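(* Let $A,B,C,L\subset\mathbb R^2$ be convex bodies with the origin in their interiors, assume $A,L\in C_+^2$, and let $\phi:[0,\infty)\to[0,\infty)$ be nondecreasing and convex, with $\phi\in C^2((0,\infty))$. Assume that the measure $\mu$ on $\mathbb R^2$ with density $e^{-\phi(\|x\|_L)}$ is a probability measure. Then \[ \begin{aligned} \mu(A;B,C)=\int_0^{2\pi}e^{-\phi(\|x_A(\theta)\|_L)}\Big[&h_B(\theta)h_C(\theta)\\ &-h_B(\theta)h_C(\theta)\,\phi'(\|x_A(\theta)\|_L)\,f_A(\theta)\,\big\langle\nabla\|x_A(\theta)\|_L,u(\theta)\big\rangle\\ &-h_B'(\theta)h_C'(\theta)\Big]\,d\theta . \end{aligned} \] Here $h_B'$ and $h_C'$ are understood in the almost-everywhere sense; changing their values on a null set does not affect the formula.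
   Context: A convex body is a compact convex subset of $\mathbb R^2$ with nonempty interior. A convex body is in the class $C_+^2$ if its boundary is of class $C^2$ and has strictly positive (Gauss) curvature. For a convex body $L$ with $0\in\operatorname{int}L$, the gauge is $\|x\|_L=\inf\{\lambda\ge0:x\in\lambda L\}$. The support function of a compact convex set $K$ is $h_K(x)=\sup_{y\in K}\langle x,y\rangle$. Put $u(\theta)=(\cos\theta,\sin\theta)$ and $h_K(\theta)=h_K(u(\theta))$; primes on $h_K$ denote derivatives with respect to $\theta$ whenever they exist. For $K\in C_+^2$, $f_K(\theta)=h_K(\theta)+h_K''(\theta)$ and $x_K(\theta)=\nabla h_K(u(\theta))$ (the point of $\partial K$ with outer unit normal $u(\theta)$). The notation $\nabla\|x_A(\theta)\|_L$ means the gradient of the function $x\mapsto\|x\|_L$ evaluated at the point $x=x_A(\theta)$. The three-body mixed measure is the mixed right derivative (whenever it exists) \[ \mu(A;B,C)=\left.\frac{\partial^2}{\partial s\,\partial t}\mu(A+sB+tC)\right|_{s=t=0^+}, \] where $+$ denotes Minkowski addition. *)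

theory Defs
  imports "HOL-Probability.Probability" "HOL-Library.Set_Algebras"
begin

definition convex_body :: "(real^2) set \<Rightarrow> bool" where
  "convex_body K \<longleftrightarrow> compact K \<and> convex K \<and> interior K \<noteq> {}"

text \<open>Signed curvature of a planar curve, from its velocity \<open>v\<close> and acceleration \<open>a\<close>;
  it is positive where the curve turns counterclockwise.\<close>

definition signed_curvature :: "real^2 \<Rightarrow> real^2 \<Rightarrow> real" where
  "signed_curvature v a = (v $ 1 * a $ 2 - v $ 2 * a $ 1) / norm v ^ 3"

text \<open>The boundary of \<open>K\<close> is a simple closed regular curve of class \<open>C\<^sup>2\<close>, given by a 1-periodic
  parametrisation. The curvature of the boundary of a convex body is taken with respect to the
  inner normal; it is the signed curvature for the counterclockwise parametrisations, and a
  simple closed curve with positive signed curvature is necessarily counterclockwise.\<close>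

definition C2_plus :: "(real^2) set \<Rightarrow> bool" where
  "C2_plus K \<longleftrightarrow> convex_body K \<and>
     (\<exists>\<gamma> \<gamma>' \<gamma>'' :: real \<Rightarrow> real^2.
        (\<forall>t. (\<gamma> has_vector_derivative \<gamma>' t) (at t)) \<and>
        (\<forall>t. (\<gamma>' has_vector_derivative \<gamma>'' t) (at t)) \<and>
        continuous_on UNIV \<gamma>'' \<and>
        (\<forall>t. \<gamma>' t \<noteq> 0) \<and>
        (\<forall>t. \<gamma> (t + 1) = \<gamma> t) \<and>
        bij_betw \<gamma> {0..<1} (frontier K) \<and>
        (\<forall>t. signed_curvature (\<gamma>' t) (\<gamma>'' t) > 0))"

text \<open>Only meaningful for open \<open>S\<close>, since the derivatives are two-sided.\<close>

definition C2_on :: "real set \<Rightarrow> (real \<Rightarrow> real) \<Rightarrow> bool" where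
  "C2_on S f \<longleftrightarrow> (\<forall>x\<in>S. f differentiable (at x)) \<and>
     (\<forall>x\<in>S. deriv f differentiable (at x)) \<and> continuous_on S (deriv (deriv f))"

definition body_gauge :: "(real^2) set \<Rightarrow> real^2 \<Rightarrow> real" where
  "body_gauge L x = Inf {r. r \<ge> 0 \<and> x \<in> (\<lambda>y. r *\<^sub>R y) ` L}"

definition support_fun :: "(real^2) set \<Rightarrow> real^2 \<Rightarrow> real" where
  "support_fun K x = (SUP y\<in>K. x \<bullet> y)"

definition unit_vec :: "real \<Rightarrow> real^2" where
  "unit_vec \<theta> = vector [cos \<theta>, sin \<theta>]"

definition support_angle :: "(real^2) set \<Rightarrow> real \<Rightarrow> real" where
  "support_angle K \<theta> = support_fun K (unit_vec \<theta>)"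

definition curv_fun :: "(real^2) set \<Rightarrow> real \<Rightarrow> real" where
  "curv_fun K \<theta> = support_angle K \<theta> + deriv (deriv (support_angle K)) \<theta>"

definition grad :: "('a::real_inner \<Rightarrow> real) \<Rightarrow> 'a \<Rightarrow> 'a" where
  "grad f x = (THE g. GDERIV f x :> g)"

definition normal_point :: "(real^2) set \<Rightarrow> real \<Rightarrow> real^2" where
  "normal_point K \<theta> = grad (support_fun K) (unit_vec \<theta>)"

definition gauge_measure :: "(real \<Rightarrow> real) \<Rightarrow> (real^2) set \<Rightarrow> (real^2) measure" where
  "gauge_measure \<phi> L = density lborel (\<lambda>x. ennreal (exp (- \<phi> (body_gauge L x))))"

text \<open>\<open>D\<close> is the iterated right derivative at \<open>s = t = 0\<close>: first in \<open>t\<close> at \<open>0\<close>, for \<open>s = 0\<close> and all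
  small \<open>s > 0\<close>, then in \<open>s\<close> at \<open>0\<close>.\<close>

definition has_mixed_right_derivative :: "(real \<Rightarrow> real \<Rightarrow> real) \<Rightarrow> real \<Rightarrow> bool" where
  "has_mixed_right_derivative F D \<longleftrightarrow>
     (\<exists>\<epsilon>>0. \<exists>G. (\<forall>s\<in>{0..<\<epsilon>}. ((\<lambda>t. F s t) has_real_derivative G s) (at_right 0)) \<and>
        (G has_real_derivative D) (at_right 0))"

text \<open>The mixed measure \<open>\<mu>(A; B, C)\<close> exists and equals \<open>D\<close>. Here \<open>+\<close> on sets is Minkowski addition.\<close>

definition has_mixed_measure ::
  "(real^2) measure \<Rightarrow> (real^2) set \<Rightarrow> (real^2) set \<Rightarrow> (real^2) set \<Rightarrow> real \<Rightarrow> bool" where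
  "has_mixed_measure \<mu> A B C D \<longleftrightarrow>
     has_mixed_right_derivative
       (\<lambda>s t. measure \<mu> (A + (\<lambda>x. s *\<^sub>R x) ` B + (\<lambda>x. t *\<^sub>R x) ` C)) D"

lemma has_mixed_right_derivative_unique:
  assumes "has_mixed_right_derivative F D" "has_mixed_right_derivative F E"
  shows "D = E"
proof -
  have uniq: "a = b" if "(f has_real_derivative a) (at_right 0)" "(f has_real_derivative b) (at_right 0)"
    for f :: "real \<Rightarrow> real" and a b
    using that tendsto_unique[OF trivial_limit_at_right_real]
    unfolding has_field_derivative_iff by blast
  obtain e1 G where 1: "e1 > 0" "\<And>s. s \<in> {0..<e1} \<Longrightarrow> (F s has_real_derivative G s) (at_right 0)"
      "(G has_real_derivative D) (at_right 0)"
    using assms(1) unfolding has_mixed_right_derivative_def by blast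
  obtain e2 H where 2: "e2 > 0" "\<And>s. s \<in> {0..<e2} \<Longrightarrow> (F s has_real_derivative H s) (at_right 0)"
      "(H has_real_derivative E) (at_right 0)"
    using assms(2) unfolding has_mixed_right_derivative_def by blast
  define e where "e = min e1 e2"
  have e: "e > 0" using 1(1) 2(1) by (simp add: e_def)
  have eq: "G s = H s" if "0 \<le> s" "s < e" for s
    using that by (intro uniq[OF 1(2) 2(2)]) (auto simp: e_def)
  have "\<forall>\<^sub>F s in at_right 0. (G s - G 0) / (s - 0) = (H s - H 0) / (s - 0)"
    unfolding eventually_at_right_field using e eq by (intro exI[of _ e]) auto
  then have "(H has_real_derivative D) (at_right 0)"
    using 1(3) unfolding has_field_derivative_iff by (rule Lim_transform_eventually[rotated])
  then show ?thesis using uniq 2(3) by blast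
qed

end

theory Submission
  imports Defs
begin

text \<open>Write \<open>u = unit_vec\<close>, \<open>h\<close> for the support function of \<open>A\<close> in the angle, \<open>f = h + h''\<close>, and \<open>w\<close> for the
  density of \<open>\<mu>\<close>. The map \<open>(\<theta>, r) \<mapsto> x\<^sub>A(\<theta>) + r u(\<theta>)\<close> is a bijection from \<open>[0, 2\<pi>) \<times> (0, \<infinity>)\<close> onto the
  complement of \<open>A\<close> with Jacobian \<open>f(\<theta>) + r\<close>, and in these coordinates \<open>A + s B + t C\<close> is the region
  below a height \<open>\<rho>(\<theta>; s, t)\<close>. As an infimum of functions affine in \<open>(s, t)\<close>, the height is concave, so
  its right derivative in \<open>t\<close> exists for every \<open>\<theta>\<close>. With \<open>H = s h\<^sub>B + t h\<^sub>C\<close> one has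
  \<open>\<rho> = H - H'\<^sup>2 / (2 f) + o(s\<^sup>2 + t\<^sup>2)\<close> wherever \<open>h\<^sub>B\<close> and \<open>h\<^sub>C\<close> are differentiable, and concavity turns this
  into the first-order expansion \<open>h\<^sub>C - s h\<^sub>B' h\<^sub>C' / f + o(s)\<close> of that right derivative. Since
  \<open>\<mu>(A + s B + t C) - \<mu>(A)\<close> is the integral over \<open>\<theta>\<close> of \<open>w (f + r)\<close> over \<open>0 < r \<le> \<rho>\<close>, two applications of
  dominated convergence give the formula.\<close>

section \<open>Support functions\<close>

text \<open>The bodies \<open>B\<close> and \<open>C\<close> are arbitrary, so
  \<open>h\<^sub>B\<close> and \<open>h\<^sub>C\<close> are merely Lipschitz, and differentiable off
  a countable set. The smoothness of the height in \<open>(s, t)\<close> has to come from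
  \<open>A\<close>: its gap function grows quadratically, so the height falls short of the upper
  bound \<open>H\<close> by at most a quadratic amount, uniformly in \<theta>; this supplies the
  dominating functions. An \<open>o(s\<^sup>2 + t\<^sup>2)\<close> expansion alone says nothing
  about a derivative in \<open>t\<close> at \<open>s > 0\<close>. To squeeze that right derivative
  from above as well, concavity needs heights with \<open>t < 0\<close>. There
  \<open>s h\<^sub>B + t h\<^sub>C\<close> need not be a support function, but the infimum defining
  the height only asks that it be nonnegative. This holds for \<open>t \<ge> - \<kappa> s\<close> as
  soon as \<open>\<kappa> h\<^sub>C \<le> h\<^sub>B\<close>, and the origin in the interior of
  \<open>B\<close> provides such a \<kappa>. In the end the weight \<open>w f\<close> on the
  boundary cancels the \<open>1 / f\<close> of the expansion, which is why the term
  \<open>h\<^sub>B' h\<^sub>C'\<close> carries no curvature.\<close>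

definition unit_tangent :: "real \<Rightarrow> real^2" where
  "unit_tangent \<theta> = vector [- sin \<theta>, cos \<theta>]"

lemma inner_vec2: "x \<bullet> y = x $ 1 * y $ 1 + x $ 2 * y $ 2" for x y :: "real^2"
  by (simp add: inner_vec_def sum_2)

lemma inner_has_real_derivative:
  "(\<gamma> has_vector_derivative \<gamma>') F \<Longrightarrow> ((\<lambda>s. \<gamma> s \<bullet> v) has_real_derivative \<gamma>' \<bullet> v) F"
  unfolding has_real_derivative_iff_has_vector_derivative
  by (rule bounded_linear.has_vector_derivative[OF bounded_linear_inner_left])

lemma vec2_eq_iff: "x = y \<longleftrightarrow> x $ 1 = y $ 1 \<and> x $ 2 = y $ 2" for x y :: "real^2"
  by (simp add: vec_eq_iff forall_2)

lemma unit_vec_nth [simp]: "unit_vec \<theta> $ 1 = cos \<theta>" "unit_vec \<theta> $ 2 = sin \<theta>"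
  by (simp_all add: unit_vec_def)

lemma unit_tangent_nth [simp]: "unit_tangent \<theta> $ 1 = - sin \<theta>" "unit_tangent \<theta> $ 2 = cos \<theta>"
  by (simp_all add: unit_tangent_def)

lemma inner_unit_vec:
  "unit_vec a \<bullet> unit_vec b = cos (b - a)"
  "unit_tangent a \<bullet> unit_vec b = sin (b - a)"
  "unit_vec a \<bullet> unit_tangent b = - sin (b - a)"
  "unit_tangent a \<bullet> unit_tangent b = cos (b - a)"
  by (simp_all add: inner_vec2 cos_diff sin_diff algebra_simps)

lemma norm_unit_vec [simp]: "norm (unit_vec \<theta>) = 1" "norm (unit_tangent \<theta>) = 1"
  by (simp_all add: norm_eq_sqrt_inner inner_unit_vec)

lemma unit_vec_decomp: "x = (x \<bullet> unit_vec \<theta>) *\<^sub>R unit_vec \<theta> + (x \<bullet> unit_tangent \<theta>) *\<^sub>R unit_tangent \<theta>"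
proof -
  have s: "sin \<theta> * sin \<theta> = 1 - cos \<theta> * cos \<theta>"
    using sin_cos_squared_add3[of \<theta>] by linarith
  have 1: "a * (cos \<theta> * cos \<theta>) + a * (sin \<theta> * sin \<theta>) = a" for a
    by (simp add: s algebra_simps)
  show ?thesis
    using 1[of "x$1"] 1[of "x$2"]
    by (simp add: vec2_eq_iff inner_vec2 algebra_simps)
qed

lemma unit_vec_vector_derivative:
  "(unit_vec has_vector_derivative unit_tangent \<theta>) (at \<theta> within S)"
  "(unit_tangent has_vector_derivative - unit_vec \<theta>) (at \<theta> within S)"
proof -
  have eq: "unit_vec = (\<lambda>\<theta>. cos \<theta> *\<^sub>R axis 1 1 + sin \<theta> *\<^sub>R axis 2 1)"
    "unit_tangent = (\<lambda>\<theta>. (- sin \<theta>) *\<^sub>R axis 1 1 + cos \<theta> *\<^sub>R axis 2 1)"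
    by (auto simp: fun_eq_iff vec2_eq_iff axis_def)
  show "(unit_vec has_vector_derivative unit_tangent \<theta>) (at \<theta> within S)"
    unfolding eq by (auto intro!: derivative_eq_intros simp: has_real_derivative_iff_has_vector_derivative[symmetric])
  show "(unit_tangent has_vector_derivative - unit_vec \<theta>) (at \<theta> within S)"
    unfolding eq by (auto intro!: derivative_eq_intros simp: has_real_derivative_iff_has_vector_derivative[symmetric])
qed

lemma continuous_unit_vec [continuous_intros]:
  "continuous_on S g \<Longrightarrow> continuous_on S (\<lambda>x. unit_vec (g x))"
  "continuous_on S g \<Longrightarrow> continuous_on S (\<lambda>x. unit_tangent (g x))"
proof -
  have "continuous_on UNIV unit_vec" "continuous_on UNIV unit_tangent"
    by (auto simp: continuous_on_eq_continuous_within
      intro!: has_vector_derivative_continuous[OF unit_vec_vector_derivative(1)]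
      has_vector_derivative_continuous[OF unit_vec_vector_derivative(2)])
  then show "continuous_on S g \<Longrightarrow> continuous_on S (\<lambda>x. unit_vec (g x))"
    "continuous_on S g \<Longrightarrow> continuous_on S (\<lambda>x. unit_tangent (g x))"
    by (auto intro: continuous_on_compose2)
qed

lemma norm_vec2_sq: "(norm v)\<^sup>2 = (v$1)\<^sup>2 + (v$2)\<^sup>2" for v :: "real^2"
  by (simp add: power2_norm_eq_inner inner_vec2) (simp add: power2_eq_square)

lemma unit_vector_cases:
  assumes "norm (v :: real^2) = 1"
  obtains \<theta> where "0 \<le> \<theta>" "\<theta> < 2*pi" "v = unit_vec \<theta>"
proof -
  have "(v$1)\<^sup>2 + (v$2)\<^sup>2 = 1" using norm_vec2_sq[of v] assms by simp
  from sincos_total_2pi[OF this] that show thesis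
    by (metis (no_types) unit_vec_nth vec2_eq_iff)
qed

lemma polar_decomposition:
  assumes "(v :: real^2) \<noteq> 0"
  obtains \<theta> where "0 \<le> \<theta>" "\<theta> < 2*pi" "v = norm v *\<^sub>R unit_vec \<theta>"
proof -
  have "norm (v /\<^sub>R norm v) = 1" using assms by simp
  then obtain \<theta> where "0 \<le> \<theta>" "\<theta> < 2*pi" "v /\<^sub>R norm v = unit_vec \<theta>"
    by (rule unit_vector_cases)
  moreover from this(3) have "v = norm v *\<^sub>R unit_vec \<theta>" using assms by (metis norm_eq_zero scaleR_right_imp_eq right_inverse scaleR_one scaleR_scaleR)
  ultimately show thesis using that by blast
qed

section \<open>Maximisers, Lipschitz bounds, Minkowski sums and gradients of support
  functions\<close>

lemma support_fun_attained:
  assumes "compact K" "K \<noteq> {}"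
  obtains y where "y \<in> K" "x \<bullet> y = support_fun K x" "\<And>z. z \<in> K \<Longrightarrow> x \<bullet> z \<le> x \<bullet> y"
proof -
  have "continuous_on K (\<lambda>y. x \<bullet> y)" by (intro continuous_intros)
  from continuous_attains_sup[OF assms this] obtain y where y: "y \<in> K" "\<And>z. z \<in> K \<Longrightarrow> x \<bullet> z \<le> x \<bullet> y"
    by blast
  have "support_fun K x = x \<bullet> y"
    unfolding support_fun_def using y by (intro cSup_eq_maximum) auto
  then show thesis using that y by metis
qed

lemma support_fun_ge:
  assumes "compact K" "y \<in> K" shows "x \<bullet> y \<le> support_fun K x"
  using support_fun_attained[OF assms(1), of x] assms(2) by (metis empty_iff)

lemma support_fun_le:
  assumes "compact K" "K \<noteq> {}" "\<And>y. y \<in> K \<Longrightarrow> x \<bullet> y \<le> c" shows "support_fun K x \<le> c"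
  using support_fun_attained[OF assms(1,2), of x] assms(3) by metis

lemma support_fun_scaleR:
  assumes "compact K" "K \<noteq> {}" "r \<ge> 0" shows "support_fun K (r *\<^sub>R x) = r * support_fun K x"
proof -
  obtain y where y: "y \<in> K" "x \<bullet> y = support_fun K x" "\<And>z. z \<in> K \<Longrightarrow> x \<bullet> z \<le> x \<bullet> y"
    using support_fun_attained[OF assms(1,2)] by metis
  show ?thesis
  proof (rule antisym)
    show "support_fun K (r *\<^sub>R x) \<le> r * support_fun K x"
      by (rule support_fun_le[OF assms(1,2)]) (simp add: y(2)[symmetric] y(3) assms(3) mult_left_mono)
    show "r * support_fun K x \<le> support_fun K (r *\<^sub>R x)"
      using support_fun_ge[OF assms(1) y(1), of "r *\<^sub>R x"] y by simp
  qed
qed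

lemma support_fun_lipschitz:
  assumes "compact K" "K \<noteq> {}" and M: "\<And>y. y \<in> K \<Longrightarrow> norm y \<le> M"
  shows "\<bar>support_fun K x - support_fun K z\<bar> \<le> M * norm (x - z)"
proof -
  have *: "support_fun K x \<le> support_fun K z + M * norm (x - z)" for x z
  proof (rule support_fun_le[OF assms(1,2)])
    fix y assume y: "y \<in> K"
    have "(x - z) \<bullet> y \<le> norm (x - z) * norm y" by (rule norm_cauchy_schwarz)
    also have "\<dots> \<le> norm (x - z) * M" using M[OF y] by (simp add: mult_left_mono)
    finally show "x \<bullet> y \<le> support_fun K z + M * norm (x - z)"
      using support_fun_ge[OF assms(1) y, of z] by (simp add: inner_diff_left mult.commute)
  qed
  show ?thesis using *[of x z] *[of z x] by (simp add: norm_minus_commute)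
qed

lemma support_fun_continuous:
  assumes "compact K" "K \<noteq> {}" shows "continuous_on S (support_fun K)"
proof -
  obtain M where M: "M > 0" "\<And>y. y \<in> K \<Longrightarrow> norm y \<le> M"
    using compact_imp_bounded[OF assms(1)] by (meson bounded_pos)
  have "\<exists>L. L-lipschitz_on UNIV (support_fun K)"
    by (rule exI[of _ M], rule lipschitz_onI) (use M support_fun_lipschitz[OF assms M(2)] in \<open>auto simp: dist_norm\<close>)
  then show ?thesis using lipschitz_on_continuous_on continuous_on_subset by blast
qed

lemma compact_set_plus:
  fixes K M :: "'a::real_normed_vector set"
  assumes "compact K" "compact M" shows "compact (K + M)"
proof -
  have "K + M = (\<Union>x\<in>K. \<Union>y\<in>M. {x + y})" by (auto simp: set_plus_def)
  then show ?thesis using compact_sums'[OF assms] by (simp only:)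
qed

lemma support_fun_plus:
  assumes "compact K" "K \<noteq> {}" "compact M" "M \<noteq> {}"
  shows "support_fun (K + M) x = support_fun K x + support_fun M x"
proof -
  obtain y where y: "y \<in> K" "x \<bullet> y = support_fun K x" using support_fun_attained[OF assms(1,2)] by metis
  obtain z where z: "z \<in> M" "x \<bullet> z = support_fun M x" using support_fun_attained[OF assms(3,4)] by metis
  have c: "compact (K + M)" by (rule compact_set_plus[OF assms(1,3)])
  show ?thesis
  proof (rule antisym)
    show "support_fun (K + M) x \<le> support_fun K x + support_fun M x"
      using y z by (intro support_fun_le[OF c]) 
        (auto simp: set_plus_def inner_add_right intro!: add_mono support_fun_ge assms)
    have "y + z \<in> K + M" using y z by (auto simp: set_plus_def)
    from support_fun_ge[OF c this, of x] show "support_fun K x + support_fun M x \<le> support_fun (K + M) x"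
      using y z by (simp add: inner_add_right)
  qed
qed

lemma support_fun_image_scaleR:
  assumes "compact K" "K \<noteq> {}" "s \<ge> 0"
  shows "support_fun ((\<lambda>x. s *\<^sub>R x) ` K) x = s * support_fun K x"
proof -
  have "support_fun ((\<lambda>x. s *\<^sub>R x) ` K) x = support_fun K (s *\<^sub>R x)"
    by (simp add: support_fun_def image_image)
  then show ?thesis using support_fun_scaleR[OF assms] by simp
qed

lemma mem_iff_support_angle:
  assumes "compact K" "convex K" "K \<noteq> {}"
  shows "x \<in> K \<longleftrightarrow> (\<forall>\<theta>. x \<bullet> unit_vec \<theta> \<le> support_angle K \<theta>)"
proof
  assume "x \<in> K" then show "\<forall>\<theta>. x \<bullet> unit_vec \<theta> \<le> support_angle K \<theta>"
    using support_fun_ge[OF assms(1)] by (auto simp: support_angle_def inner_commute)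
next
  assume *: "\<forall>\<theta>. x \<bullet> unit_vec \<theta> \<le> support_angle K \<theta>"
  show "x \<in> K"
  proof (rule ccontr)
    assume "x \<notin> K"
    from separating_hyperplane_closed_point[OF assms(2) compact_imp_closed[OF assms(1)] this]
    obtain a b where ab: "a \<bullet> x < b" "\<forall>y\<in>K. b < a \<bullet> y" by blast
    \<comment> \<open>The separation puts \<open>K\<close> on the upper side of the hyperplane, so
      the outward direction is \<open>- a\<close>.\<close>
    have "- a \<noteq> 0" using ab assms(3) by auto
    then obtain \<theta> where \<theta>: "- a = norm (- a) *\<^sub>R unit_vec \<theta>" by (rule polar_decomposition)
    obtain y where y: "y \<in> K" "unit_vec \<theta> \<bullet> y = support_fun K (unit_vec \<theta>)"
      using support_fun_attained[OF assms(1,3)] by metis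
    have "(- a) \<bullet> y < (- a) \<bullet> x" using ab y(1) by auto
    also have "\<dots> = norm (-a) * (x \<bullet> unit_vec \<theta>)" by (subst \<theta>) (simp add: inner_commute)
    also have "\<dots> \<le> norm (-a) * (unit_vec \<theta> \<bullet> y)"
      using * y by (intro mult_left_mono) (auto simp: support_angle_def)
    also have "\<dots> = (- a) \<bullet> y" by (subst (2) \<theta>) simp
    finally show False by simp
  qed
qed

text \<open>Danskin's theorem: the maximisers at nearby points converge to the unique maximiser.\<close>

lemma support_fun_gderiv:
  assumes K: "compact K" "y \<in> K" and max: "x \<bullet> y = support_fun K x"
    and uniq: "\<And>z. z \<in> K \<Longrightarrow> x \<bullet> z = support_fun K x \<Longrightarrow> z = y"
  shows "GDERIV (support_fun K) x :> y"
proof -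
  have ne: "K \<noteq> {}" using K by auto
  have "\<exists>m. \<forall>z. m z \<in> K \<and> (x + z) \<bullet> m z = support_fun K (x + z)"
  proof -
    have "\<exists>y. y \<in> K \<and> (x + z) \<bullet> y = support_fun K (x + z)" for z
      using support_fun_attained[OF K(1) ne, of "x + z"] by metis
    then show ?thesis by metis
  qed
  then obtain m where m: "\<And>z. m z \<in> K" "\<And>z. (x + z) \<bullet> m z = support_fun K (x + z)" by blast
  obtain M where M: "M > 0" "\<And>y. y \<in> K \<Longrightarrow> norm y \<le> M"
    using compact_imp_bounded[OF K(1)] by (meson bounded_pos)
  have lim: "(m \<longlongrightarrow> y) (at 0)"
  proof (rule topological_tendstoI)
    fix U assume U: "open U" "y \<in> U"
    \<comment> \<open>Compactness of \<open>K - U\<close>: away from the maximiser the functional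
      misses its maximum by a fixed amount \<open>d\<close>.\<close>
    have near: "\<exists>d>0. \<forall>z\<in>K - U. x \<bullet> z \<le> support_fun K x - d"
    proof (cases "K - U = {}")
      case True then show ?thesis by (intro exI[of _ 1]) auto
    next
      case False
      have "compact (K - U)" using compact_diff[OF K(1) U(1)] .
      moreover have "continuous_on (K - U) (\<lambda>z. x \<bullet> z)" by (intro continuous_intros)
      ultimately obtain z where z: "z \<in> K - U" "\<And>w. w \<in> K - U \<Longrightarrow> x \<bullet> w \<le> x \<bullet> z"
        using continuous_attains_sup[OF _ False] by metis
      have "x \<bullet> z < support_fun K x" using uniq[of z] support_fun_ge[OF K(1), of z x] z(1) U(2) by fastforce
      then show ?thesis using z by (intro exI[of _ "support_fun K x - x \<bullet> z"]) auto
    qed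
    then obtain d where d: "d > 0" "\<And>z. z \<in> K - U \<Longrightarrow> x \<bullet> z \<le> support_fun K x - d" by blast
    \<comment> \<open>Both \<open>z \<bullet> m z\<close> and the change of the support function are
      at most \<open>M * norm z\<close>, hence below \<open>d / 2\<close>, so together they cannot
      make up the deficit \<open>d\<close>.\<close>
    have "m z \<in> U" if z: "norm z < d / (2 * M)" for z
    proof (rule ccontr)
      assume "m z \<notin> U"
      then have "x \<bullet> m z \<le> support_fun K x - d" using d m by auto
      moreover have "z \<bullet> m z \<le> norm z * norm (m z)" by (rule norm_cauchy_schwarz)
      moreover have "norm z * norm (m z) \<le> norm z * M" using M(2)[OF m(1)] by (simp add: mult_left_mono)
      moreover have "norm z * M < d / 2" using z M(1) by (simp add: field_simps)
      moreover have "\<bar>support_fun K x - support_fun K (x + z)\<bar> \<le> M * norm z"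
        using support_fun_lipschitz[OF K(1) ne M(2), of x "x + z"] by simp
      ultimately show False using m(2)[of z] by (simp add: inner_add_left mult.commute)
    qed
    then show "\<forall>\<^sub>F z in at 0. m z \<in> U"
      unfolding eventually_at using d(1) M(1) by (intro exI[of _ "d / (2 * M)"]) auto
  qed
  \<comment> \<open>The remainder is nonnegative by testing \<open>x + z\<close> against
    \<open>y\<close>, and at most \<open>z \<bullet> (m z - y)\<close> by testing \<open>x\<close>
    against \<open>m z\<close>.\<close>
  have bound: "norm (norm (support_fun K (x + z) - support_fun K x - z \<bullet> y) / norm z) \<le> norm (m z - y)" for z
  proof (cases "z = 0")
    case False
    have 1: "(x + z) \<bullet> y \<le> support_fun K (x + z)" by (rule support_fun_ge[OF K])
    have 2: "x \<bullet> m z \<le> support_fun K x" by (rule support_fun_ge[OF K(1) m(1)])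
    have 3: "z \<bullet> (m z - y) \<le> norm z * norm (m z - y)" by (rule norm_cauchy_schwarz)
    have "support_fun K (x + z) - support_fun K x - z \<bullet> y \<le> norm z * norm (m z - y)"
      using 2 3 m(2)[of z] by (simp add: inner_add_left inner_diff_right)
    moreover have "0 \<le> support_fun K (x + z) - support_fun K x - z \<bullet> y"
      using 1 max by (simp add: inner_add_left)
    ultimately show ?thesis using False by (simp add: divide_simps mult.commute)
  qed auto
  have "((\<lambda>z. norm (support_fun K (x + z) - support_fun K x - z \<bullet> y) / norm z) \<longlongrightarrow> 0) (at 0)"
  proof (rule Lim_null_comparison)
    show "((\<lambda>z. norm (m z - y)) \<longlongrightarrow> 0) (at 0)"
      using lim by (intro tendsto_norm_zero LIM_zero)
    show "\<forall>\<^sub>F z in at 0. norm (norm (support_fun K (x + z) - support_fun K x - z \<bullet> y) / norm z) \<le> norm (m z - y)"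
      using bound by (intro always_eventually allI)
  qed
  then show ?thesis
    unfolding gderiv_def has_derivative_at by (auto intro: bounded_linear_inner_left)
qed

lemma grad_eq:
  assumes "GDERIV f x :> g" shows "grad f x = g"
proof -
  have "g' = g" if "GDERIV f x :> g'" for g'
  proof -
    have "(\<lambda>h. h \<bullet> g') = (\<lambda>h. h \<bullet> g)"
      using that assms unfolding gderiv_def by (rule has_derivative_unique)
    then have "h \<bullet> g' = h \<bullet> g" for h by metis
    then show ?thesis by (metis inner_commute vector_eq_ldot)
  qed
  then show ?thesis unfolding grad_def using assms by blast
qed

section \<open>Regularity of support functions and gauges\<close>

lemma support_angle_lipschitz:
  assumes "compact K" "K \<noteq> {}"
  obtains M where "M > 0" "\<And>\<theta>. \<bar>support_angle K \<theta>\<bar> \<le> M"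
    "\<And>\<theta> \<psi>. \<bar>support_angle K \<theta> - support_angle K \<psi>\<bar> \<le> M * \<bar>\<theta> - \<psi>\<bar>"
proof -
  obtain M where M: "M > 0" "\<And>y. y \<in> K \<Longrightarrow> norm y \<le> M"
    using compact_imp_bounded[OF assms(1)] by (meson bounded_pos)
  \<comment> \<open>A chord is at most its arc: the chord has length
    \<open>2 * \<bar>sin ((\<theta> - \<psi>) / 2)\<bar>\<close>.\<close>
  have u: "norm (unit_vec \<theta> - unit_vec \<psi>) \<le> \<bar>\<theta> - \<psi>\<bar>" for \<theta> \<psi>
  proof -
    have "(norm (unit_vec \<theta> - unit_vec \<psi>))\<^sup>2 = 2 - 2 * cos (\<theta> - \<psi>)"
      by (simp add: power2_norm_eq_inner inner_diff_left inner_diff_right inner_unit_vec)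
        (metis cos_minus minus_diff_eq)
    also have "\<dots> = (2 * sin ((\<theta> - \<psi>) / 2))\<^sup>2"
    proof -
      define x where "x = (\<theta> - \<psi>) / 2"
      have "\<theta> - \<psi> = 2 * x" by (simp add: x_def)
      then show ?thesis by (simp add: cos_double_sin power2_eq_square)
    qed
    also have "\<dots> \<le> \<bar>\<theta> - \<psi>\<bar>\<^sup>2"
      using abs_sin_x_le_abs_x[of "(\<theta> - \<psi>) / 2"] by (subst power2_abs[symmetric], intro power_mono) (auto simp: abs_mult)
    finally show ?thesis by (rule power2_le_imp_le) simp
  qed
  show thesis
  proof (rule that[OF M(1)])
    fix \<theta> \<psi>
    show "\<bar>support_angle K \<theta>\<bar> \<le> M"
    proof -
      have "support_fun K 0 = 0" using support_fun_scaleR[OF assms, of 0 0] by simp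
      then show ?thesis using support_fun_lipschitz[OF assms M(2), of "unit_vec \<theta>" 0]
        by (simp add: support_angle_def)
    qed
    have "\<bar>support_angle K \<theta> - support_angle K \<psi>\<bar> \<le> M * norm (unit_vec \<theta> - unit_vec \<psi>)"
      unfolding support_angle_def by (rule support_fun_lipschitz[OF assms M(2)])
    also have "\<dots> \<le> M * \<bar>\<theta> - \<psi>\<bar>" using u M(1) by (simp add: mult_left_mono)
    finally show "\<bar>support_angle K \<theta> - support_angle K \<psi>\<bar> \<le> M * \<bar>\<theta> - \<psi>\<bar>" .
  qed
qed

lemma support_angle_pos:
  assumes "compact K" "0 \<in> interior K"
  obtains m where "m > 0" "\<And>\<theta>. m \<le> support_angle K \<theta>"
proof -
  obtain e where e: "e > 0" "cball 0 e \<subseteq> K" using assms(2) mem_interior_cball by blast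
  have "e \<le> support_angle K \<theta>" for \<theta>
  proof -
    have "e *\<^sub>R unit_vec \<theta> \<in> K" using e by (intro subsetD[OF e(2)]) simp
    from support_fun_ge[OF assms(1) this, of "unit_vec \<theta>"] show ?thesis
      by (simp add: support_angle_def inner_unit_vec)
  qed
  then show thesis using that e(1) by blast
qed

text \<open>A function with a subgradient \<open>a\<close> everywhere is differentiable wherever the monotone
  function \<open>a\<close> is continuous.\<close>

lemma subgradient_countable_nondifferentiable:
  fixes k a :: "real \<Rightarrow> real"
  assumes sub: "\<And>x y. k x + a x * (y - x) \<le> k y"
  shows "countable {x. \<not> k differentiable (at x)}"
proof -
  have "mono a"
  proof (rule monoI)
    fix x y :: real assume "x \<le> y"
    have "k x + a x * (y - x) + a y * (x - y) \<le> k x" using sub[of x y] sub[of y x] by linarith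
    then have "(a x - a y) * (y - x) \<le> 0" by (simp add: algebra_simps)
    then show "a x \<le> a y" using \<open>x \<le> y\<close> by (cases "x = y") (auto simp: mult_le_0_iff)
  qed
  then have "countable {x. \<not> isCont a x}" by (rule mono_ctble_discont)
  moreover have "k differentiable (at x)" if "isCont a x" for x
  proof -
    have "((\<lambda>y. (k y - k x) / (y - x)) \<longlongrightarrow> a x) (at x)"
    proof (rule LIM_zero_cancel)
      have "((\<lambda>y. a y - a x) \<longlongrightarrow> 0) (at x)"
        using that by (simp add: isCont_def LIM_zero)
      then have lim: "((\<lambda>y. norm (a y - a x)) \<longlongrightarrow> 0) (at x)" by (rule tendsto_norm_zero)
      show "((\<lambda>y. (k y - k x) / (y - x) - a x) \<longlongrightarrow> 0) (at x)"
      proof (rule Lim_null_comparison[OF _ lim])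
        \<comment> \<open>The two subgradient inequalities trap the difference quotient between
          \<open>a x\<close> and \<open>a y\<close>.\<close>
        have "norm ((k y - k x) / (y - x) - a x) \<le> norm (a y - a x)" if "y \<noteq> x" for y
        proof -
          have 1: "a x * (y - x) \<le> k y - k x" "k y - k x \<le> a y * (y - x)"
            using sub[of x y] sub[of y x] by (simp_all add: algebra_simps)
          show ?thesis
          proof (cases "y > x")
            case True
            then have "a x \<le> (k y - k x) / (y - x)" "(k y - k x) / (y - x) \<le> a y"
              using 1 by (simp_all add: pos_le_divide_eq pos_divide_le_eq)
            then show ?thesis by simp
          next
            case False
            then have "y - x < 0" using that by simp
            then have "(k y - k x) / (y - x) \<le> a x" "a y \<le> (k y - k x) / (y - x)"
              using 1 by (simp_all add: neg_le_divide_eq neg_divide_le_eq)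
            then show ?thesis by simp
          qed
        qed
        then show "\<forall>\<^sub>F y in at x. norm ((k y - k x) / (y - x) - a x) \<le> norm (a y - a x)"
          by (auto simp: eventually_at intro: exI[of _ 1])
      qed
    qed
    then have "(k has_real_derivative a x) (at x)" by (simp add: has_field_derivative_iff)
    then show ?thesis by (auto simp: real_differentiable_def)
  qed
  ultimately show ?thesis by (auto elim: countable_subset[rotated])
qed

text \<open>Adding a multiple of \<open>\<theta>\<^sup>2\<close> makes \<open>h\<^sub>K\<close> convex, because \<open>h\<^sub>K + h\<^sub>K'' \<ge> 0\<close>.\<close>

lemma support_angle_countable_nondifferentiable:
  assumes "compact K" "K \<noteq> {}"
  shows "countable {\<theta>. \<not> support_angle K differentiable (at \<theta>)}"
proof -
  obtain M where M: "M > 0" "\<And>y. y \<in> K \<Longrightarrow> norm y \<le> M"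
    using compact_imp_bounded[OF assms(1)] by (meson bounded_pos)
  have "\<exists>m. \<forall>\<theta>. m \<theta> \<in> K \<and> unit_vec \<theta> \<bullet> m \<theta> = support_angle K \<theta>"
  proof -
    have "\<exists>y. y \<in> K \<and> unit_vec \<theta> \<bullet> y = support_angle K \<theta>" for \<theta>
      unfolding support_angle_def using support_fun_attained[OF assms, of "unit_vec \<theta>"] by metis
    then show ?thesis by metis
  qed
  then obtain m where m: "\<And>\<theta>. m \<theta> \<in> K" "\<And>\<theta>. unit_vec \<theta> \<bullet> m \<theta> = support_angle K \<theta>" by blast
  define k where "k \<theta> = support_angle K \<theta> + M * \<theta>\<^sup>2 / 2" for \<theta>
  define a where "a \<theta> = unit_tangent \<theta> \<bullet> m \<theta> + M * \<theta>" for \<theta>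
  have "k \<theta> + a \<theta> * (\<psi> - \<theta>) \<le> k \<psi>" for \<theta> \<psi>
  proof -
    \<comment> \<open>The contribution of the single point \<open>m \<theta>\<close>: it lies below
      \<open>k\<close>, touches it at \<theta>, and is convex because \<open>M\<close> bounds the
      norms on \<open>K\<close>. Its tangent at \<theta> therefore stays below
      \<open>k\<close>.\<close>
    define g where "g \<psi> = unit_vec \<psi> \<bullet> m \<theta> + M * \<psi>\<^sup>2 / 2" for \<psi>
    define g' where "g' \<psi> = unit_tangent \<psi> \<bullet> m \<theta> + M * \<psi>" for \<psi>
    have d1: "(g has_real_derivative g' \<psi>) (at \<psi> within S)" for \<psi> S
      unfolding g_def[abs_def] g'_def
      by (auto intro!: derivative_eq_intros inner_has_real_derivative unit_vec_vector_derivative)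
    have d2: "(g' has_real_derivative M - unit_vec \<psi> \<bullet> m \<theta>) (at \<psi> within S)" for \<psi> S
      unfolding g'_def[abs_def]
      by (auto intro!: derivative_eq_intros inner_has_real_derivative unit_vec_vector_derivative)
    have "convex_on UNIV g"
    proof (rule f''_ge0_imp_convex[OF _ d1 d2])
      fix \<psi>
      have "unit_vec \<psi> \<bullet> m \<theta> \<le> norm (unit_vec \<psi>) * norm (m \<theta>)" by (rule norm_cauchy_schwarz)
      then show "0 \<le> M - unit_vec \<psi> \<bullet> m \<theta>" using M(2)[OF m(1)[of \<theta>]] by simp
    qed auto
    then have "g \<psi> - g \<theta> \<ge> g' \<theta> * (\<psi> - \<theta>)"
      using convex_on_imp_above_tangent[of UNIV g \<theta> \<psi> "g' \<theta>"] d1 by auto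
    moreover have "g \<psi> \<le> k \<psi>" using support_fun_ge[OF assms(1) m(1), of "unit_vec \<psi>" \<theta>]
      by (simp add: g_def k_def support_angle_def)
    moreover have "g \<theta> = k \<theta>" "g' \<theta> = a \<theta>" using m(2)[of \<theta>] by (simp_all add: g_def k_def g'_def a_def)
    ultimately show ?thesis by simp
  qed
  then have "countable {\<theta>. \<not> k differentiable (at \<theta>)}" by (rule subgradient_countable_nondifferentiable)
  moreover have "support_angle K differentiable (at \<theta>)" if "k differentiable (at \<theta>)" for \<theta>
  proof -
    have "(\<lambda>\<theta>. k \<theta> - M * \<theta>\<^sup>2 / 2) differentiable (at \<theta>)"
      by (intro differentiable_diff that) (auto intro!: derivative_intros)
    then show ?thesis by (simp add: k_def)
  qed
  ultimately show ?thesis by (auto elim: countable_subset[rotated])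
qed

lemma countable_imp_AE_lebesgue:
  fixes P :: "real \<Rightarrow> bool"
  assumes "countable {x. \<not> P x}" shows "AE x in lebesgue. P x"
proof -
  have "AE x in lborel. P x"
    by (rule AE_I'[of "{x. \<not> P x}"]) (auto intro: countable_imp_null_set_lborel assms)
  then show ?thesis by (rule AE_completion)
qed

section \<open>Gauges as support functions of polar sets\<close>

definition polar_set :: "(real^2) set \<Rightarrow> (real^2) set" where
  "polar_set L = {v. \<forall>y\<in>L. y \<bullet> v \<le> 1}"

text \<open>A ball of radius \<open>e\<close> inside \<open>L\<close> forces norms of at most
  \<open>1 / e\<close> in the polar set: test \<open>v\<close> against the point of the ball in the
  direction of \<open>v\<close>.\<close>

lemma compact_polar_set:
  assumes "0 \<in> interior L" shows "compact (polar_set L)"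
proof -
  obtain e where e: "e > 0" "cball 0 e \<subseteq> L" using assms mem_interior_cball by blast
  have "norm v \<le> 1 / e" if "v \<in> polar_set L" for v
  proof (cases "v = 0")
    case False
    have "(e / norm v) *\<^sub>R v \<in> L" using e False by (intro subsetD[OF e(2)]) simp
    then have "(e / norm v) * (norm v)\<^sup>2 \<le> 1" using that by (auto simp: polar_set_def power2_norm_eq_inner)
    then show ?thesis using False e(1) by (simp add: field_simps power2_eq_square)
  qed (use e in auto)
  then have "bounded (polar_set L)" by (auto simp: bounded_iff)
  moreover have "polar_set L = (\<Inter>y\<in>L. {v. y \<bullet> v \<le> 1})" by (auto simp: polar_set_def)
  then have "closed (polar_set L)" by (auto intro!: closed_INT closed_halfspace_le)
  ultimately show ?thesis by (simp add: compact_eq_bounded_closed)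
qed

lemma polar_set_nonempty: "polar_set L \<noteq> {}"
  by (auto simp: polar_set_def intro: exI[of _ 0])

text \<open>The infimum is attained because \<open>L\<close> is closed, seen by approaching the
  gauge value from the right. The point \<open>y\<close> is not interior, since otherwise values
  slightly to the left would still be admissible.\<close>

lemma gauge_frontier_decomposition:
  assumes L: "compact L" "convex L" "0 \<in> interior L" and x: "x \<noteq> 0"
  obtains y where "y \<in> frontier L" "y \<in> L" "x = body_gauge L x *\<^sub>R y" "body_gauge L x > 0"
proof -
  define R where "R = {r. r \<ge> 0 \<and> x \<in> (\<lambda>y. r *\<^sub>R y) ` L}"
  obtain e where e: "e > 0" "cball 0 e \<subseteq> L" using L(3) mem_interior_cball by blast
  obtain M where M: "M > 0" "\<And>y. y \<in> L \<Longrightarrow> norm y \<le> M"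
    using compact_imp_bounded[OF L(1)] by (meson bounded_pos)
  have Rpos: "r > 0" "norm x / M \<le> r" if r: "r \<in> R" for r
  proof -
    obtain y where y: "y \<in> L" "x = r *\<^sub>R y" using r unfolding R_def by blast
    have "r \<ge> 0" using r by (simp add: R_def)
    with y x show "r > 0" by (cases "r = 0") auto
    have "norm x \<le> r * M" using y M(2)[OF y(1)] \<open>r > 0\<close> by simp
    then show "norm x / M \<le> r" using M(1) by (simp add: field_simps)
  qed
  have Riff: "r \<in> R \<longleftrightarrow> r > 0 \<and> x /\<^sub>R r \<in> L" for r
  proof
    assume r: "r \<in> R" then show "r > 0 \<and> x /\<^sub>R r \<in> L" using Rpos[OF r] by (auto simp: R_def)
  next
    assume "r > 0 \<and> x /\<^sub>R r \<in> L" then show "r \<in> R" by (auto simp: R_def intro!: image_eqI[of _ _ "x /\<^sub>R r"])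
  qed
  have ne: "R \<noteq> {}"
  proof -
    have "x /\<^sub>R (norm x / e) \<in> L" using x e by (intro subsetD[OF e(2)]) simp
    then have "norm x / e \<in> R" using Riff x e by simp
    then show ?thesis by blast
  qed
  have bdd: "bdd_below R" using Rpos(1) by (meson bdd_belowI less_imp_le)
  define g where "g = body_gauge L x"
  have g: "g = Inf R" by (simp add: g_def body_gauge_def R_def)
  have gpos: "g > 0"
  proof -
    have "norm x / M \<le> g" unfolding g using Rpos(2) ne by (intro cInf_greatest) auto
    moreover have "0 < norm x / M" using x M(1) by simp
    ultimately show ?thesis by linarith
  qed
  define y where "y = x /\<^sub>R g"
  \<comment> \<open>\<open>L\<close> is star-shaped about the origin, so the admissible factors form
    an up-set.\<close>
  have inv: "z \<in> L" if "x /\<^sub>R r \<in> L" "r > 0" "z = c *\<^sub>R x" "0 \<le> c" "c \<le> 1 / r" for z r c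
  proof -
    have "(c * r) *\<^sub>R (x /\<^sub>R r) + (1 - c * r) *\<^sub>R 0 \<in> L"
      using that L interior_subset[of L] by (intro convexD[OF L(2)]) (auto simp: field_simps)
    moreover have "(c * r) *\<^sub>R (x /\<^sub>R r) = z" using that(2,3) by (simp add: divide_inverse[symmetric])
    ultimately show ?thesis by simp
  qed
  have lt: "x /\<^sub>R r \<in> L" if r: "r > g" for r
  proof -
    obtain r' where r': "r' \<in> R" "r' < r" using r ne unfolding g by (metis cInf_lessD)
    then have "r' > 0" "x /\<^sub>R r' \<in> L" using Riff by auto
    moreover from this(1) r'(2) have "0 \<le> inverse r" "inverse r \<le> 1 / r'" by (simp_all add: divide_inverse)
    ultimately show ?thesis using inv[of r' "x /\<^sub>R r" "inverse r"] by blast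
  qed
  have lim: "((\<lambda>r. x /\<^sub>R r) \<longlongrightarrow> y) (at g within S)" for S
    unfolding y_def using gpos by (intro tendsto_intros) auto
  have yL: "y \<in> L"
  proof (rule Lim_in_closed_set[OF compact_imp_closed[OF L(1)] _ _ lim])
    show "at_right g \<noteq> bot" by simp
    show "\<forall>\<^sub>F r in at_right g. x /\<^sub>R r \<in> L" using lt by (auto simp: eventually_at_filter)
  qed
  have "y \<notin> interior L"
  proof
    assume "y \<in> interior L"
    then have "\<forall>\<^sub>F r in at_left g. x /\<^sub>R r \<in> interior L"
      by (intro topological_tendstoD[OF lim]) auto
    moreover have "\<forall>\<^sub>F r in at_left g. r \<in> {0<..<g}"
      using gpos by (rule eventually_at_left_real)
    ultimately have "\<forall>\<^sub>F r in at_left g. x /\<^sub>R r \<in> interior L \<and> r \<in> {0<..<g}" by (rule eventually_conj)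
    from eventually_happens'[OF trivial_limit_at_left_real this]
    obtain r where "x /\<^sub>R r \<in> interior L \<and> r \<in> {0<..<g}" ..
    then have "x /\<^sub>R r \<in> interior L" "0 < r" "r < g" by auto
    then have "r \<in> R" using Riff interior_subset by blast
    then have "g \<le> r" unfolding g using bdd by (rule cInf_lower)
    with \<open>r < g\<close> show False by simp
  qed
  then have "y \<in> frontier L" using yL closure_subset by (auto simp: frontier_def)
  moreover have "x = g *\<^sub>R y" using gpos by (simp add: y_def)
  ultimately show thesis using yL gpos unfolding g_def by (intro that) auto
qed

text \<open>This carries the Lipschitz bound and the gradient criterion for support functions over
  to gauges. The functional that attains the gauge at \<open>x\<close> is a supporting functional of
  \<open>L\<close> at the radial projection of \<open>x\<close>.\<close>

lemma body_gauge_eq_support_fun: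
  assumes L: "compact L" "convex L" "0 \<in> interior L"
  shows "body_gauge L x = support_fun (polar_set L) x"
proof (cases "x = 0")
  case True
  have "{r. r \<ge> 0 \<and> (0::real^2) \<in> (\<lambda>y. r *\<^sub>R y) ` L} = {0..}"
    using L(3) interior_subset[of L] by (auto intro!: image_eqI[of _ _ 0])
  then have "body_gauge L 0 = 0" by (simp add: body_gauge_def)
  moreover have "support_fun (polar_set L) 0 = 0"
    using support_fun_scaleR[OF compact_polar_set[OF L(3)] polar_set_nonempty, of 0 0] by simp
  ultimately show ?thesis using True by simp
next
  case False
  obtain y where y: "y \<in> frontier L" "y \<in> L" "x = body_gauge L x *\<^sub>R y" "body_gauge L x > 0"
    using gauge_frontier_decomposition[OF L False] by blast
  have "y \<notin> rel_interior L" using y(1) L(3) by (simp add: frontier_def rel_interior_nonempty_interior[of L] empty_iff) (metis empty_iff rel_interior_nonempty_interior)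
  from supporting_hyperplane_relative_frontier[OF L(2) subsetD[OF closure_subset y(2)] this]
  obtain a where a: "a \<noteq> 0" "\<And>z. z \<in> closure L \<Longrightarrow> a \<bullet> y \<le> a \<bullet> z" "\<And>z. z \<in> rel_interior L \<Longrightarrow> a \<bullet> y < a \<bullet> z"
    by metis
  have "a \<bullet> y < a \<bullet> 0" using L(3) by (intro a(3)) (metis empty_iff rel_interior_nonempty_interior)
  then have neg: "a \<bullet> y < 0" by simp
  \<comment> \<open>Dividing by the negative number \<open>a \<bullet> y\<close> reverses the
    supporting inequality and normalises \<open>y \<bullet> v\<close> to 1.\<close>
  define v where "v = (1 / (a \<bullet> y)) *\<^sub>R a"
  have vP: "v \<in> polar_set L"
    using a(2) neg closure_subset[of L] by (auto simp: polar_set_def v_def inner_commute[of _ a] field_simps)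
  have "body_gauge L x \<le> support_fun (polar_set L) x"
  proof -
    have "x \<bullet> v = body_gauge L x" using neg by (subst y(3)) (simp add: v_def inner_commute[of _ a])
    then show ?thesis using support_fun_ge[OF compact_polar_set[OF L(3)] vP, of x] by simp
  qed
  moreover have "support_fun (polar_set L) x \<le> body_gauge L x"
  proof (rule support_fun_le[OF compact_polar_set[OF L(3)] polar_set_nonempty])
    fix v assume "v \<in> polar_set L"
    then have "body_gauge L x * (y \<bullet> v) \<le> body_gauge L x * 1"
      using y by (intro mult_left_mono) (auto simp: polar_set_def)
    then show "x \<bullet> v \<le> body_gauge L x" by (subst y(3)) simp
  qed
  ultimately show ?thesis by simp
qed

section \<open>Bodies with a boundary of class \<open>C\<^sup>2\<close>\<close>

text \<open>A derivative of at least \<open>m > 0\<close> makes \<Theta> grow at least linearly.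
  Hence it is onto, and its inverse is Lipschitz with constant \<open>1 / m\<close>; the continuity
  so obtained is what the inverse function rule asks for.\<close>

lemma bounded_antiderivative_inverse:
  fixes \<Theta> \<omega> :: "real \<Rightarrow> real"
  assumes der: "\<And>t. (\<Theta> has_real_derivative \<omega> t) (at t)" and m: "m > 0" "\<And>t. m \<le> \<omega> t"
  obtains g where "\<And>\<phi>. \<Theta> (g \<phi>) = \<phi>" "\<And>\<phi>. (g has_real_derivative inverse (\<omega> (g \<phi>))) (at \<phi>)"
proof -
  have grow: "m * (t - s) \<le> \<Theta> t - \<Theta> s" if st: "s \<le> t" for s t
  proof (cases "s = t")
    case False
    then obtain z where "\<Theta> t - \<Theta> s = (t - s) * \<omega> z"
      using MVT2[of s t \<Theta> \<omega>] der st by auto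
    then show ?thesis using m(2)[of z] st by (simp add: mult.commute mult_right_mono)
  qed simp
  have cont: "continuous_on S \<Theta>" for S
    using der by (meson DERIV_isCont continuous_at_imp_continuous_on)
  have surj: "\<exists>t. \<Theta> t = \<phi>" for \<phi>
  proof -
    \<comment> \<open>On an interval of length \<open>r\<close> the function \<Theta> moves by at
      least \<open>m * r\<close>, the distance from \<open>\<Theta> 0\<close> to the target
      value.\<close>
    define r where "r = \<bar>\<phi> - \<Theta> 0\<bar> / m"
    have r: "r \<ge> 0" "m * r = \<bar>\<phi> - \<Theta> 0\<bar>" using m(1) by (auto simp: r_def)
    have "\<Theta> (- r) \<le> \<phi>" "\<phi> \<le> \<Theta> r"
      using grow[of "-r" 0] grow[of 0 r] r by (auto simp: abs_if split: if_splits)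
    then show ?thesis using IVT'[of \<Theta> "- r" \<phi> r] r(1) cont by auto
  qed
  then obtain g where g: "\<And>\<phi>. \<Theta> (g \<phi>) = \<phi>" by metis
  have lip: "\<bar>g a - g b\<bar> \<le> (1 / m) * \<bar>a - b\<bar>" for a b
    using grow[of "g a" "g b"] grow[of "g b" "g a"] g m(1) by (auto simp: field_simps abs_if)
  have "isCont g \<phi>" for \<phi>
  proof -
    have "(1 / m)-lipschitz_on UNIV g"
      by (rule lipschitz_onI) (use lip m(1) in \<open>auto simp: dist_real_def\<close>)
    then show ?thesis using lipschitz_on_continuous_on continuous_on_eq_continuous_at by blast
  qed
  moreover have "\<omega> (g \<phi>) \<noteq> 0" for \<phi> using m(1) m(2)[of "g \<phi>"] by linarith
  ultimately have "(g has_real_derivative inverse (\<omega> (g \<phi>))) (at \<phi>)" for \<phi>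
    by (intro DERIV_inverse_function[of \<Theta> _ _ _ "\<phi> - 1" "\<phi> + 1"])
      (use der g in auto)
  then show thesis using that g by blast
qed

lemma continuous_antiderivative:
  fixes \<omega> :: "real \<Rightarrow> real"
  assumes "continuous_on UNIV \<omega>"
  obtains \<Theta> where "\<Theta> 0 = c" "\<And>t. (\<Theta> has_real_derivative \<omega> t) (at t)"
proof -
  define \<Theta> where "\<Theta> t = c + (LBINT y=0..t. \<omega> y)" for t :: real
  have "(\<Theta> has_real_derivative \<omega> t) (at t)" for t
  proof -
    \<comment> \<open>The interval contains both the base point 0 and \<open>t\<close> in its
      interior, so the derivative within it is two-sided.\<close>
    define a where "a = - \<bar>t\<bar> - 1"
    define b where "b = \<bar>t\<bar> + 1"
    have "((\<lambda>u. LBINT y=ereal 0..ereal u. \<omega> y) has_vector_derivative (\<omega> t)) (at t within {a..b})"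
      by (rule interval_integral_FTC2) (auto simp: a_def b_def intro: continuous_on_subset[OF assms])
    moreover have "at t within {a..b} = at t" by (rule at_within_interior) (auto simp: a_def b_def)
    ultimately have "((\<lambda>u. LBINT y=ereal 0..ereal u. \<omega> y) has_real_derivative \<omega> t) (at t)"
      by (simp add: has_real_derivative_iff_has_vector_derivative)
    then show ?thesis unfolding \<Theta>_def[abs_def] zero_ereal_def by (auto intro!: derivative_eq_intros)
  qed
  moreover have "\<Theta> 0 = c" by (simp add: \<Theta>_def zero_ereal_def)
  ultimately show thesis using that by blast
qed

lemma periodic_int:
  fixes f :: "real \<Rightarrow> 'a"
  assumes "\<And>t. f (t + 1) = f t" shows "f (t + of_int n) = f t"
proof (induction n rule: int_induct[of _ 0])
  case (step1 i) then show ?case using assms[of "t + of_int i"] by (simp add: add.assoc)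
next
  case (step2 i) then show ?case using assms[of "t + of_int i - 1"] by (simp add: algebra_simps)
qed simp

lemma periodic_frac:
  fixes f :: "real \<Rightarrow> 'a"
  assumes "\<And>t. f (t + 1) = f t" shows "f t = f (frac t)"
  using periodic_int[of f "frac t" "\<lfloor>t\<rfloor>", OF assms] by (simp add: frac_def)

text \<open>One period is compact, and \<open>frac\<close> carries every parameter into it.\<close>

lemma periodic_pos_bounds:
  fixes f :: "real \<Rightarrow> real"
  assumes per: "\<And>t. f (t + 1) = f t" and cont: "continuous_on UNIV f" and pos: "\<And>t. f t > 0"
  obtains m M where "m > 0" "\<And>t. m \<le> f t" "\<And>t. f t \<le> M"
proof -
  have c: "continuous_on {0..1} f" using cont continuous_on_subset by blast
  have I: "compact {0..1::real}" "{0..1::real} \<noteq> {}" by auto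
  obtain a where a: "\<And>t. t \<in> {0..1} \<Longrightarrow> f a \<le> f t"
    using continuous_attains_inf[OF I c] by blast
  obtain b where b: "\<And>t. t \<in> {0..1} \<Longrightarrow> f t \<le> f b"
    using continuous_attains_sup[OF I c] by blast
  have fr: "frac t \<in> {0..1}" for t :: real using frac_ge_0[of t] frac_lt_1[of t] by simp
  show thesis
    using that[of "f a" "f b"] pos a[OF fr] b[OF fr] periodic_frac[of f, OF per] by metis
qed

lemma periodic_derivative:
  fixes f :: "real \<Rightarrow> 'a::real_normed_vector"
  assumes "\<And>t. f (t + 1) = f t" "\<And>t. (f has_vector_derivative f' t) (at t)"
  shows "f' (t + 1) = f' t"
proof -
  have "((f \<circ> (\<lambda>t. t + 1)) has_vector_derivative 1 *\<^sub>R f' (t + 1)) (at t)"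
    by (rule vector_diff_chain_at) (auto intro!: derivative_eq_intros assms(2))
  then have "(f has_vector_derivative f' (t + 1)) (at t)" using assms(1) by (simp add: comp_def)
  then show ?thesis using assms(2) vector_derivative_unique_at by blast
qed

lemma second_derivative_nonpos_at_max:
  fixes g g' :: "real \<Rightarrow> real"
  assumes der: "\<And>s. (g has_real_derivative g' s) (at s)" and der2: "(g' has_real_derivative g2) (at t)"
    and max: "\<And>s. g s \<le> g t"
  shows "g' t = 0" "g2 \<le> 0"
proof -
  show 0: "g' t = 0" by (rule DERIV_local_max[OF der, of 1]) (auto simp: max)
  show "g2 \<le> 0"
  proof (rule ccontr)
    assume "\<not> g2 \<le> 0"
    then obtain d where d: "d > 0" "\<And>h. 0 < h \<Longrightarrow> h < d \<Longrightarrow> g' t < g' (t + h)"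
      using DERIV_pos_inc_right[OF der2] by (metis not_le)
    obtain z where z: "t < z" "z < t + d/2" "g (t + d/2) - g t = (t + d/2 - t) * g' z"
      using MVT2[of t "t + d/2" g g'] der d(1) by auto
    have "g' z > 0" using d(2)[of "z - t"] z 0 d(1) by auto
    then have "0 < (t + d/2 - t) * g' z" using d(1) by simp
    then have "g (t + d/2) > g t" using z(3) by linarith
    then show False using max[of "t + d/2"] by simp
  qed
qed

section \<open>The boundary curve and its normal angle\<close>

locale C2_curve =
  fixes K :: "(real^2) set" and \<gamma> \<gamma>' \<gamma>'' :: "real \<Rightarrow> real^2"
  assumes body: "compact K" "convex K" "interior K \<noteq> {}"
    and der: "\<And>t. (\<gamma> has_vector_derivative \<gamma>' t) (at t)"
    and der2: "\<And>t. (\<gamma>' has_vector_derivative \<gamma>'' t) (at t)"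
    and cont: "continuous_on UNIV \<gamma>''" and reg: "\<And>t. \<gamma>' t \<noteq> 0"
    and per: "\<And>t. \<gamma> (t + 1) = \<gamma> t" and bij: "bij_betw \<gamma> {0..<1} (frontier K)"
    and curv: "\<And>t. signed_curvature (\<gamma>' t) (\<gamma>'' t) > 0"
begin

lemma frontier_point: "\<gamma> t \<in> frontier K"
proof -
  have "\<gamma> t = \<gamma> (frac t)" using periodic_frac[of \<gamma>, OF per] .
  moreover have "frac t \<in> {0..<1}" using frac_ge_0[of t] frac_lt_1[of t] by simp
  ultimately show ?thesis using bij by (metis bij_betwE)
qed

lemma in_body: "\<gamma> t \<in> K"
  using frontier_point[of t] body(1) by (meson compact_imp_closed frontier_subset_closed subsetD)

text \<open>The function \<open>\<gamma> s \<bullet> v\<close> of \<open>s\<close> is largest at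
  \<open>t\<close>. Its first derivative makes \<open>v\<close> a normal; the sign of its second
  derivative later tells the outer normal from the inner one.\<close>

lemma normal_orthogonal:
  assumes "\<And>y. y \<in> K \<Longrightarrow> y \<bullet> v \<le> \<gamma> t \<bullet> v"
  shows "\<gamma>' t \<bullet> v = 0" "\<gamma>'' t \<bullet> v \<le> 0"
  by (rule second_derivative_nonpos_at_max[OF inner_has_real_derivative[OF der] inner_has_real_derivative[OF der2]];
      use assms in_body in simp)+

lemma supporting_normal:
  obtains v where "v \<noteq> 0" "\<And>y. y \<in> K \<Longrightarrow> y \<bullet> v \<le> \<gamma> t \<bullet> v"
proof -
  have "\<gamma> t \<notin> rel_interior K"
    using frontier_point[of t] rel_interior_nonempty_interior[OF body(3)] by (simp add: frontier_def)
  from supporting_hyperplane_relative_frontier[OF body(2) subsetD[OF closure_subset in_body] this]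
  obtain a where a: "a \<noteq> 0" "\<And>z. z \<in> closure K \<Longrightarrow> a \<bullet> \<gamma> t \<le> a \<bullet> z" by metis
  show thesis using that[of "- a"] a closure_subset[of K] by (auto simp: inner_commute[of _ a])
qed

text \<open>The normal angle \<open>\<Theta>\<close> integrates curvature times speed; \<open>\<gamma>'\<close> stays parallel to
  \<open>unit_tangent \<circ> \<Theta>\<close> because \<open>(\<gamma>' \<bullet> (unit_vec \<circ> \<Theta>))\<^sup>2 / (norm \<gamma>')\<^sup>2\<close> has derivative zero.\<close>

lemma angle_lift:
  obtains \<Theta> where "\<And>t. (\<Theta> has_real_derivative signed_curvature (\<gamma>' t) (\<gamma>'' t) * norm (\<gamma>' t)) (at t)"
    "\<And>t. \<gamma>' t = norm (\<gamma>' t) *\<^sub>R unit_tangent (\<Theta> t)"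
proof -
  define a where "a t = \<gamma>' t $ 1" for t
  define b where "b t = \<gamma>' t $ 2" for t
  define a' where "a' t = \<gamma>'' t $ 1" for t
  define b' where "b' t = \<gamma>'' t $ 2" for t
  define \<omega> where "\<omega> t = (a t * b' t - b t * a' t) / ((a t)\<^sup>2 + (b t)\<^sup>2)" for t
  have nsq: "(a t)\<^sup>2 + (b t)\<^sup>2 = (norm (\<gamma>' t))\<^sup>2" for t by (simp add: a_def b_def norm_vec2_sq)
  have pos: "(a t)\<^sup>2 + (b t)\<^sup>2 > 0" for t using reg[of t] by (simp add: nsq)
  have \<omega>: "signed_curvature (\<gamma>' t) (\<gamma>'' t) * norm (\<gamma>' t) = \<omega> t" for t
    using reg[of t] unfolding \<omega>_def nsq
    by (simp add: signed_curvature_def a_def b_def a'_def b'_def power2_eq_square power3_eq_cube)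
  have da: "(a has_real_derivative a' t) (at t)" and db: "(b has_real_derivative b' t) (at t)" for t
    unfolding a_def[abs_def] b_def[abs_def] a'_def b'_def has_real_derivative_iff_has_vector_derivative
    by (intro bounded_linear.has_vector_derivative[OF bounded_linear_vec_nth] der2)+
  have ca: "continuous_on UNIV a" "continuous_on UNIV b"
    using da db by (auto intro!: continuous_at_imp_continuous_on DERIV_isCont)
  have ca': "continuous_on UNIV a'" "continuous_on UNIV b'"
    unfolding a'_def b'_def using cont by (auto intro!: continuous_intros)
  have "continuous_on UNIV \<omega>"
    unfolding \<omega>_def using pos by (intro continuous_intros ca ca') (metis less_irrefl)
  \<comment> \<open>The vector is \<open>\<gamma>' 0\<close> turned clockwise by a right angle, so
    \<open>\<theta>0\<close> is the outer normal angle at parameter 0 for a counterclockwise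
    curve.\<close>
  moreover obtain \<theta>0 where \<theta>0: "vector [b 0, - a 0] = norm (vector [b 0, - a 0] :: real^2) *\<^sub>R unit_vec \<theta>0"
    using polar_decomposition[of "vector [b 0, - a 0] :: real^2"] pos[of 0] by (auto simp: vec2_eq_iff sum_power2_gt_zero_iff)
  ultimately obtain \<Theta> where \<Theta>: "\<Theta> 0 = \<theta>0" "\<And>t. (\<Theta> has_real_derivative \<omega> t) (at t)"
    using continuous_antiderivative by metis
  \<comment> \<open>\<open>p\<close> and \<open>q\<close> are the components of
    \<open>\<gamma>'\<close> along \<open>unit_vec (\<Theta> t)\<close> and
    \<open>unit_tangent (\<Theta> t)\<close>; the aim is \<open>p = 0\<close> and
    \<open>q = norm \<gamma>'\<close>.\<close>
  define p where "p t = a t * cos (\<Theta> t) + b t * sin (\<Theta> t)" for t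
  define q where "q t = b t * cos (\<Theta> t) - a t * sin (\<Theta> t)" for t
  have dp: "(p has_real_derivative a' t * cos (\<Theta> t) + b' t * sin (\<Theta> t) + \<omega> t * q t) (at t)" for t
    unfolding p_def[abs_def] q_def
    by (auto intro!: derivative_eq_intros da db \<Theta>(2) simp: algebra_simps)
  \<comment> \<open>With \<open>p'\<close> for the first factor this reads \<open>p' * (norm
    \<gamma>')\<^sup>2 = p * (\<gamma>' \<bullet> \<gamma>'')\<close>: the square of
    \<open>p\<close> and the squared speed grow at the same relative rate.\<close>
  have key: "(a' t * cos (\<Theta> t) + b' t * sin (\<Theta> t) + \<omega> t * q t) * ((a t)\<^sup>2 + (b t)\<^sup>2)
      = p t * (a t * a' t + b t * b' t)" for t
  proof -
    have "\<omega> t * ((a t)\<^sup>2 + (b t)\<^sup>2) = a t * b' t - b t * a' t" using pos[of t] by (simp add: \<omega>_def)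
    then have "(a' t * cos (\<Theta> t) + b' t * sin (\<Theta> t) + \<omega> t * q t) * ((a t)\<^sup>2 + (b t)\<^sup>2)
      = (a' t * cos (\<Theta> t) + b' t * sin (\<Theta> t)) * ((a t)\<^sup>2 + (b t)\<^sup>2) + (a t * b' t - b t * a' t) * q t"
      by (simp add: distrib_right)
    then show ?thesis by (simp add: p_def q_def algebra_simps power2_eq_square)
  qed
  have "((\<lambda>t. (p t)\<^sup>2 / ((a t)\<^sup>2 + (b t)\<^sup>2)) has_real_derivative 0) (at t)" for t
  proof -
    define dp' where "dp' = a' t * cos (\<Theta> t) + b' t * sin (\<Theta> t) + \<omega> t * q t"
    have "((\<lambda>t. (p t)\<^sup>2 / ((a t)\<^sup>2 + (b t)\<^sup>2)) has_real_derivative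
      (2 * p t * dp' * ((a t)\<^sup>2 + (b t)\<^sup>2) - (p t)\<^sup>2 * (2 * a t * a' t + 2 * b t * b' t))
        / (((a t)\<^sup>2 + (b t)\<^sup>2) * ((a t)\<^sup>2 + (b t)\<^sup>2))) (at t)"
      using pos[of t] unfolding dp'_def
      by (auto intro!: derivative_eq_intros da db dp simp: algebra_simps)
    moreover have "2 * p t * dp' * ((a t)\<^sup>2 + (b t)\<^sup>2) = (p t)\<^sup>2 * (2 * a t * a' t + 2 * b t * b' t)"
    proof -
      have "2 * p t * (dp' * ((a t)\<^sup>2 + (b t)\<^sup>2)) = 2 * p t * (p t * (a t * a' t + b t * b' t))"
        using key[of t] unfolding dp'_def[symmetric] by simp
      then show ?thesis by (simp add: power2_eq_square algebra_simps)
    qed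
    ultimately show ?thesis by simp
  qed
  then have const: "(p t)\<^sup>2 / ((a t)\<^sup>2 + (b t)\<^sup>2) = (p 0)\<^sup>2 / ((a 0)\<^sup>2 + (b 0)\<^sup>2)" for t
    by (intro DERIV_isconst_all allI)
  have init: "b 0 = norm (vector [b 0, - a 0] :: real^2) * cos \<theta>0"
      "- a 0 = norm (vector [b 0, - a 0] :: real^2) * sin \<theta>0"
    using \<theta>0 by (simp_all add: vec2_eq_iff)
  define n0 where "n0 = norm (vector [b 0, - a 0] :: real^2)"
  have init': "b 0 = n0 * cos \<theta>0" "a 0 = - n0 * sin \<theta>0"
    using init unfolding n0_def[symmetric] by linarith+
  have "n0 \<noteq> 0" using pos[of 0] init' by auto
  then have n0: "n0 > 0" unfolding n0_def by simp
  have p0: "p 0 = 0" by (simp add: p_def \<Theta>(1) init')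
  have "q 0 = n0 * ((cos \<theta>0)\<^sup>2 + (sin \<theta>0)\<^sup>2)"
    unfolding q_def \<Theta>(1) init' by (simp add: power2_eq_square algebra_simps del: sin_cos_squared_add sin_cos_squared_add2 sin_cos_squared_add3)
  then have q0: "q 0 > 0" using n0 by simp
  have p: "p t = 0" for t using const[of t] p0 pos[of t] by auto
  have pq: "(p t)\<^sup>2 + (q t)\<^sup>2 = (a t)\<^sup>2 + (b t)\<^sup>2" for t
  proof -
    have "(p t)\<^sup>2 + (q t)\<^sup>2 = ((a t)\<^sup>2 + (b t)\<^sup>2) * ((cos (\<Theta> t))\<^sup>2 + (sin (\<Theta> t))\<^sup>2)"
      by (simp add: p_def q_def power2_eq_square algebra_simps del: sin_cos_squared_add sin_cos_squared_add2 sin_cos_squared_add3)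
    then show ?thesis by simp
  qed
  have qne: "q t \<noteq> 0" for t using pq[of t] p pos[of t] by auto
  have cq: "continuous_on UNIV q"
  proof -
    have "continuous_on UNIV \<Theta>" using \<Theta>(2) by (auto intro!: continuous_at_imp_continuous_on DERIV_isCont)
    then show ?thesis unfolding q_def by (intro continuous_intros ca)
  qed
  \<comment> \<open>Since \<open>p = 0\<close>, the square of \<open>q\<close> is the squared speed,
    so \<open>q\<close> never vanishes; being continuous and positive at 0, it keeps its
    sign.\<close>
  have qpos: "q t > 0" for t
  proof (rule ccontr)
    assume "\<not> q t > 0"
    then have "0 \<in> closed_segment (q 0) (q t)" using q0 by (auto simp: closed_segment_eq_real_ivl)
    moreover have "connected (range q)" using cq connected_continuous_image connected_UNIV by blast
    then have "closed_segment (q 0) (q t) \<subseteq> range q"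
      using connected_contains_Icc[of "range q"] by (auto simp: closed_segment_eq_real_ivl)
    ultimately show False using qne by (metis (no_types, lifting) imageE subsetD)
  qed
  have "q t = norm (\<gamma>' t)" for t
    using pq[of t] p[of t] qpos[of t] nsq[of t] by (metis abs_norm_cancel abs_of_pos add_0 power2_eq_iff_nonneg abs_ge_zero zero_power2)
  moreover have "\<gamma>' t = q t *\<^sub>R unit_tangent (\<Theta> t)" for t
  proof -
    have "a t = a t * ((cos (\<Theta> t))\<^sup>2 + (sin (\<Theta> t))\<^sup>2)" "b t = b t * ((cos (\<Theta> t))\<^sup>2 + (sin (\<Theta> t))\<^sup>2)" by simp_all
    then have "a t = p t * cos (\<Theta> t) - q t * sin (\<Theta> t)" "b t = p t * sin (\<Theta> t) + q t * cos (\<Theta> t)"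
      by (simp_all add: p_def q_def power2_eq_square algebra_simps del: sin_cos_squared_add sin_cos_squared_add2 sin_cos_squared_add3)
    then show ?thesis using p[of t] by (simp add: vec2_eq_iff a_def b_def)
  qed
  ultimately show thesis using that[of \<Theta>] \<Theta>(2) \<omega> by metis
qed

text \<open>The normal angle increases at a rate bounded below, so it can be inverted to
  \<open>g\<close>. Then \<open>\<gamma> \<circ> g\<close> parametrises the boundary by the normal
  angle and \<open>h \<phi> = \<gamma> (g \<phi>) \<bullet> unit_vec \<phi>\<close>. Its velocity is
  tangential, so the first derivative of \<open>h\<close> involves only the position; the second
  brings in the speed \<open>f\<close>.\<close>

lemma support_angle_C2:
  obtains h' f c1 c2 where "c1 > 0" "\<And>\<theta>. c1 \<le> f \<theta>" "\<And>\<theta>. f \<theta> \<le> c2" "continuous_on UNIV f"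
    "\<And>\<theta>. (support_angle K has_real_derivative h' \<theta>) (at \<theta>)"
    "\<And>\<theta>. (h' has_real_derivative f \<theta> - support_angle K \<theta>) (at \<theta>)"
proof -
  define \<omega> where "\<omega> t = signed_curvature (\<gamma>' t) (\<gamma>'' t) * norm (\<gamma>' t)" for t
  obtain \<Theta> where \<Theta>: "\<And>t. (\<Theta> has_real_derivative \<omega> t) (at t)"
    "\<And>t. \<gamma>' t = norm (\<gamma>' t) *\<^sub>R unit_tangent (\<Theta> t)"
    using angle_lift unfolding \<omega>_def by blast
  have per': "\<gamma>' (t + 1) = \<gamma>' t" for t by (rule periodic_derivative[OF per der])
  have per'': "\<gamma>'' (t + 1) = \<gamma>'' t" for t by (rule periodic_derivative[OF per' der2])
  have c': "continuous_on UNIV \<gamma>'"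
    using der2 by (auto intro!: continuous_at_imp_continuous_on has_vector_derivative_continuous)
  have c\<omega>: "continuous_on UNIV \<omega>"
    unfolding \<omega>_def signed_curvature_def using reg by (intro continuous_intros c' cont) auto
  have pos: "\<omega> t > 0" for t unfolding \<omega>_def using curv reg by simp
  obtain m where m: "m > 0" "\<And>t. m \<le> \<omega> t"
    using periodic_pos_bounds[OF _ c\<omega> pos] per' per'' unfolding \<omega>_def by metis
  obtain g where g: "\<And>\<phi>. \<Theta> (g \<phi>) = \<phi>" "\<And>\<phi>. (g has_real_derivative inverse (\<omega> (g \<phi>))) (at \<phi>)"
    using bounded_antiderivative_inverse[OF \<Theta>(1) m] by blast
  \<comment> \<open>As \<omega> is curvature times speed, \<open>F\<close> is the radius of
    curvature. Its bounds come from periodicity in the parameter \<open>t\<close>.\<close>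
  define F where "F t = norm (\<gamma>' t) / \<omega> t" for t
  have cF: "continuous_on UNIV F"
    unfolding F_def using pos by (intro continuous_intros c' c\<omega>) (metis less_irrefl)
  have "F t > 0" for t using pos reg by (simp add: F_def)
  then obtain c1 c2 where F: "c1 > 0" "\<And>t. c1 \<le> F t" "\<And>t. F t \<le> c2"
    using periodic_pos_bounds[OF _ cF] per' per'' unfolding F_def \<omega>_def by metis
  have cg: "continuous_on UNIV g" using g(2) by (auto intro!: continuous_at_imp_continuous_on DERIV_isCont)
  \<comment> \<open>Some supporting normal \<open>v\<close> exists and is parallel to
    \<open>unit_vec (\<Theta> t)\<close>. Positive curvature makes
    \<open>\<gamma>'' t \<bullet> unit_vec (\<Theta> t)\<close> negative, while
    \<open>\<gamma>'' t \<bullet> v \<le> 0\<close>; hence the factor \<open>l\<close> between them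
    is positive.\<close>
  have supp: "\<gamma> t \<bullet> unit_vec (\<Theta> t) = support_angle K (\<Theta> t)" for t
  proof -
    obtain v where v: "v \<noteq> 0" "\<And>y. y \<in> K \<Longrightarrow> y \<bullet> v \<le> \<gamma> t \<bullet> v" using supporting_normal by blast
    have o: "\<gamma>' t \<bullet> v = 0" "\<gamma>'' t \<bullet> v \<le> 0" using normal_orthogonal[OF v(2)] by auto
    have "unit_tangent (\<Theta> t) \<bullet> v = 0" using o(1) reg[of t] by (subst (asm) \<Theta>(2)) simp
    then have v': "v = (v \<bullet> unit_vec (\<Theta> t)) *\<^sub>R unit_vec (\<Theta> t)"
      using unit_vec_decomp[of v "\<Theta> t"] by (simp add: inner_commute)
    define l where "l = v \<bullet> unit_vec (\<Theta> t)"
    have l0: "l \<noteq> 0" using v(1) v' unfolding l_def by auto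
    have n12: "\<gamma>' t $ 1 = - norm (\<gamma>' t) * sin (\<Theta> t)" "\<gamma>' t $ 2 = norm (\<gamma>' t) * cos (\<Theta> t)"
      by (subst \<Theta>(2), simp)+
    have "0 < \<gamma>' t $ 1 * \<gamma>'' t $ 2 - \<gamma>' t $ 2 * \<gamma>'' t $ 1"
      using curv[of t] reg[of t] by (simp add: signed_curvature_def zero_less_divide_iff)
    also have "\<dots> = - (norm (\<gamma>' t) * (\<gamma>'' t \<bullet> unit_vec (\<Theta> t)))"
      unfolding n12 by (simp add: inner_vec2 algebra_simps)
    finally have "\<gamma>'' t \<bullet> unit_vec (\<Theta> t) < 0" using reg[of t] by (simp add: mult_less_0_iff)
    moreover have "l * (\<gamma>'' t \<bullet> unit_vec (\<Theta> t)) \<le> 0"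
      using o(2) by (subst (asm) v') (simp add: l_def)
    ultimately have lpos: "l > 0" using l0 by (auto simp: mult_le_0_iff)
    have "y \<bullet> unit_vec (\<Theta> t) \<le> \<gamma> t \<bullet> unit_vec (\<Theta> t)" if "y \<in> K" for y
    proof -
      have "l * (y \<bullet> unit_vec (\<Theta> t)) \<le> l * (\<gamma> t \<bullet> unit_vec (\<Theta> t))"
        using v(2)[OF that] v' unfolding l_def[symmetric] by (metis inner_scaleR_right)
      then show ?thesis using lpos by simp
    qed
    then show ?thesis unfolding support_angle_def
      using support_fun_le[OF body(1), of "unit_vec (\<Theta> t)" "\<gamma> t \<bullet> unit_vec (\<Theta> t)"]
        support_fun_ge[OF body(1) in_body[of t], of "unit_vec (\<Theta> t)"] in_body
      by (metis (full_types) antisym empty_iff inner_commute)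
  qed
  have "support_angle K = (\<lambda>\<phi>. \<gamma> (g \<phi>) \<bullet> unit_vec \<phi>)" using supp g(1) by (metis)
  have dg: "((\<lambda>\<phi>. \<gamma> (g \<phi>)) has_vector_derivative F (g \<phi>) *\<^sub>R unit_tangent \<phi>) (at \<phi>)" for \<phi>
  proof -
    have "((\<gamma> \<circ> g) has_vector_derivative inverse (\<omega> (g \<phi>)) *\<^sub>R \<gamma>' (g \<phi>)) (at \<phi>)"
      by (rule vector_diff_chain_at) (use g der in \<open>auto simp: has_real_derivative_iff_has_vector_derivative\<close>)
    moreover have "inverse (\<omega> (g \<phi>)) *\<^sub>R \<gamma>' (g \<phi>) = F (g \<phi>) *\<^sub>R unit_tangent \<phi>"
      by (subst \<Theta>(2)) (simp add: g(1) F_def divide_inverse mult.commute)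
    ultimately show ?thesis by (simp add: comp_def)
  qed
  have hd: "(support_angle K has_real_derivative \<gamma> (g \<phi>) \<bullet> unit_tangent \<phi>) (at \<phi>)" for \<phi>
  proof -
    have "((\<lambda>\<phi>. \<gamma> (g \<phi>) \<bullet> unit_vec \<phi>) has_vector_derivative
       \<gamma> (g \<phi>) \<bullet> unit_tangent \<phi> + (F (g \<phi>) *\<^sub>R unit_tangent \<phi>) \<bullet> unit_vec \<phi>) (at \<phi>)"
      by (rule bounded_bilinear.has_vector_derivative[OF bounded_bilinear_inner dg unit_vec_vector_derivative(1)])
    then show ?thesis unfolding \<open>support_angle K = _\<close>
      by (simp add: inner_unit_vec has_real_derivative_iff_has_vector_derivative)
  qed
  have hdd: "((\<lambda>\<phi>. \<gamma> (g \<phi>) \<bullet> unit_tangent \<phi>) has_real_derivative F (g \<phi>) - support_angle K \<phi>) (at \<phi>)" for \<phi>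
  proof -
    have "((\<lambda>\<phi>. \<gamma> (g \<phi>) \<bullet> unit_tangent \<phi>) has_vector_derivative
       \<gamma> (g \<phi>) \<bullet> (- unit_vec \<phi>) + (F (g \<phi>) *\<^sub>R unit_tangent \<phi>) \<bullet> unit_tangent \<phi>) (at \<phi>)"
      by (rule bounded_bilinear.has_vector_derivative[OF bounded_bilinear_inner dg unit_vec_vector_derivative(2)])
    then show ?thesis unfolding \<open>support_angle K = _\<close>
      by (simp add: inner_unit_vec has_real_derivative_iff_has_vector_derivative)
  qed
  show thesis
    by (rule that[OF F(1) F(2) F(3) _ hd hdd]) (auto intro: continuous_on_compose2[OF cF cg])
qed

text \<open>Any maximiser \<open>w\<close> over the polar set satisfies
  \<open>y \<bullet> w = 1\<close> and \<open>\<gamma>' t \<bullet> w = 0\<close>. These two linear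
  equations determine it, so the gradient criterion for support functions applies.\<close>

lemma gauge_gderiv:
  assumes 0: "0 \<in> interior K" and x: "x \<noteq> 0"
  obtains d where "GDERIV (body_gauge K) x :> d"
proof -
  let ?P = "polar_set K"
  obtain y where y: "y \<in> frontier K" "x = body_gauge K x *\<^sub>R y" "body_gauge K x > 0"
    using gauge_frontier_decomposition[OF body(1,2) 0 x] by blast
  obtain t where t: "y = \<gamma> t" using y(1) bij by (metis (no_types, lifting) bij_betw_imp_surj_on imageE)
  have eq: "body_gauge K = support_fun ?P"
    using body_gauge_eq_support_fun[OF body(1,2) 0] by blast
  obtain z where z: "z \<in> ?P" "x \<bullet> z = support_fun ?P x"
    using support_fun_attained[OF compact_polar_set[OF 0] polar_set_nonempty] by metis
  have normal: "\<gamma>' t \<bullet> w = 0" "y \<bullet> w = 1" if "w \<in> ?P" "x \<bullet> w = support_fun ?P x" for w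
  proof -
    have "body_gauge K x * (y \<bullet> w) = body_gauge K x"
      using that(2) by (subst (asm) y(2)) (simp add: eq)
    then show 1: "y \<bullet> w = 1" using y(3) by simp
    show "\<gamma>' t \<bullet> w = 0" using normal_orthogonal(1)[of w t] that(1) 1 t by (auto simp: polar_set_def)
  qed
  have "w = z" if w: "w \<in> ?P" "x \<bullet> w = support_fun ?P x" for w
  proof (rule ccontr)
    assume "w \<noteq> z"
    define d where "d = w - z"
    have d: "d \<noteq> 0" "\<gamma>' t \<bullet> d = 0" "y \<bullet> d = 0"
      using \<open>w \<noteq> z\<close> normal[OF w] normal[OF z] by (auto simp: d_def inner_diff_right)
    have par: "\<gamma>' t $ 1 * y $ 2 = \<gamma>' t $ 2 * y $ 1"
    proof (cases "d $ 1 = 0")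
      case True then show ?thesis using d by (auto simp: inner_vec2 vec2_eq_iff)
    next
      case False
      have "d $ 1 * (\<gamma>' t $ 1 * y $ 2 - \<gamma>' t $ 2 * y $ 1) = (\<gamma>' t \<bullet> d) * y $ 2 - (y \<bullet> d) * \<gamma>' t $ 2"
        by (simp add: inner_vec2 algebra_simps)
      then show ?thesis using False d by simp
    qed
    have "\<gamma>' t $ 1 * (y \<bullet> z) = y $ 1 * (\<gamma>' t \<bullet> z)" "\<gamma>' t $ 2 * (y \<bullet> z) = y $ 2 * (\<gamma>' t \<bullet> z)"
      unfolding inner_vec2 using par by (simp_all add: algebra_simps)
    then have "\<gamma>' t = 0" using normal[OF z] by (simp add: vec2_eq_iff)
    then show False using reg by blast
  qed
  then show thesis using that support_fun_gderiv[OF compact_polar_set[OF 0] z] unfolding eq by blast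
qed

end

lemma C2_plus_curve:
  assumes "C2_plus K" obtains \<gamma> \<gamma>' \<gamma>'' where "C2_curve K \<gamma> \<gamma>' \<gamma>''"
  using assms unfolding C2_plus_def convex_body_def C2_curve_def by blast

text \<open>The difference \<open>support_angle K \<psi> - unit_vec \<psi> \<bullet> y\<close> is
  nonnegative and vanishes at \<theta>, so its derivative there is zero. This fixes the tangential
  component of \<open>y\<close>.\<close>

lemma support_angle_maximiser:
  assumes K: "compact K" and h': "(support_angle K has_real_derivative h') (at \<theta>)"
    and y: "y \<in> K" "unit_vec \<theta> \<bullet> y = support_angle K \<theta>"
  shows "y = support_angle K \<theta> *\<^sub>R unit_vec \<theta> + h' *\<^sub>R unit_tangent \<theta>"
proof -
  have "((\<lambda>\<psi>. support_angle K \<psi> - unit_vec \<psi> \<bullet> y) has_real_derivative h' - unit_tangent \<theta> \<bullet> y) (at \<theta>)"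
    by (intro DERIV_diff h' inner_has_real_derivative unit_vec_vector_derivative)
  then have "h' - unit_tangent \<theta> \<bullet> y = 0"
    by (rule DERIV_local_min[of _ _ _ 1])
      (use y support_fun_ge[OF K y(1)] in \<open>auto simp: support_angle_def\<close>)
  then show ?thesis using unit_vec_decomp[of y \<theta>] y(2) by (simp add: inner_commute)
qed

text \<open>Differentiability in the angle alone already makes the maximiser unique, and uniqueness
  yields the full gradient.\<close>

lemma support_fun_gderiv_unit_vec:
  assumes K: "compact K" "K \<noteq> {}" and h': "(support_angle K has_real_derivative h') (at \<theta>)"
  defines "p \<equiv> support_angle K \<theta> *\<^sub>R unit_vec \<theta> + h' *\<^sub>R unit_tangent \<theta>"
  shows "GDERIV (support_fun K) (unit_vec \<theta>) :> p" "p \<in> K"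
proof -
  have max: "y = p" if y: "y \<in> K" "unit_vec \<theta> \<bullet> y = support_fun K (unit_vec \<theta>)" for y
    using support_angle_maximiser[OF K(1) h' y(1)] y(2) by (simp add: p_def support_angle_def)
  obtain y where y: "y \<in> K" "unit_vec \<theta> \<bullet> y = support_fun K (unit_vec \<theta>)"
    using support_fun_attained[OF K] by metis
  show "p \<in> K" using max[OF y] y by simp
  show "GDERIV (support_fun K) (unit_vec \<theta>) :> p"
    using support_fun_gderiv[OF K(1) y] max y by metis
qed

section \<open>The height function in normal coordinates\<close>

text \<open>With \<open>y = \<bar>x\<bar> / 2 \<le> 1\<close> the Taylor bound gives
  \<open>sin y \<ge> 5/6 * y\<close>, hence
  \<open>1 - cos x = 2 * (sin y)\<^sup>2 \<ge> 25/72 * x\<^sup>2\<close>; the constant 1/4 is this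
  rounded down.\<close>

lemma one_minus_cos_ge:
  assumes "\<bar>x\<bar> \<le> pi / 2" shows "x\<^sup>2 / 4 \<le> 1 - cos x"
proof -
  define y where "y = \<bar>x\<bar> / 2"
  have y: "0 \<le> y" "y \<le> 1" using assms pi_less_4 by (auto simp: y_def)
  have "\<bar>sin y - (\<Sum>m<3. sin_coeff m * y ^ m)\<bar> \<le> inverse (fact 3) * \<bar>y\<bar> ^ 3"
    by (rule Maclaurin_sin_bound)
  moreover have "(\<Sum>m<3. sin_coeff m * y ^ m) = y"
    by (simp add: numeral_3_eq_3 sin_coeff_def)
  moreover have "inverse (fact 3) = (1 / 6 :: real)" by (simp add: eval_nat_numeral)
  ultimately have "\<bar>sin y - y\<bar> \<le> y ^ 3 / 6" using y(1) by simp
  then have "y - y ^ 3 / 6 \<le> sin y" by linarith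
  moreover have "y ^ 3 \<le> y" using power_decreasing[of 1 3 y] y by simp
  ultimately have s: "5 / 6 * y \<le> sin y" by simp
  have "(5 / 6 * y)\<^sup>2 \<le> (sin y)\<^sup>2" using y s by (intro power_mono) auto
  moreover have "cos x = 1 - 2 * (sin y)\<^sup>2"
    using cos_double_sin[of y] by (simp add: y_def)
  moreover have "(5 / 6 * y)\<^sup>2 = 25 / 144 * x\<^sup>2" by (simp add: y_def power_mult_distrib power_divide)
  ultimately show ?thesis using zero_le_power2[of x] by linarith
qed

lemma eventually_at_right_witness:
  fixes P :: "real \<Rightarrow> bool"
  assumes "\<forall>\<^sub>F x in at_right a. P x" "a < b" obtains x where "a < x" "x < b" "P x"
  using eventually_happens'[OF trivial_limit_at_right_real eventually_conj[OF assms(1) eventually_at_right_real[OF assms(2)]]]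
  by auto

text \<open>The slopes increase as \<open>t\<close> decreases to 0 and are bounded, so they converge
  to their supremum.\<close>

lemma decreasing_slope_right_derivative:
  fixes g :: "real \<Rightarrow> real"
  assumes slope: "\<And>s t. 0 < s \<Longrightarrow> s \<le> t \<Longrightarrow> (g t - g 0) / t \<le> (g s - g 0) / s"
    and bound: "\<And>t. 0 < t \<Longrightarrow> (g t - g 0) / t \<le> U"
  obtains p where "(g has_real_derivative p) (at_right 0)" "p \<le> U"
    "\<And>t. 0 < t \<Longrightarrow> (g t - g 0) / t \<le> p"
proof -
  define S where "S = (\<lambda>t. (g t - g 0) / t) ` {0<..}"
  define p where "p = Sup S"
  have bdd: "bdd_above S" using bound by (auto simp: S_def intro!: bdd_aboveI[of _ U])
  have ne: "S \<noteq> {}" by (auto simp: S_def)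
  have up: "(g t - g 0) / t \<le> p" if "0 < t" for t
    unfolding p_def by (rule cSup_upper[OF _ bdd]) (use that in \<open>auto simp: S_def\<close>)
  have "p \<le> U" unfolding p_def using bound by (intro cSup_least ne) (auto simp: S_def)
  have "((\<lambda>t. (g t - g 0) / t) \<longlongrightarrow> p) (at_right 0)"
  proof (rule order_tendstoI)
    fix a assume "a < p"
    then obtain t where t: "t > 0" "a < (g t - g 0) / t"
      unfolding p_def using less_cSup_iff[OF ne bdd] by (auto simp: S_def)
    have "a < (g s - g 0) / s" if "0 < s" "s < t" for s using slope[of s t] that t by simp
    then show "\<forall>\<^sub>F s in at_right 0. a < (g s - g 0) / s"
      unfolding eventually_at_right_field using t(1) by blast
  next
    fix a assume "p < a"
    then show "\<forall>\<^sub>F s in at_right 0. (g s - g 0) / s < a"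
      unfolding eventually_at_right_field using up by (intro exI[of _ 1]) (auto intro: le_less_trans)
  qed
  then show thesis using that up \<open>p \<le> U\<close> by (simp add: has_field_derivative_iff)
qed

text \<open>For \<open>q\<close> the gap of \<open>A\<close> at a boundary point and
  \<open>H\<close> the excess of the support function of a larger body, this is how far one can walk
  along the outer normal inside that body: the normal at angle \<eta> allows
  \<open>r * cos \<eta> \<le> q \<eta> + H \<eta>\<close>. Angles with
  \<open>cos \<eta> \<le> 0\<close> never restrict a nonnegative \<open>r\<close>. The definition
  also makes sense when \<open>H\<close> is not a difference of support functions.\<close>

definition reach :: "(real \<Rightarrow> real) \<Rightarrow> (real \<Rightarrow> real) \<Rightarrow> real" where
  "reach q H = (INF \<eta>\<in>{- pi/2<..<pi/2}. (q \<eta> + H \<eta>) / cos \<eta>)"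

section \<open>Bounds and second-order expansion of the reach over a quadratically growing
  gap\<close>

locale reach_gap =
  fixes q :: "real \<Rightarrow> real" and c :: real
  assumes c: "c > 0" and q0: "q 0 = 0" and q_ge: "\<And>\<eta>. \<bar>\<eta>\<bar> < pi/2 \<Longrightarrow> c * \<eta>\<^sup>2 \<le> q \<eta>"
begin

lemma q_nonneg: "\<bar>\<eta>\<bar> < pi/2 \<Longrightarrow> 0 \<le> q \<eta>"
  using q_ge[of \<eta>] c by (meson mult_nonneg_nonneg less_imp_le order_trans zero_le_power2)

lemma cos_pos: "\<bar>\<eta>\<bar> < pi/2 \<Longrightarrow> 0 < cos \<eta>"
  by (rule cos_gt_zero_pi) auto

lemma le_reach_iff:
  assumes H: "\<And>\<eta>. 0 \<le> H \<eta>"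
  shows "a \<le> reach q H \<longleftrightarrow> (\<forall>\<eta>. \<bar>\<eta>\<bar> < pi/2 \<longrightarrow> a * cos \<eta> \<le> q \<eta> + H \<eta>)"
proof -
  let ?I = "{- pi/2<..<pi/2}"
  have I: "\<eta> \<in> ?I \<longleftrightarrow> \<bar>\<eta>\<bar> < pi/2" for \<eta> :: real by (auto simp: abs_less_iff)
  have "0 \<in> ?I" by simp
  then have ne: "?I \<noteq> {}" by blast
  have "bdd_below ((\<lambda>\<eta>. (q \<eta> + H \<eta>) / cos \<eta>) ` ?I)"
  proof (rule bdd_belowI2[of _ 0])
    fix \<eta> assume "\<eta> \<in> ?I"
    then have "\<bar>\<eta>\<bar> < pi/2" using I by blast
    then show "0 \<le> (q \<eta> + H \<eta>) / cos \<eta>" using H[of \<eta>] q_nonneg cos_pos by (simp add: less_imp_le)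
  qed
  from le_cINF_iff[OF ne this] have "a \<le> reach q H \<longleftrightarrow> (\<forall>\<eta>\<in>?I. a \<le> (q \<eta> + H \<eta>) / cos \<eta>)"
    unfolding reach_def by blast
  also have "\<dots> \<longleftrightarrow> (\<forall>\<eta>. \<bar>\<eta>\<bar> < pi/2 \<longrightarrow> a * cos \<eta> \<le> q \<eta> + H \<eta>)"
    using I cos_pos by (auto simp: pos_le_divide_eq)
  finally show ?thesis .
qed

lemma reach_le:
  assumes "\<And>\<eta>. 0 \<le> H \<eta>" "\<bar>\<eta>\<bar> < pi/2"
  shows "reach q H \<le> (q \<eta> + H \<eta>) / cos \<eta>"
proof -
  have "reach q H * cos \<eta> \<le> q \<eta> + H \<eta>" using le_reach_iff[of H "reach q H"] assms by auto
  then show ?thesis using cos_pos[OF assms(2)] by (simp add: pos_le_divide_eq)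
qed

lemma reach_le_0: assumes "\<And>\<eta>. 0 \<le> H \<eta>" shows "reach q H \<le> H 0"
  using reach_le[OF assms, of 0] by (simp add: q0)

lemma reach_nonneg: assumes "\<And>\<eta>. 0 \<le> H \<eta>" shows "0 \<le> reach q H"
  using le_reach_iff[OF assms, of 0] assms q_nonneg by simp

text \<open>For \<open>a \<ge> 0\<close> dropping the factor \<open>cos \<eta>\<close> only
  strengthens the condition; a negative \<open>a\<close> lies below every reach.\<close>

lemma le_reachI:
  assumes H: "\<And>\<eta>. 0 \<le> H \<eta>" and a: "\<And>\<eta>. \<bar>\<eta>\<bar> < pi/2 \<Longrightarrow> a \<le> q \<eta> + H \<eta>" shows "a \<le> reach q H"
proof (cases "0 \<le> a")
  case True
  have "a * cos \<eta> \<le> q \<eta> + H \<eta>" if "\<bar>\<eta>\<bar> < pi/2" for \<eta>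
    by (rule order_trans[OF mult_left_le[OF cos_le_one True] a[OF that]])
  then show ?thesis by (subst le_reach_iff[of H, OF H]) blast
next
  case False then show ?thesis using reach_nonneg[of H, OF H] by simp
qed

lemma reach_mono:
  assumes "\<And>\<eta>. 0 \<le> H \<eta>" "\<And>\<eta>. H \<eta> \<le> H' \<eta>" shows "reach q H \<le> reach q H'"
proof -
  have H': "0 \<le> H' \<eta>" for \<eta> using assms order_trans by blast
  have "reach q H * cos \<eta> \<le> q \<eta> + H \<eta>" if "\<bar>\<eta>\<bar> < pi/2" for \<eta>
    using le_reach_iff[of H "reach q H"] assms(1) that by auto
  then show ?thesis unfolding le_reach_iff[OF H'] using assms(2) by (meson add_left_mono order_trans)
qed

lemma reach_concave:
  assumes "\<And>\<eta>. 0 \<le> H1 \<eta>" "\<And>\<eta>. 0 \<le> H2 \<eta>" "0 \<le> u" "0 \<le> v" "u + v = 1"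
  shows "u * reach q H1 + v * reach q H2 \<le> reach q (\<lambda>\<eta>. u * H1 \<eta> + v * H2 \<eta>)"
proof -
  have 1: "reach q H1 * cos \<eta> \<le> q \<eta> + H1 \<eta>" "reach q H2 * cos \<eta> \<le> q \<eta> + H2 \<eta>" if "\<bar>\<eta>\<bar> < pi/2" for \<eta>
    using le_reach_iff[of H1 "reach q H1"] le_reach_iff[of H2 "reach q H2"] assms(1,2) that by auto
  have "(u * reach q H1 + v * reach q H2) * cos \<eta> \<le> q \<eta> + (u * H1 \<eta> + v * H2 \<eta>)" if "\<bar>\<eta>\<bar> < pi/2" for \<eta>
  proof -
    have "(u * reach q H1 + v * reach q H2) * cos \<eta> = u * (reach q H1 * cos \<eta>) + v * (reach q H2 * cos \<eta>)"
      by (simp add: algebra_simps)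
    also have "\<dots> \<le> u * (q \<eta> + H1 \<eta>) + v * (q \<eta> + H2 \<eta>)"
      using 1[OF that] assms(3,4) by (intro add_mono mult_left_mono)
    also have "\<dots> = (u + v) * q \<eta> + (u * H1 \<eta> + v * H2 \<eta>)" by (simp add: algebra_simps)
    finally show ?thesis using assms(5) by simp
  qed
  then show ?thesis using assms by (subst le_reach_iff) auto
qed

text \<open>Replacing \<open>H\<close> by \<open>H 0 - l * \<bar>\<eta>\<bar>\<close> leaves
  \<open>c * x\<^sup>2 - l * x\<close> to be minimised over \<open>x = \<bar>\<eta>\<bar>\<close>;
  completing the square gives the loss \<open>l\<^sup>2 / (4 * c)\<close>.\<close>

lemma reach_ge_quadratic:
  assumes H: "\<And>\<eta>. 0 \<le> H \<eta>" and lip: "\<And>\<eta>. \<bar>H \<eta> - H 0\<bar> \<le> l * \<bar>\<eta>\<bar>"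
  shows "H 0 - l\<^sup>2 / (4 * c) \<le> reach q H"
proof (rule le_reachI[of H, OF H])
  fix \<eta> :: real assume \<eta>: "\<bar>\<eta>\<bar> < pi/2"
  have "0 \<le> (2 * c * \<bar>\<eta>\<bar> - l)\<^sup>2 / (4 * c)" using c by simp
  also have "\<dots> = c * \<eta>\<^sup>2 - l * \<bar>\<eta>\<bar> + l\<^sup>2 / (4 * c)"
    using c by (simp add: power2_diff power_mult_distrib field_simps) (simp add: power2_eq_square)
  finally show "H 0 - l\<^sup>2 / (4 * c) \<le> q \<eta> + H \<eta>" using q_ge[OF \<eta>] lip[of \<eta>] by simp
qed

text \<open>The competitor \<open>\<eta> = - s d / f\<close> minimises the leading part \<open>f \<eta>\<^sup>2 / 2 + s d \<eta>\<close>.\<close>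

lemma reach_second_order:
  assumes f: "f > 0" and q2: "((\<lambda>\<eta>. q \<eta> / \<eta>\<^sup>2) \<longlongrightarrow> f / 2) (at 0)"
    and h: "\<And>\<eta>. 0 \<le> h \<eta>" and lip: "\<And>\<eta>. \<bar>h \<eta> - h 0\<bar> \<le> l * \<bar>\<eta>\<bar>"
    and d: "(h has_real_derivative d) (at 0)"
  shows "((\<lambda>s. (reach q (\<lambda>\<eta>. s * h \<eta>) - s * h 0) / s\<^sup>2) \<longlongrightarrow> - d\<^sup>2 / (2 * f)) (at_right 0)"
proof (rule order_tendstoI)
  fix a assume a: "a < - d\<^sup>2 / (2 * f)"
  \<comment> \<open>Room for a slack \<open>e\<close> in both first-order data: near 0 the gap is at
    least \<open>(f - e) / 2 * \<eta>\<^sup>2\<close> and \<open>h\<close> falls at most at rate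
    \<open>\<bar>d\<bar> + e\<close>.\<close>
  have "((\<lambda>e. - (\<bar>d\<bar> + e)\<^sup>2 / (2 * (f - e))) \<longlongrightarrow> - (\<bar>d\<bar> + 0)\<^sup>2 / (2 * (f - 0))) (at_right 0)"
    by (intro tendsto_intros) (use f in auto)
  then have "\<forall>\<^sub>F e in at_right 0. a < - (\<bar>d\<bar> + e)\<^sup>2 / (2 * (f - e))"
    using a by (intro order_tendstoD(1)) simp_all
  from eventually_at_right_witness[OF this f]
  obtain e where e: "a < - (\<bar>d\<bar> + e)\<^sup>2 / (2 * (f - e))" "0 < e" "e < f" by blast
  have "\<forall>\<^sub>F \<eta> in at 0. (f - e) / 2 < q \<eta> / \<eta>\<^sup>2" using e(2) by (intro order_tendstoD(1)[OF q2]) simp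
  then obtain d1 where d1: "d1 > 0" "\<And>\<eta>. \<eta> \<noteq> 0 \<Longrightarrow> \<bar>\<eta>\<bar> < d1 \<Longrightarrow> (f - e) / 2 < q \<eta> / \<eta>\<^sup>2"
    unfolding eventually_at by (auto simp: dist_real_def)
  have "((\<lambda>\<eta>. (h \<eta> - h 0) / (\<eta> - 0)) \<longlongrightarrow> d) (at 0)" using d by (simp add: has_field_derivative_iff)
  then have "\<forall>\<^sub>F \<eta> in at 0. dist ((h \<eta> - h 0) / (\<eta> - 0)) d < e" using e(2) by (rule tendstoD)
  then obtain d2 where d2: "d2 > 0" "\<And>\<eta>. \<eta> \<noteq> 0 \<Longrightarrow> \<bar>\<eta>\<bar> < d2 \<Longrightarrow> \<bar>(h \<eta> - h 0) / \<eta> - d\<bar> < e"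
    unfolding eventually_at by (auto simp: dist_real_def)
  define \<delta> where "\<delta> = min d1 d2"
  have \<delta>: "\<delta> > 0" using d1(1) d2(1) by (simp add: \<delta>_def)
  have q_near: "(f - e) / 2 * \<eta>\<^sup>2 \<le> q \<eta>" and h_near: "h 0 - (\<bar>d\<bar> + e) * \<bar>\<eta>\<bar> \<le> h \<eta>" if "\<bar>\<eta>\<bar> < \<delta>" for \<eta>
  proof -
    show "(f - e) / 2 * \<eta>\<^sup>2 \<le> q \<eta>"
    proof (cases "\<eta> = 0")
      case False
      then have "(f - e) / 2 < q \<eta> / \<eta>\<^sup>2" using d1(2)[of \<eta>] that by (simp add: \<delta>_def)
      then show ?thesis using False by (simp add: pos_less_divide_eq less_imp_le)
    qed (simp add: q0)
    show "h 0 - (\<bar>d\<bar> + e) * \<bar>\<eta>\<bar> \<le> h \<eta>"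
    proof (cases "\<eta> = 0")
      case False
      then have "\<bar>(h \<eta> - h 0) / \<eta> - d\<bar> < e" using d2(2)[of \<eta>] that by (simp add: \<delta>_def)
      then have "\<bar>(h \<eta> - h 0) / \<eta>\<bar> \<le> \<bar>d\<bar> + e" by linarith
      then have "\<bar>h \<eta> - h 0\<bar> \<le> (\<bar>d\<bar> + e) * \<bar>\<eta>\<bar>" using False by (simp add: abs_divide pos_divide_le_eq)
      then show ?thesis by linarith
    qed simp
  qed
  \<comment> \<open>The maximum with 1 makes the Lipschitz constant positive, so that it may appear
    as a divisor.\<close>
  define l' where "l' = max l 1"
  have lip': "\<bar>h \<eta> - h 0\<bar> \<le> l' * \<bar>\<eta>\<bar>" for \<eta>
    using lip[of \<eta>] by (rule order_trans) (simp add: l'_def mult_right_mono)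
  have l': "l' > 0" by (simp add: l'_def)
  define m where "m = (\<bar>d\<bar> + e)\<^sup>2 / (2 * (f - e))"
  \<comment> \<open>For \<open>\<bar>\<eta>\<bar> < \<delta>\<close> the sharp local bounds apply.
    For larger \<eta> the condition on \<open>s\<close> gives
    \<open>s * l' \<le> c * \<bar>\<eta>\<bar>\<close>, so the gap absorbs the whole variation of
    \<open>s * h\<close>.\<close>
  have "a < (reach q (\<lambda>\<eta>. s * h \<eta>) - s * h 0) / s\<^sup>2" if s: "0 < s" "s < c * \<delta> / l'" for s
  proof -
    have key: "s * h 0 - s\<^sup>2 * m \<le> q \<eta> + s * h \<eta>" if \<eta>: "\<bar>\<eta>\<bar> < pi/2" for \<eta>
    proof (cases "\<bar>\<eta>\<bar> < \<delta>")
      case True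
      have "0 \<le> ((f - e) * \<bar>\<eta>\<bar> - s * (\<bar>d\<bar> + e))\<^sup>2 / (2 * (f - e))" using e by simp
      also have "\<dots> = (f - e) / 2 * \<eta>\<^sup>2 - s * ((\<bar>d\<bar> + e) * \<bar>\<eta>\<bar>) + s\<^sup>2 * m"
      proof -
        have E: "((f - e) * \<bar>\<eta>\<bar> - s * (\<bar>d\<bar> + e))\<^sup>2 = (f - e) * (f - e) * \<eta>\<^sup>2 - 2 * (f - e) * (s * ((\<bar>d\<bar> + e) * \<bar>\<eta>\<bar>)) + s\<^sup>2 * (\<bar>d\<bar> + e)\<^sup>2"
        proof -
          have "(A * x - s * D)\<^sup>2 = A * A * x\<^sup>2 - 2 * A * (s * (D * x)) + s\<^sup>2 * D\<^sup>2" for A x D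
            by (simp add: power2_eq_square algebra_simps)
          from this[of "f - e" "\<bar>\<eta>\<bar>" "\<bar>d\<bar> + e"] show ?thesis by simp
        qed
        have I: "(A * A * X - 2 * A * Y + Z) / (2 * A) = A / 2 * X - Y + Z / (2 * A)" if "A \<noteq> 0" for A X Y Z :: real
          using that by (simp add: field_simps)
        have "f - e \<noteq> 0" using e by simp
        from I[OF this] show ?thesis unfolding m_def E by (simp only: times_divide_eq_right)
      qed
      finally show ?thesis using q_near[OF True] mult_left_mono[OF h_near[OF True], of s] s(1)
        by (simp add: right_diff_distrib)
    next
      case False
      have "s * l' \<le> c * \<delta>" using s(2) l' by (simp add: pos_less_divide_eq less_imp_le)
      also have "\<dots> \<le> c * \<bar>\<eta>\<bar>" using False c by simp
      finally have "s * l' * \<bar>\<eta>\<bar> \<le> c * \<bar>\<eta>\<bar> * \<bar>\<eta>\<bar>" by (simp add: mult_right_mono)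
      moreover have "s * (h 0 - l' * \<bar>\<eta>\<bar>) \<le> s * h \<eta>" using lip'[of \<eta>] s(1) by (intro mult_left_mono) auto
      moreover have "0 \<le> s\<^sup>2 * m" using e by (simp add: m_def)
      ultimately show ?thesis using q_ge[OF \<eta>] by (simp add: algebra_simps power2_eq_square)
    qed
    have "s * h 0 - s\<^sup>2 * m \<le> reach q (\<lambda>\<eta>. s * h \<eta>)" using h s(1) by (intro le_reachI key) auto
    then have "- m * s\<^sup>2 \<le> reach q (\<lambda>\<eta>. s * h \<eta>) - s * h 0" by (simp add: mult.commute)
    then have "- m \<le> (reach q (\<lambda>\<eta>. s * h \<eta>) - s * h 0) / s\<^sup>2" using s(1) by (simp add: pos_le_divide_eq)
    then show ?thesis using e(1) by (simp add: m_def)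
  qed
  then show "\<forall>\<^sub>F s in at_right 0. a < (reach q (\<lambda>\<eta>. s * h \<eta>) - s * h 0) / s\<^sup>2"
    unfolding eventually_at_right_field using c \<delta> l' by (intro exI[of _ "c * \<delta> / l'"]) auto
next
  fix a assume a: "- d\<^sup>2 / (2 * f) < a"
  define k where "k = - d / f"
  \<comment> \<open>The removable singularity is filled in so that composing with
    \<open>k * s\<close> is legitimate even when \<open>d = 0\<close>, where \<open>k * s\<close> is
    constantly 0.\<close>
  define \<psi> where "\<psi> \<eta> = (if \<eta> = 0 then f / 2 else q \<eta> / \<eta>\<^sup>2)" for \<eta>
  have "\<psi> \<midarrow>0\<rightarrow> f / 2"
    using q2 by (rule Lim_transform_eventually) (auto simp: \<psi>_def eventually_at intro: exI[of _ 1])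
  then have \<psi>: "\<psi> \<midarrow>0\<rightarrow> \<psi> 0" by (simp add: \<psi>_def)
  have q\<psi>: "q \<eta> = \<psi> \<eta> * \<eta>\<^sup>2" for \<eta> by (simp add: \<psi>_def q0)
  \<comment> \<open>The value of the competitor \<open>\<eta> = k * s\<close>, minus
    \<open>s * h 0\<close> and divided by \<open>s\<^sup>2\<close>, arranged into terms with known
    limits. The factor \<open>1 / cos\<close> contributes nothing, since
    \<open>1 / cos (k * s) - 1\<close> has derivative 0.\<close>
  define U where "U s = (\<psi> (k * s) * k\<^sup>2 + (h (k * s) - h 0) / s) / cos (k * s) + h 0 * ((1 / cos (k * s) - 1) / s)" for s
  have ks: "((\<lambda>s. k * s) \<longlongrightarrow> 0) (at_right 0)"
    using tendsto_mult[OF tendsto_const[of k] tendsto_ident_at[of 0 "{0<..}"]] by simp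
  have "((\<lambda>s. h (k * s)) has_real_derivative d * k) (at 0)"
    by (rule DERIV_chain2[of h]) (use d in \<open>auto intro!: derivative_eq_intros\<close>)
  then have h_lim: "((\<lambda>s. (h (k * s) - h 0) / s) \<longlongrightarrow> d * k) (at_right 0)"
    unfolding has_field_derivative_iff by (auto intro: tendsto_within_subset)
  have "((\<lambda>s. 1 / cos (k * s)) has_real_derivative 0) (at 0)"
    by (auto intro!: derivative_eq_intros)
  then have c_lim: "((\<lambda>s. (1 / cos (k * s) - 1) / s) \<longlongrightarrow> 0) (at_right 0)"
    unfolding has_field_derivative_iff by (auto intro: tendsto_within_subset)
  have cos_lim: "((\<lambda>s. cos (k * s)) \<longlongrightarrow> 1) (at_right 0)" using tendsto_cos[OF ks] by simp
  have "(U \<longlongrightarrow> (\<psi> 0 * k\<^sup>2 + d * k) / 1 + h 0 * 0) (at_right 0)"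
    unfolding U_def[abs_def]
    by (intro tendsto_intros tendsto_compose[OF \<psi> ks] h_lim c_lim cos_lim) simp
  moreover have "(\<psi> 0 * k\<^sup>2 + d * k) / 1 + h 0 * 0 = - d\<^sup>2 / (2 * f)"
    using f by (simp add: \<psi>_def k_def power2_eq_square field_simps)
  ultimately have "\<forall>\<^sub>F s in at_right 0. U s < a" using a by (intro order_tendstoD(2)) simp_all
  moreover have "\<forall>\<^sub>F s in at_right 0. dist (k * s) 0 < pi / 2" by (rule tendstoD[OF ks]) simp
  moreover have "\<forall>\<^sub>F s in at_right (0::real). s > 0" by (simp add: eventually_at_filter)
  ultimately show "\<forall>\<^sub>F s in at_right 0. (reach q (\<lambda>\<eta>. s * h \<eta>) - s * h 0) / s\<^sup>2 < a"
  proof eventually_elim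
    case (elim s)
    have ks: "\<bar>k * s\<bar> < pi / 2" using elim(2) by (simp add: dist_real_def)
    have cp: "cos (k * s) > 0" using cos_pos[OF ks] .
    have "reach q (\<lambda>\<eta>. s * h \<eta>) \<le> (q (k * s) + s * h (k * s)) / cos (k * s)"
      using h elim(3) ks by (intro reach_le) auto
    then have "(reach q (\<lambda>\<eta>. s * h \<eta>) - s * h 0) / s\<^sup>2 \<le> ((q (k * s) + s * h (k * s)) / cos (k * s) - s * h 0) / s\<^sup>2"
      using elim(3) by (simp add: divide_right_mono)
    also have "\<dots> = U s"
      unfolding U_def q\<psi>[of "k * s"] using elim(3) cp by (simp add: field_simps power2_eq_square)
    finally show ?case using elim(1) by linarith
  qed
qed

end

section \<open>The height as a concave function of two parameters\<close>

locale reach_pair = reach_gap +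
  fixes B C :: "real \<Rightarrow> real" and l \<kappa> :: real
  assumes B: "\<And>\<eta>. 0 \<le> B \<eta>" and C: "\<And>\<eta>. 0 \<le> C \<eta>"
    and \<kappa>: "0 < \<kappa>" "\<kappa> \<le> 1" "\<And>\<eta>. \<kappa> * C \<eta> \<le> B \<eta>"
    and lipB: "\<And>\<eta>. \<bar>B \<eta> - B 0\<bar> \<le> l * \<bar>\<eta>\<bar>" and lipC: "\<And>\<eta>. \<bar>C \<eta> - C 0\<bar> \<le> l * \<bar>\<eta>\<bar>"
begin

definition R :: "real \<Rightarrow> real \<Rightarrow> real" where
  "R s t = reach q (\<lambda>\<eta>. s * B \<eta> + t * C \<eta>)"

text \<open>This is the purpose of \<kappa>: for \<open>s > 0\<close> the value \<open>t = 0\<close>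
  becomes an interior point of the range where concavity in \<open>t\<close> is available. As
  \<open>\<kappa> \<le> 1\<close>, one also has \<open>\<bar>t\<bar> \<le> s\<close> for the
  negative \<open>t\<close> allowed.\<close>

lemma combination_nonneg:
  assumes "0 \<le> s" "- \<kappa> * s \<le> t" shows "0 \<le> s * B \<eta> + t * C \<eta>"
proof -
  have "- (\<kappa> * s) * C \<eta> \<le> t * C \<eta>" using assms C by (intro mult_right_mono) auto
  moreover have "s * (\<kappa> * C \<eta>) \<le> s * B \<eta>" using assms(1) \<kappa>(3) by (intro mult_left_mono)
  ultimately show ?thesis by (simp add: algebra_simps)
qed

lemma R_concave:
  assumes "0 \<le> s" "- \<kappa> * s \<le> t1" "- \<kappa> * s \<le> t2" "0 \<le> u" "0 \<le> v" "u + v = 1"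
  shows "u * R s t1 + v * R s t2 \<le> R s (u * t1 + v * t2)"
proof -
  have "(\<lambda>\<eta>. s * B \<eta> + (u * t1 + v * t2) * C \<eta>)
      = (\<lambda>\<eta>. u * (s * B \<eta> + t1 * C \<eta>) + v * (s * B \<eta> + t2 * C \<eta>))"
  proof
    fix \<eta>
    have "u * (s * B \<eta> + t1 * C \<eta>) + v * (s * B \<eta> + t2 * C \<eta>) = (u + v) * (s * B \<eta>) + (u * t1 + v * t2) * C \<eta>"
      by (simp add: algebra_simps)
    then show "s * B \<eta> + (u * t1 + v * t2) * C \<eta> = u * (s * B \<eta> + t1 * C \<eta>) + v * (s * B \<eta> + t2 * C \<eta>)"
      using assms(6) by simp
  qed
  then show ?thesis unfolding R_def
    using reach_concave[of "\<lambda>\<eta>. s * B \<eta> + t1 * C \<eta>" "\<lambda>\<eta>. s * B \<eta> + t2 * C \<eta>" u v] assms combination_nonneg by simp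
qed

lemma R_le: assumes "0 \<le> s" "- \<kappa> * s \<le> t" shows "R s t \<le> s * B 0 + t * C 0"
  unfolding R_def by (rule reach_le_0[OF combination_nonneg[OF assms]])

lemma R_nonneg: assumes "0 \<le> s" "- \<kappa> * s \<le> t" shows "0 \<le> R s t"
  unfolding R_def by (rule reach_nonneg[OF combination_nonneg[OF assms]])

lemma R_ge: assumes "0 \<le> s" "- \<kappa> * s \<le> t"
  shows "s * B 0 + t * C 0 - (l * (s + \<bar>t\<bar>))\<^sup>2 / (4 * c) \<le> R s t"
  unfolding R_def
proof (rule reach_ge_quadratic[OF combination_nonneg[OF assms]])
  fix \<eta>
  have "\<bar>s * (B \<eta> - B 0) + t * (C \<eta> - C 0)\<bar> \<le> s * \<bar>B \<eta> - B 0\<bar> + \<bar>t\<bar> * \<bar>C \<eta> - C 0\<bar>"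
    using assms(1) abs_triangle_ineq[of "s * (B \<eta> - B 0)" "t * (C \<eta> - C 0)"] by (simp add: abs_mult)
  also have "\<dots> \<le> s * (l * \<bar>\<eta>\<bar>) + \<bar>t\<bar> * (l * \<bar>\<eta>\<bar>)"
    using lipB lipC assms(1) by (intro add_mono mult_left_mono) auto
  finally show "\<bar>s * B \<eta> + t * C \<eta> - (s * B 0 + t * C 0)\<bar> \<le> l * (s + \<bar>t\<bar>) * \<bar>\<eta>\<bar>"
    by (simp add: algebra_simps)
qed

lemma R_mono: assumes "0 \<le> s" "0 \<le> t1" "t1 \<le> t2" shows "R s t1 \<le> R s t2"
  unfolding R_def using assms B C by (intro reach_mono) (auto intro!: mult_right_mono)

lemma R_slope:
  assumes "0 \<le> s" "- \<kappa> * s \<le> a" "a < b" "b < d" shows "(R s d - R s b) / (d - b) \<le> (R s b - R s a) / (b - a)"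
proof -
  define u v where "u = (d - b) / (d - a)" and "v = (b - a) / (d - a)"
  have uv: "0 \<le> u" "0 \<le> v" "u + v = 1" "u * a + v * d = b"
    using assms unfolding u_def v_def by (auto simp: add_divide_distrib[symmetric] field_simps)
  have "u * R s a + v * R s d \<le> R s (u * a + v * d)"
    using assms uv by (intro R_concave) auto
  then have "(d - a) * (u * R s a + v * R s d) \<le> (d - a) * R s b" using uv(4) assms by (intro mult_left_mono) auto
  moreover have "(d - a) * u = d - b" "(d - a) * v = b - a" using assms by (auto simp: u_def v_def)
  ultimately have "(d - b) * R s a + (b - a) * R s d \<le> (d - a) * R s b"
    by (simp add: distrib_left mult.assoc[symmetric])
  then have "(R s d - R s b) * (b - a) \<le> (R s b - R s a) * (d - b)" by (simp add: algebra_simps)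
  then show ?thesis using assms by (simp add: divide_simps mult.commute)
qed

definition slope :: "real \<Rightarrow> real" where
  "slope s = (THE p. (R s has_real_derivative p) (at_right 0))"

lemma R_00: "R 0 0 = 0" using R_le[of 0 0] R_nonneg[of 0 0] by simp

text \<open>Concavity makes the right difference quotients decrease in \<open>t\<close>. For
  \<open>s > 0\<close> they are bounded by any quotient over \<open>[- r, 0]\<close>, which also
  bounds the derivative. For \<open>s = 0\<close> no negative \<open>t\<close> is available, and the
  bound is \<open>R 0 t \<le> t * C 0\<close>.\<close>

lemma slope_exists:
  assumes s: "0 \<le> s"
  shows "\<exists>p. (R s has_real_derivative p) (at_right 0)
    \<and> (\<forall>t>0. (R s t - R s 0) / t \<le> p)
    \<and> (s > 0 \<longrightarrow> (\<forall>r. 0 < r \<longrightarrow> r \<le> \<kappa> * s \<longrightarrow> p \<le> (R s 0 - R s (- r)) / r)) \<and> (s = 0 \<longrightarrow> p \<le> C 0)"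
proof -
  have ks: "0 \<le> \<kappa> * s" using s \<kappa>(1) by simp
  have dec: "(R s t2 - R s 0) / t2 \<le> (R s t1 - R s 0) / t1" if t: "0 < t1" "t1 \<le> t2" for t1 t2
  proof (cases "t1 = t2")
    case False
    define k where "k = (R s t1 - R s 0) / t1"
    have "(R s t2 - R s t1) / (t2 - t1) \<le> k" using R_slope[of s 0 t1 t2] s ks t False by (simp add: k_def)
    then have "R s t2 - R s t1 \<le> k * (t2 - t1)" using t False by (simp add: pos_divide_le_eq)
    moreover have "R s t1 - R s 0 = k * t1" using t by (simp add: k_def)
    ultimately have "R s t2 - R s 0 \<le> k * t2" by (simp add: right_diff_distrib)
    then show ?thesis using t by (simp add: pos_divide_le_eq k_def)
  qed simp
  show ?thesis
  proof (cases "s = 0")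
    case True
    have "(R s t - R s 0) / t \<le> C 0" if "0 < t" for t
      using R_le[of 0 t] that True R_00 by (simp add: pos_divide_le_eq mult.commute)
    from decreasing_slope_right_derivative[of "R s", OF dec this] show ?thesis using True by (metis less_irrefl)
  next
    case False
    have b: "(R s t - R s 0) / t \<le> (R s 0 - R s (- r)) / r" if "0 < t" "0 < r" "r \<le> \<kappa> * s" for t r
      using R_slope[of s "- r" 0 t] s that by simp
    have "0 < \<kappa> * s" using False s \<kappa>(1) by simp
    from decreasing_slope_right_derivative[of "R s", OF dec b[OF _ this order_refl]]
    obtain p where p: "(R s has_real_derivative p) (at_right 0)" "\<And>t. 0 < t \<Longrightarrow> (R s t - R s 0) / t \<le> p" by metis
    have "p \<le> (R s 0 - R s (- r)) / r" if "0 < r" "r \<le> \<kappa> * s" for r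
    proof (rule tendsto_upperbound)
      show "((\<lambda>t. (R s t - R s 0) / (t - 0)) \<longlongrightarrow> p) (at_right 0)" using p(1) by (simp add: has_field_derivative_iff)
      show "\<forall>\<^sub>F t in at_right 0. (R s t - R s 0) / (t - 0) \<le> (R s 0 - R s (- r)) / r"
        using b that by (auto simp: eventually_at_filter)
    qed simp
    then show ?thesis using p False by blast
  qed
qed

lemma slope_derivative: assumes "0 \<le> s" shows "(R s has_real_derivative slope s) (at_right 0)"
proof -
  obtain p where p: "(R s has_real_derivative p) (at_right 0)" using slope_exists[OF assms] by blast
  have "p' = p" if "(R s has_real_derivative p') (at_right 0)" for p'
    using p that tendsto_unique[OF trivial_limit_at_right_real] unfolding has_field_derivative_iff by blast
  then show ?thesis unfolding slope_def using p by (metis (no_types, lifting) the_equality)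
qed

lemma slope_bounds:
  assumes "0 \<le> s"
  shows "0 < t \<Longrightarrow> (R s t - R s 0) / t \<le> slope s"
    "0 < r \<Longrightarrow> r \<le> \<kappa> * s \<Longrightarrow> slope s \<le> (R s 0 - R s (- r)) / r" "slope 0 \<le> C 0"
proof -
  have eq: "p = slope s" if "(R s has_real_derivative p) (at_right 0)" "0 \<le> s" for p s
    using slope_derivative[OF that(2)] that(1) tendsto_unique[OF trivial_limit_at_right_real] unfolding has_field_derivative_iff by blast
  show "0 < t \<Longrightarrow> (R s t - R s 0) / t \<le> slope s" using slope_exists[OF assms] eq[OF _ assms] by metis
  show "slope s \<le> (R s 0 - R s (- r)) / r" if r: "0 < r" "r \<le> \<kappa> * s"
  proof -
    have "s > 0" using assms r by (cases "s = 0") auto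
    then show ?thesis using slope_exists[OF assms] eq[OF _ assms] r by metis
  qed
  show "slope 0 \<le> C 0" using slope_exists[of 0] eq[of 0] by auto
qed

text \<open>Together with \<open>slope_upper\<close> this gives a deviation from \<open>C 0\<close>
  of order \<open>s\<close> with constants independent of the base angle, which dominates the second
  limit.\<close>

lemma slope_lower: assumes "0 \<le> s" shows "C 0 - (2 * l)\<^sup>2 / (4 * c) * s \<le> slope s"
proof (cases "s = 0")
  case True
  have "((\<lambda>t. C 0 - l\<^sup>2 / (4 * c) * t) \<longlongrightarrow> C 0 - l\<^sup>2 / (4 * c) * 0) (at_right 0)" by (intro tendsto_intros)
  moreover have "((\<lambda>t. (R 0 t - R 0 0) / (t - 0)) \<longlongrightarrow> slope 0) (at_right 0)"
    using slope_derivative[of 0] by (simp add: has_field_derivative_iff)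
  moreover have "\<forall>\<^sub>F t in at_right 0. C 0 - l\<^sup>2 / (4 * c) * t \<le> (R 0 t - R 0 0) / (t - 0)"
  proof -
    have "C 0 - l\<^sup>2 / (4 * c) * t \<le> (R 0 t - R 0 0) / (t - 0)" if "0 < t" for t
    proof -
      have "(t * C 0 - (l * t)\<^sup>2 / (4 * c)) / t \<le> R 0 t / t"
        using R_ge[of 0 t] that by (intro divide_right_mono) auto
      moreover have "(t * C 0 - (l * t)\<^sup>2 / (4 * c)) / t = C 0 - l\<^sup>2 / (4 * c) * t"
        using that by (simp add: diff_divide_distrib power2_eq_square)
      ultimately show ?thesis using R_00 by simp
    qed
    then show ?thesis by (auto simp: eventually_at_filter)
  qed
  ultimately have "C 0 - l\<^sup>2 / (4 * c) * 0 \<le> slope 0"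
    by (intro tendsto_le[of "at_right 0" "\<lambda>t. (R 0 t - R 0 0) / (t - 0)" _ "\<lambda>t. C 0 - l\<^sup>2 / (4 * c) * t"]) auto
  then show ?thesis using True by simp
next
  case False
  then have s: "s > 0" using assms by simp
  \<comment> \<open>At \<open>t = s\<close> the quadratic loss is a multiple of
    \<open>s\<^sup>2\<close>, hence of order \<open>s\<close> once the increment is divided by
    \<open>s\<close>.\<close>
  have "s * B 0 + s * C 0 - (l * (2 * s))\<^sup>2 / (4 * c) \<le> R s s" 
  proof -
    have "0 \<le> \<kappa> * s" using s \<kappa>(1) by simp
    then have "- \<kappa> * s \<le> s" using s by linarith
    then show ?thesis using R_ge[of s s] s by simp
  qed
  moreover have "R s 0 \<le> s * B 0" using R_le[of s 0] s \<kappa>(1) by simp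
  ultimately have "s * C 0 - (l * (2 * s))\<^sup>2 / (4 * c) \<le> R s s - R s 0" by simp
  then have "(s * C 0 - (l * (2 * s))\<^sup>2 / (4 * c)) / s \<le> (R s s - R s 0) / s" using s by (simp add: divide_right_mono)
  also have "\<dots> \<le> slope s" using slope_bounds(1)[OF assms s] .
  finally show ?thesis using s by (simp add: diff_divide_distrib power2_eq_square algebra_simps)
qed

lemma slope_upper: assumes "0 \<le> s" shows "slope s \<le> C 0 + (2 * l)\<^sup>2 / (4 * c * \<kappa>) * s"
proof (cases "s = 0")
  case True then show ?thesis using slope_bounds(3)[of 0] by simp
next
  case False
  then have s: "s > 0" using assms by simp
  have ks: "0 < \<kappa> * s" using s \<kappa>(1) by simp
  \<comment> \<open>The leftmost admissible \<open>t\<close>. Dividing the quadratic loss by the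
    interval length \<open>\<kappa> * s\<close> is what puts \<kappa> into the denominator.\<close>
  have "s * B 0 + (- (\<kappa> * s)) * C 0 - (l * (s + \<bar>- (\<kappa> * s)\<bar>))\<^sup>2 / (4 * c) \<le> R s (- (\<kappa> * s))"
    using R_ge[of s "- (\<kappa> * s)"] s by simp
  moreover have "(l * (s + \<bar>- (\<kappa> * s)\<bar>))\<^sup>2 / (4 * c) \<le> (l * (2 * s))\<^sup>2 / (4 * c)"
  proof -
    have "(s + \<kappa> * s)\<^sup>2 \<le> (2 * s)\<^sup>2" using s \<kappa> by (intro power_mono) (auto simp: mult_left_le_one_le)
    then have "l\<^sup>2 * (s + \<kappa> * s)\<^sup>2 \<le> l\<^sup>2 * (2 * s)\<^sup>2" by (intro mult_left_mono) auto
    then show ?thesis using ks c unfolding power_mult_distrib[of l] by (intro divide_right_mono) auto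
  qed
  moreover have "R s 0 \<le> s * B 0" using R_le[of s 0] s \<kappa>(1) by simp
  ultimately have "R s 0 - R s (- (\<kappa> * s)) \<le> (\<kappa> * s) * C 0 + (l * (2 * s))\<^sup>2 / (4 * c)" by simp
  then have "(R s 0 - R s (- (\<kappa> * s))) / (\<kappa> * s) \<le> ((\<kappa> * s) * C 0 + (l * (2 * s))\<^sup>2 / (4 * c)) / (\<kappa> * s)"
    using ks by (simp add: divide_right_mono)
  also have "\<dots> = C 0 + (2 * l)\<^sup>2 / (4 * c * \<kappa>) * s"
    using s \<kappa>(1) c by (simp add: field_simps power2_eq_square)
  finally show ?thesis using slope_bounds(2)[OF assms ks order_refl] by linarith
qed

text \<open>By concavity the right derivative lies between the difference quotients at \<open>t = \<plusminus>k s\<close>, whose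
  expansions differ by \<open>O(k s)\<close>; then \<open>k\<close> tends to \<open>0\<close>.\<close>

lemma slope_first_order:
  assumes f: "f > 0" and q2: "((\<lambda>\<eta>. q \<eta> / \<eta>\<^sup>2) \<longlongrightarrow> f / 2) (at 0)"
    and dB: "(B has_real_derivative b) (at 0)" and dC: "(C has_real_derivative d) (at 0)"
  shows "((\<lambda>s. (slope s - C 0) / s) \<longlongrightarrow> - b * d / f) (at_right 0)"
proof -
  \<comment> \<open>The second-order remainder along the ray \<open>t = k * s\<close>; on each ray
    the height is that of the single function \<open>B + k * C\<close> scaled by
    \<open>s\<close>.\<close>
  define Q where "Q k s = (R s (k * s) - s * (B 0 + k * C 0)) / s\<^sup>2" for k s
  have lim: "(Q k \<longlongrightarrow> - (b + k * d)\<^sup>2 / (2 * f)) (at_right 0)" if k: "- \<kappa> \<le> k" "k \<le> \<kappa>" for k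
  proof -
    have "((\<lambda>s. (reach q (\<lambda>\<eta>. s * (B \<eta> + k * C \<eta>)) - s * (B 0 + k * C 0)) / s\<^sup>2) \<longlongrightarrow> - (b + k * d)\<^sup>2 / (2 * f)) (at_right 0)"
    proof (rule reach_second_order[OF f q2, where l = "2 * l"])
      show "0 \<le> B \<eta> + k * C \<eta>" for \<eta> using combination_nonneg[of 1 k \<eta>] k by simp
      show "((\<lambda>\<eta>. B \<eta> + k * C \<eta>) has_real_derivative b + k * d) (at 0)"
        by (auto intro!: derivative_eq_intros dB dC)
      fix \<eta>
      have "\<bar>k * (C \<eta> - C 0)\<bar> \<le> 1 * (l * \<bar>\<eta>\<bar>)"
        unfolding abs_mult using lipC[of \<eta>] k \<kappa> by (intro mult_mono) auto
      then show "\<bar>B \<eta> + k * C \<eta> - (B 0 + k * C 0)\<bar> \<le> 2 * l * \<bar>\<eta>\<bar>"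
        using lipB[of \<eta>] by (simp add: right_diff_distrib)
    qed
    moreover have "reach q (\<lambda>\<eta>. s * (B \<eta> + k * C \<eta>)) = R s (k * s)" for s
      unfolding R_def by (simp add: algebra_simps)
    ultimately show ?thesis unfolding Q_def by simp
  qed
  \<comment> \<open>Polarisation: from \<open>(b + k * d)\<^sup>2 - b\<^sup>2\<close> only the cross
    term survives as \<open>k\<close> tends to 0, and the error is linear in \<open>k\<close>. In
    the difference of the two quotients the terms with \<open>B 0\<close> cancel.\<close>
  have Q_lim: "((\<lambda>s. (Q k s - Q 0 s) / k) \<longlongrightarrow> - b * d / f - k * (d\<^sup>2 / (2 * f))) (at_right 0)"
    if "- \<kappa> \<le> k" "k \<le> \<kappa>" "k \<noteq> 0" for k
  proof -
    have "((\<lambda>s. (Q k s - Q 0 s) / k) \<longlongrightarrow> (- (b + k * d)\<^sup>2 / (2 * f) - (- (b + 0 * d)\<^sup>2 / (2 * f))) / k) (at_right 0)"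
      using that \<kappa>(1) by (intro tendsto_intros lim) auto
    moreover have "(- (b + k * d)\<^sup>2 / (2 * f) - (- (b + 0 * d)\<^sup>2 / (2 * f))) / k = - b * d / f - k * (d\<^sup>2 / (2 * f))"
      using that(3) f by (simp add: field_simps power2_eq_square)
    ultimately show ?thesis by simp
  qed
  have ineq1: "(Q k s - Q 0 s) / k \<le> (slope s - C 0) / s" if "0 < s" "0 < k" for k s
  proof -
    have "(R s (k * s) - R s 0) / (k * s) \<le> slope s" using slope_bounds(1)[of s "k * s"] that by simp
    then have "((R s (k * s) - R s 0) / (k * s) - C 0) / s \<le> (slope s - C 0) / s" using that by (simp add: divide_right_mono)
    moreover have "((R s (k * s) - R s 0) / (k * s) - C 0) / s = (Q k s - Q 0 s) / k"
      using that by (simp add: Q_def field_simps power2_eq_square)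
    ultimately show ?thesis by simp
  qed
  have ineq2: "(slope s - C 0) / s \<le> (Q (- k) s - Q 0 s) / (- k)" if "0 < s" "0 < k" "k \<le> \<kappa>" for k s
  proof -
    have "slope s \<le> (R s 0 - R s (- (k * s))) / (k * s)" using slope_bounds(2)[of s "k * s"] that by simp
    then have "(slope s - C 0) / s \<le> ((R s 0 - R s (- (k * s))) / (k * s) - C 0) / s" using that by (simp add: divide_right_mono)
    moreover have "((R s 0 - R s (- (k * s))) / (k * s) - C 0) / s = (Q (- k) s - Q 0 s) / (- k)"
      using that by (simp add: Q_def field_simps power2_eq_square)
    ultimately show ?thesis by simp
  qed
  have small: "\<exists>k. 0 < k \<and> k < \<kappa> \<and> k * (d\<^sup>2 / (2 * f)) < e" if "0 < e" for e
  proof -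
    have "((\<lambda>k. k * (d\<^sup>2 / (2 * f))) \<longlongrightarrow> 0 * (d\<^sup>2 / (2 * f))) (at_right 0)" by (intro tendsto_intros)
    then have "\<forall>\<^sub>F k in at_right 0. k * (d\<^sup>2 / (2 * f)) < e" using that by (intro order_tendstoD(2)) simp_all
    from eventually_at_right_witness[OF this \<kappa>(1)] show ?thesis by blast
  qed
  have pos: "\<forall>\<^sub>F s in at_right (0::real). s > 0" by (simp add: eventually_at_filter)
  show ?thesis
  proof (rule order_tendstoI)
    fix a assume "a < - b * d / f"
    then obtain k where k: "0 < k" "k < \<kappa>" "k * (d\<^sup>2 / (2 * f)) < - b * d / f - a" using small[of "- b * d / f - a"] by auto
    then have "\<forall>\<^sub>F s in at_right 0. a < (Q k s - Q 0 s) / k" by (intro order_tendstoD(1)[OF Q_lim]) auto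
    with pos show "\<forall>\<^sub>F s in at_right 0. a < (slope s - C 0) / s"
      by eventually_elim (use k ineq1 in \<open>auto intro: less_le_trans\<close>)
  next
    fix a assume "- b * d / f < a"
    then obtain k where k: "0 < k" "k < \<kappa>" "k * (d\<^sup>2 / (2 * f)) < a - - b * d / f" using small[of "a - - b * d / f"] by auto
    then have "\<forall>\<^sub>F s in at_right 0. (Q (- k) s - Q 0 s) / (- k) < a" by (intro order_tendstoD(2)[OF Q_lim]) auto
    with pos show "\<forall>\<^sub>F s in at_right 0. (slope s - C 0) / s < a"
    proof eventually_elim
      case (elim s)
      then show ?case using ineq2[of s k] k by auto
    qed
  qed
qed

end

section \<open>Normal coordinates\<close>

text \<open>Sturm comparison: multiply \<open>g'' + g \<ge> 0\<close> by \<open>sin (\<eta> - t)\<close> and integrate over \<open>[0, \<eta>]\<close>.\<close>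

lemma oscillator_nonneg:
  fixes g g' g2 :: "real \<Rightarrow> real"
  assumes g: "\<And>t. (g has_real_derivative g' t) (at t)" "\<And>t. (g' has_real_derivative g2 t) (at t)"
    and pos: "\<And>t. 0 \<le> g2 t + g t" and init: "g 0 = 0" "g' 0 = 0"
    and \<eta>: "0 \<le> \<eta>" "\<eta> \<le> pi"
  shows "0 \<le> g \<eta>"
proof -
  \<comment> \<open>Chosen so that \<open>\<phi> 0 = 0\<close> by the initial conditions and
    \<open>\<phi> \<eta> = g \<eta>\<close>, while the derivative is
    \<open>(g2 t + g t) * sin (\<eta> - t)\<close>.\<close>
  define \<phi> where "\<phi> t = g' t * sin (\<eta> - t) + g t * cos (\<eta> - t)" for t
  have "\<phi> 0 \<le> \<phi> \<eta>"
  proof (rule DERIV_nonneg_imp_nondecreasing[OF \<eta>(1)])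
    fix t assume t: "0 \<le> t" "t \<le> \<eta>"
    have "(\<phi> has_real_derivative (g2 t + g t) * sin (\<eta> - t)) (at t)"
      unfolding \<phi>_def[abs_def] by (auto intro!: derivative_eq_intros g simp: algebra_simps)
    moreover have "0 \<le> (g2 t + g t) * sin (\<eta> - t)"
      using t \<eta> pos by (intro mult_nonneg_nonneg sin_ge_zero) auto
    ultimately show "\<exists>y. (\<phi> has_real_derivative y) (at t) \<and> 0 \<le> y" by blast
  qed
  then show ?thesis using init by (simp add: \<phi>_def)
qed

lemma second_order_quotient:
  fixes g g' :: "real \<Rightarrow> real"
  assumes g: "\<And>t. (g has_real_derivative g' t) (at t)" "(g' has_real_derivative k) (at 0)"
    and init: "g 0 = 0" "g' 0 = 0"
  shows "((\<lambda>t. g t / t\<^sup>2) \<longlongrightarrow> k / 2) (at 0)"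
proof (rule lhopital[of g 0 "\<lambda>t. t\<^sup>2" "\<lambda>t. 2 * t" g'])
  show "(g \<longlongrightarrow> 0) (at 0)" using DERIV_isCont[OF g(1), of 0] init by (simp add: isCont_def)
  show "((\<lambda>t::real. t\<^sup>2) \<longlongrightarrow> 0) (at 0)" by (auto intro!: tendsto_eq_intros)
  show "\<forall>\<^sub>F t in at 0. (t::real)\<^sup>2 \<noteq> 0" "\<forall>\<^sub>F t in at 0. 2 * (t::real) \<noteq> 0"
    by (auto simp: eventually_at_filter)
  show "\<forall>\<^sub>F t in at 0. (g has_real_derivative g' t) (at t)" using g by simp
  show "\<forall>\<^sub>F t in at 0. ((\<lambda>t. t\<^sup>2) has_real_derivative 2 * t) (at t)"
    by (intro always_eventually allI) (auto intro!: derivative_eq_intros)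
  have "((\<lambda>t. g' t / t) \<longlongrightarrow> k) (at 0)" using g(2) init by (simp add: has_field_derivative_iff)
  then have "((\<lambda>t. g' t / t / 2) \<longlongrightarrow> k / 2) (at 0)" by (intro tendsto_intros) auto
  then show "((\<lambda>t. g' t / (2 * t)) \<longlongrightarrow> k / 2) (at 0)" by (simp add: mult.commute)
qed

section \<open>The moving frame of a smooth body and its gap function\<close>

locale smooth_body =
  fixes A :: "(real^2) set" and h' f :: "real \<Rightarrow> real" and c1 c2 :: real
  assumes A: "compact A" "convex A" "A \<noteq> {}"
    and f: "c1 > 0" "\<And>\<theta>. c1 \<le> f \<theta>" "\<And>\<theta>. f \<theta> \<le> c2" "continuous_on UNIV f"
    and dh: "\<And>\<theta>. (support_angle A has_real_derivative h' \<theta>) (at \<theta>)"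
    and dh': "\<And>\<theta>. (h' has_real_derivative f \<theta> - support_angle A \<theta>) (at \<theta>)"
begin

abbreviation "h \<equiv> support_angle A"

definition bpoint :: "real \<Rightarrow> real^2" where
  "bpoint \<theta> = h \<theta> *\<^sub>R unit_vec \<theta> + h' \<theta> *\<^sub>R unit_tangent \<theta>"

lemma normal_point_eq: "normal_point A \<theta> = bpoint \<theta>"
  unfolding normal_point_def bpoint_def by (rule grad_eq[OF support_fun_gderiv_unit_vec(1)[OF A(1,3) dh]])

lemma bpoint_in: "bpoint \<theta> \<in> A"
  unfolding bpoint_def by (rule support_fun_gderiv_unit_vec(2)[OF A(1,3) dh])

lemma curv_fun_eq: "curv_fun A \<theta> = f \<theta>"
proof -
  have "deriv h = h'" using dh by (auto intro: DERIV_imp_deriv)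
  then show ?thesis using DERIV_imp_deriv[OF dh'] unfolding curv_fun_def by simp
qed

lemma f_pos: "0 < f \<theta>" using f(1) f(2)[of \<theta>] by linarith

lemma bpoint_derivative: "(bpoint has_vector_derivative f \<theta> *\<^sub>R unit_tangent \<theta>) (at \<theta> within S)"
proof -
  have "(bpoint has_vector_derivative (h \<theta> *\<^sub>R unit_tangent \<theta> + h' \<theta> *\<^sub>R unit_vec \<theta>)
      + (h' \<theta> *\<^sub>R (- unit_vec \<theta>) + (f \<theta> - h \<theta>) *\<^sub>R unit_tangent \<theta>)) (at \<theta> within S)"
    unfolding bpoint_def[abs_def]
    by (intro has_vector_derivative_add has_vector_derivative_scaleR unit_vec_vector_derivative
        has_field_derivative_at_within[OF dh] has_field_derivative_at_within[OF dh'])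
  then show ?thesis by (simp add: algebra_simps)
qed

lemma bpoint_continuous [continuous_intros]:
  "continuous_on S g \<Longrightarrow> continuous_on S (\<lambda>x. bpoint (g x))"
  by (rule continuous_on_compose2[of UNIV bpoint])
    (auto simp: continuous_on_eq_continuous_within intro: has_vector_derivative_continuous[OF bpoint_derivative])

lemma bpoint_unit_vec: "bpoint \<theta> \<bullet> unit_vec (\<theta> + \<eta>) = h \<theta> * cos \<eta> + h' \<theta> * sin \<eta>"
  by (simp add: bpoint_def inner_add_left inner_unit_vec)

text \<open>How far the boundary point at \<theta> stays below the supporting line with normal angle
  \<open>\<theta> + \<eta>\<close>. In \<eta> it solves
  \<open>gap'' + gap = f (\<theta> + \<eta>)\<close> with vanishing initial data.\<close>

definition gap :: "real \<Rightarrow> real \<Rightarrow> real" where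
  "gap \<theta> \<eta> = h (\<theta> + \<eta>) - bpoint \<theta> \<bullet> unit_vec (\<theta> + \<eta>)"

definition gap' :: "real \<Rightarrow> real \<Rightarrow> real" where
  "gap' \<theta> \<eta> = h' (\<theta> + \<eta>) + h \<theta> * sin \<eta> - h' \<theta> * cos \<eta>"

lemma gap_derivative:
  "(gap \<theta> has_real_derivative gap' \<theta> \<eta>) (at \<eta>)"
  "(gap' \<theta> has_real_derivative f (\<theta> + \<eta>) - gap \<theta> \<eta>) (at \<eta>)"
proof -
  have 1: "((\<lambda>\<eta>. h (\<theta> + \<eta>)) has_real_derivative h' (\<theta> + \<eta>) * 1) (at \<eta>)"
    by (rule DERIV_chain2[OF dh]) (auto intro!: derivative_eq_intros)
  have 2: "((\<lambda>\<eta>. h' (\<theta> + \<eta>)) has_real_derivative (f (\<theta> + \<eta>) - h (\<theta> + \<eta>)) * 1) (at \<eta>)"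
    by (rule DERIV_chain2[OF dh']) (auto intro!: derivative_eq_intros)
  show "(gap \<theta> has_real_derivative gap' \<theta> \<eta>) (at \<eta>)"
    unfolding gap_def[abs_def] gap'_def bpoint_unit_vec by (auto intro!: derivative_eq_intros 1)
  show "(gap' \<theta> has_real_derivative f (\<theta> + \<eta>) - gap \<theta> \<eta>) (at \<eta>)"
  proof -
    have "(gap' \<theta> has_real_derivative (f (\<theta> + \<eta>) - h (\<theta> + \<eta>)) * 1 + h \<theta> * cos \<eta> + h' \<theta> * sin \<eta>) (at \<eta>)"
      unfolding gap'_def[abs_def] by (auto intro!: derivative_eq_intros 2)
    then show ?thesis unfolding gap_def bpoint_unit_vec by (simp add: algebra_simps)
  qed
qed

lemma gap_0: "gap \<theta> 0 = 0" "gap' \<theta> 0 = 0"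
  unfolding gap_def gap'_def bpoint_unit_vec by simp_all

text \<open>\<open>c1 * (1 - cos \<eta>)\<close> is the gap of a disc of radius \<open>c1\<close>
  and solves the same equation with right-hand side \<open>c1 \<le> f\<close>. Sturm comparison
  applies to the difference; negative angles follow by reflection.\<close>

lemma gap_ge: assumes "\<bar>\<eta>\<bar> \<le> pi" shows "c1 * (1 - cos \<eta>) \<le> gap \<theta> \<eta>"
proof -
  define g where "g t = gap \<theta> t - c1 * (1 - cos t)" for t
  define g' where "g' t = gap' \<theta> t - c1 * sin t" for t
  define g2 where "g2 t = f (\<theta> + t) - gap \<theta> t - c1 * cos t" for t
  have d: "(g has_real_derivative g' t) (at t)" "(g' has_real_derivative g2 t) (at t)" for t
    unfolding g_def[abs_def] g'_def[abs_def] g2_def by (auto intro!: derivative_eq_intros gap_derivative)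
  have pos: "0 \<le> g2 t + g t" for t using f(2)[of "\<theta> + t"] by (simp add: g2_def g_def algebra_simps)
  have init: "g 0 = 0" "g' 0 = 0" by (simp_all add: g_def g'_def gap_0)
  have "0 \<le> g \<eta>"
  proof (cases "0 \<le> \<eta>")
    case True
    then show ?thesis using oscillator_nonneg[OF d pos init, of \<eta>] assms by simp
  next
    case False
    have "0 \<le> g (- (- \<eta>))"
    proof (rule oscillator_nonneg[of "\<lambda>t. g (- t)" "\<lambda>t. - g' (- t)" "\<lambda>t. g2 (- t)"])
      show "((\<lambda>t. g (- t)) has_real_derivative - g' (- t)) (at t)" for t
        using DERIV_chain2[where f = g and g = uminus, OF d(1)[of "- t"] DERIV_minus[OF DERIV_ident]] by simp
      show "((\<lambda>t. - g' (- t)) has_real_derivative g2 (- t)) (at t)" for t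
        using DERIV_minus[OF DERIV_chain2[where f = g' and g = uminus, OF d(2)[of "- t"] DERIV_minus[OF DERIV_ident]]] by simp
    qed (use pos init False assms in auto)
    then show ?thesis by simp
  qed
  then show ?thesis by (simp add: g_def)
qed

lemma gap_nonneg: "0 \<le> gap \<theta> \<eta>"
  using support_fun_ge[OF A(1) bpoint_in, of "unit_vec (\<theta> + \<eta>)" \<theta>]
  by (simp add: gap_def support_angle_def inner_commute)

lemma gap_second_order: "((\<lambda>\<eta>. gap \<theta> \<eta> / \<eta>\<^sup>2) \<longlongrightarrow> f \<theta> / 2) (at 0)"
  by (rule second_order_quotient[OF gap_derivative(1)]) (use gap_derivative(2)[of \<theta> 0] gap_0 in auto)

text \<open>The constant \<open>c1 / 4\<close> is the disc comparison followed by
  \<open>1 - cos \<eta> \<ge> \<eta>\<^sup>2 / 4\<close>.\<close>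

lemma gap_reach: "reach_gap (gap \<theta>) (c1 / 4)"
proof
  show "0 < c1 / 4" using f(1) by simp
  show "gap \<theta> 0 = 0" by (rule gap_0)
  fix \<eta> :: real assume \<eta>: "\<bar>\<eta>\<bar> < pi / 2"
  have "c1 * (\<eta>\<^sup>2 / 4) \<le> c1 * (1 - cos \<eta>)" using one_minus_cos_ge[of \<eta>] \<eta> f(1) by (intro mult_left_mono) auto
  also have "\<dots> \<le> gap \<theta> \<eta>" using \<eta> by (intro gap_ge) auto
  finally show "c1 / 4 * \<eta>\<^sup>2 \<le> gap \<theta> \<eta>" by simp
qed

section \<open>Normal coordinates as a bijection onto the exterior of the body\<close>

definition nc :: "real \<Rightarrow> real \<Rightarrow> real^2" where
  "nc \<theta> r = bpoint \<theta> + r *\<^sub>R unit_vec \<theta>"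

lemma nc_unit_vec: "nc \<theta> r \<bullet> unit_vec (\<theta> + \<eta>) = h (\<theta> + \<eta>) - gap \<theta> \<eta> + r * cos \<eta>"
  by (simp add: nc_def gap_def inner_add_left inner_unit_vec)

lemma nc_continuous [continuous_intros]:
  "continuous_on S a \<Longrightarrow> continuous_on S b \<Longrightarrow> continuous_on S (\<lambda>x. nc (a x) (b x))"
  unfolding nc_def by (intro continuous_intros)

text \<open>Membership in \<open>K\<close> is one support inequality per direction, and the
  direction \<open>\<theta> + \<eta>\<close> contributes the constraint of \<open>reach\<close> at
  \<eta>. Directions with \<open>cos \<eta> \<le> 0\<close> hold automatically; the others are
  brought into the half circle modulo a full turn.\<close>

lemma mem_iff_le_reach:
  assumes K: "compact K" "convex K" "K \<noteq> {}" and H: "\<And>\<theta>. h \<theta> \<le> support_angle K \<theta>" and r: "0 \<le> r"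
  shows "nc \<theta> r \<in> K \<longleftrightarrow> r \<le> reach (gap \<theta>) (\<lambda>\<eta>. support_angle K (\<theta> + \<eta>) - h (\<theta> + \<eta>))"
proof -
  interpret reach_gap "gap \<theta>" "c1 / 4" by (rule gap_reach)
  let ?P = "\<lambda>\<eta>. r * cos \<eta> \<le> gap \<theta> \<eta> + (support_angle K (\<theta> + \<eta>) - h (\<theta> + \<eta>))"
  have P: "?P \<eta> \<longleftrightarrow> nc \<theta> r \<bullet> unit_vec (\<theta> + \<eta>) \<le> support_angle K (\<theta> + \<eta>)" for \<eta>
    unfolding nc_unit_vec by auto
  have "nc \<theta> r \<in> K \<longleftrightarrow> (\<forall>\<psi>. nc \<theta> r \<bullet> unit_vec \<psi> \<le> support_angle K \<psi>)" by (rule mem_iff_support_angle[OF K])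
  also have "\<dots> \<longleftrightarrow> (\<forall>\<eta>. ?P \<eta>)"
  proof
    assume "\<forall>\<psi>. nc \<theta> r \<bullet> unit_vec \<psi> \<le> support_angle K \<psi>" then show "\<forall>\<eta>. ?P \<eta>" unfolding P by blast
  next
    assume *: "\<forall>\<eta>. ?P \<eta>"
    show "\<forall>\<psi>. nc \<theta> r \<bullet> unit_vec \<psi> \<le> support_angle K \<psi>"
    proof
      fix \<psi> from *[rule_format, of "\<psi> - \<theta>"] show "nc \<theta> r \<bullet> unit_vec \<psi> \<le> support_angle K \<psi>" unfolding P by simp
    qed
  qed
  also have "\<dots> \<longleftrightarrow> (\<forall>\<eta>. \<bar>\<eta>\<bar> < pi/2 \<longrightarrow> ?P \<eta>)"
  proof
    assume *: "\<forall>\<eta>. \<bar>\<eta>\<bar> < pi/2 \<longrightarrow> ?P \<eta>"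
    show "\<forall>\<eta>. ?P \<eta>"
    proof
      fix \<eta>
      show "?P \<eta>"
      proof (cases "0 < cos \<eta>")
        case False
        then have "r * cos \<eta> \<le> 0" using r by (simp add: mult_nonneg_nonpos)
        then show ?thesis using gap_nonneg[of \<theta> \<eta>] H[of "\<theta> + \<eta>"] by linarith
      next
        case True
        \<comment> \<open>The representative of \<eta> modulo a full turn in the open half circle,
          available because \<open>cos \<eta> > 0\<close>.\<close>
        define \<eta>' where "\<eta>' = arcsin (sin \<eta>)"
        have "0 < (cos \<eta>)\<^sup>2" using True by simp
        then have "(sin \<eta>)\<^sup>2 < 1" using sin_cos_squared_add[of \<eta>] by linarith
        then have s: "- 1 < sin \<eta>" "sin \<eta> < 1" by (auto simp: abs_square_less_1 abs_less_iff)
        have \<eta>': "\<bar>\<eta>'\<bar> < pi/2" using arcsin_lt_bounded[OF s] by (auto simp: \<eta>'_def)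
        have sc: "sin \<eta>' = sin \<eta>" "cos \<eta>' = cos \<eta>"
        proof -
          show "sin \<eta>' = sin \<eta>" by (simp add: \<eta>'_def)
          have "cos \<eta>' = sqrt (1 - (sin \<eta>)\<^sup>2)" unfolding \<eta>'_def by (rule cos_arcsin) (auto)
          also have "1 - (sin \<eta>)\<^sup>2 = (cos \<eta>)\<^sup>2" using sin_cos_squared_add[of \<eta>] by linarith
          finally show "cos \<eta>' = cos \<eta>" using True by simp
        qed
        have u: "unit_vec (\<theta> + \<eta>') = unit_vec (\<theta> + \<eta>)"
          by (simp add: vec2_eq_iff cos_add sin_add sc)
        have "gap \<theta> \<eta>' = gap \<theta> \<eta>" by (simp add: gap_def u support_angle_def)
        then show ?thesis using *[rule_format, OF \<eta>'] u sc(2) by (simp add: support_angle_def)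
      qed
    qed
  qed blast
  also have "\<dots> \<longleftrightarrow> r \<le> reach (gap \<theta>) (\<lambda>\<eta>. support_angle K (\<theta> + \<eta>) - h (\<theta> + \<eta>))"
    by (rule le_reach_iff[symmetric]) (use H in simp)
  finally show ?thesis .
qed

lemma nc_notin: assumes "0 < r" shows "nc \<theta> r \<notin> A"
proof
  assume "nc \<theta> r \<in> A"
  from support_fun_ge[OF A(1) this, of "unit_vec \<theta>"] show False
    using nc_unit_vec[of \<theta> r 0] assms by (simp add: support_angle_def gap_0 inner_commute)
qed

text \<open>Reading the common point in direction \<theta> gives
  \<open>r = s * cos (\<theta> - \<psi>) - gap\<close>, so
  \<open>r \<le> s * cos (\<theta> - \<psi>)\<close>. By symmetry
  \<open>s \<le> r * cos (\<theta> - \<psi>)\<close>, which forces the cosine to be 1.\<close>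

lemma nc_inj:
  assumes eq: "nc \<theta> r = nc \<psi> s" and pos: "0 < r" "0 < s" and I: "0 \<le> \<theta>" "\<theta> < 2*pi" "0 \<le> \<psi>" "\<psi> < 2*pi"
  shows "\<theta> = \<psi>" "r = s"
proof -
  have *: "r \<le> s * cos (\<theta> - \<psi>)" if "nc \<theta> r = nc \<psi> s" for \<theta> \<psi> r s
    using nc_unit_vec[of \<theta> r 0] nc_unit_vec[of \<psi> s "\<theta> - \<psi>"] gap_nonneg[of \<psi> "\<theta> - \<psi>"] that by (simp add: gap_0)
  define d where "d = cos (\<theta> - \<psi>)"
  have 1: "r \<le> s * d" using *[OF eq] by (simp add: d_def)
  have 2: "s \<le> r * d" using *[OF eq[symmetric]] by (simp add: d_def) (metis cos_minus minus_diff_eq)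
  have "d \<le> 1" by (simp add: d_def)
  then have "s * d \<le> s" "r * d \<le> r" using pos by (simp_all add: mult_left_le)
  then have rs: "r = s" "r * d = r" using 1 2 by linarith+
  then have "cos (\<theta> - \<psi>) = 1" using pos unfolding d_def by simp
  then obtain n :: int where n: "\<theta> - \<psi> = of_int n * 2 * pi" by (auto simp: cos_one_2pi_int)
  have "\<bar>of_int n * 2 * pi\<bar> < 2 * pi" using n I by auto
  then have "\<bar>real_of_int n\<bar> < 1" by (simp add: abs_mult)
  then have "n = 0" by linarith
  then show "\<theta> = \<psi>" "r = s" using n rs by simp_all
qed

text \<open>The displacement from the nearest point of \<open>A\<close> is an outer normal there,
  and differentiability of \<open>h\<close> identifies that point with
  \<open>bpoint \<theta>\<close>.\<close>

lemma nc_surj: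
  assumes y: "y \<notin> A"
  obtains \<theta> r where "0 \<le> \<theta>" "\<theta> < 2*pi" "0 < r" "y = nc \<theta> r"
proof -
  define p where "p = closest_point A y"
  have cl: "closed A" using A(1) compact_imp_closed by blast
  have p: "p \<in> A" unfolding p_def by (rule closest_point_in_set[OF cl A(3)])
  have "y - p \<noteq> 0" using y p by auto
  then obtain \<theta> where \<theta>: "0 \<le> \<theta>" "\<theta> < 2*pi" "y - p = norm (y - p) *\<^sub>R unit_vec \<theta>" by (rule polar_decomposition)
  have max: "unit_vec \<theta> \<bullet> z \<le> unit_vec \<theta> \<bullet> p" if "z \<in> A" for z
  proof -
    have "(y - p) \<bullet> (z - p) \<le> 0" unfolding p_def by (rule closest_point_dot[OF A(2) cl that])
    then have "norm (y - p) * (unit_vec \<theta> \<bullet> (z - p)) \<le> 0" by (subst (asm) \<theta>(3)) simp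
    then show ?thesis using \<open>y - p \<noteq> 0\<close> by (simp add: mult_le_0_iff inner_diff_right)
  qed
  have "unit_vec \<theta> \<bullet> p = h \<theta>"
    unfolding support_angle_def
    by (rule antisym[OF support_fun_ge[OF A(1) p] support_fun_le[OF A(1,3) max]])
  then have "p = bpoint \<theta>" unfolding bpoint_def by (rule support_angle_maximiser[OF A(1) dh p])
  then have "y = nc \<theta> (norm (y - p))" using \<theta>(3) by (simp add: nc_def algebra_simps)
  moreover have "0 < norm (y - p)" using \<open>y - p \<noteq> 0\<close> by simp
  ultimately show thesis using that[OF \<theta>(1,2)] by blast
qed

definition ncv :: "real^2 \<Rightarrow> real^2" where "ncv p = nc (p $ 1) (p $ 2)"

definition nc_dom :: "(real^2) set" where "nc_dom = {p. 0 \<le> p $ 1 \<and> p $ 1 < 2*pi \<and> 0 < p $ 2}"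

lemma ncv_image: "ncv ` {p \<in> nc_dom. ncv p \<in> S} = S - A"
proof (intro equalityI subsetI)
  fix y assume y: "y \<in> S - A"
  then obtain \<theta> r where \<theta>: "0 \<le> \<theta>" "\<theta> < 2*pi" "0 < r" "y = nc \<theta> r" using nc_surj by blast
  have "y = ncv (vector [\<theta>, r])" using \<theta> by (simp add: ncv_def)
  moreover have "vector [\<theta>, r] \<in> nc_dom" using \<theta> by (simp add: nc_dom_def)
  ultimately show "y \<in> ncv ` {p \<in> nc_dom. ncv p \<in> S}" using y by blast
next
  fix y assume "y \<in> ncv ` {p \<in> nc_dom. ncv p \<in> S}"
  then obtain p where p: "y = ncv p" "p \<in> nc_dom" "ncv p \<in> S" by blast
  then have "0 < p $ 2" by (simp add: nc_dom_def)
  then show "y \<in> S - A" using nc_notin p by (simp add: ncv_def)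
qed

lemma ncv_inj: "inj_on ncv nc_dom"
proof (rule inj_onI)
  fix p q assume pq: "p \<in> nc_dom" "q \<in> nc_dom" "ncv p = ncv q"
  then have "p $ 1 = q $ 1" "p $ 2 = q $ 2"
    using nc_inj[of "p $ 1" "p $ 2" "q $ 1" "q $ 2"] unfolding nc_dom_def ncv_def by blast+
  then show "p = q" by (simp add: vec2_eq_iff)
qed

definition ncv' :: "real^2 \<Rightarrow> real^2 \<Rightarrow> real^2" where
  "ncv' p v = (v $ 1 * (f (p $ 1) + p $ 2)) *\<^sub>R unit_tangent (p $ 1) + v $ 2 *\<^sub>R unit_vec (p $ 1)"

lemma ncv_derivative: "(ncv has_derivative ncv' p) (at p within S)"
proof -
  have nth: "((\<lambda>p::real^2. p $ i) has_derivative (\<lambda>v. v $ i)) (at p within S)" for i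
    by (rule bounded_linear_imp_has_derivative[OF bounded_linear_vec_nth])
  have b: "((\<lambda>p. bpoint (p $ 1)) has_derivative (\<lambda>v. (v $ 1) *\<^sub>R (f (p $ 1) *\<^sub>R unit_tangent (p $ 1)))) (at p within S)"
    using has_derivative_compose[OF nth, of bpoint] bpoint_derivative[of "p $ 1" UNIV]
    unfolding has_vector_derivative_def by blast
  have u: "((\<lambda>p. unit_vec (p $ 1)) has_derivative (\<lambda>v. (v $ 1) *\<^sub>R unit_tangent (p $ 1))) (at p within S)"
    using has_derivative_compose[OF nth, of unit_vec] unit_vec_vector_derivative(1)[of "p $ 1" UNIV]
    unfolding has_vector_derivative_def by blast
  have "(ncv has_derivative (\<lambda>v. (v $ 1) *\<^sub>R (f (p $ 1) *\<^sub>R unit_tangent (p $ 1))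
     + (p $ 2 *\<^sub>R ((v $ 1) *\<^sub>R unit_tangent (p $ 1)) + v $ 2 *\<^sub>R unit_vec (p $ 1)))) (at p within S)"
    unfolding ncv_def[abs_def] nc_def by (intro has_derivative_add b has_derivative_scaleR nth u)
  moreover have "(\<lambda>v. (v $ 1) *\<^sub>R (f (p $ 1) *\<^sub>R unit_tangent (p $ 1))
     + (p $ 2 *\<^sub>R ((v $ 1) *\<^sub>R unit_tangent (p $ 1)) + v $ 2 *\<^sub>R unit_vec (p $ 1))) = ncv' p"
    by (simp add: fun_eq_iff ncv'_def algebra_simps)
  ultimately show ?thesis by simp
qed

lemma ncv_jacobian: assumes "0 \<le> p $ 2" shows "\<bar>det (matrix (ncv' p))\<bar> = f (p $ 1) + p $ 2"
proof -
  define F where "F = f (p $ 1) + p $ 2"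
  \<comment> \<open>The frame with the tangent first and the normal second is negatively oriented,
    hence the minus sign.\<close>
  have "det (matrix (ncv' p)) = - F * ((sin (p $ 1))\<^sup>2 + (cos (p $ 1))\<^sup>2)"
    by (simp add: det_2 matrix_def ncv'_def axis_def F_def[symmetric] power2_eq_square algebra_simps
        del: sin_cos_squared_add sin_cos_squared_add2 sin_cos_squared_add3)
  moreover have "0 < F" using f_pos[of "p $ 1"] assms by (simp add: F_def)
  ultimately show ?thesis by (simp add: F_def)
qed

end

section \<open>Integration in normal coordinates\<close>

text \<open>Identifies the product space, on which Fubini is applied, with \<open>real^2\<close>, on
  which the determinant form of the change of variables is applied.\<close>

definition vec2 :: "real \<times> real \<Rightarrow> real^2" where
  "vec2 z = vector [fst z, snd z]"

lemma vec2_nth [simp]: "vec2 z $ 1 = fst z" "vec2 z $ 2 = snd z"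
  by (simp_all add: vec2_def)

lemma vec2_measurable [measurable]: "vec2 \<in> borel_measurable (lborel \<Otimes>\<^sub>M lborel)"
proof -
  have eq: "vec2 = (\<lambda>z. fst z *\<^sub>R axis 1 1 + snd z *\<^sub>R axis 2 1)"
    by (auto simp: fun_eq_iff vec2_eq_iff axis_def)
  have "continuous_on UNIV vec2" unfolding eq by (intro continuous_intros)
  then have "vec2 \<in> borel_measurable borel" by (rule borel_measurable_continuous_onI)
  then show ?thesis by (simp add: lborel_prod)
qed

lemma lborel_vec2: "lborel = distr (lborel \<Otimes>\<^sub>M lborel) borel vec2"
proof (rule lborel_eqI)
  fix l u :: "real^2" assume lu: "\<And>b. b \<in> Basis \<Longrightarrow> l \<bullet> b \<le> u \<bullet> b"
  have Basis: "(Basis :: (real^2) set) = {axis 1 1, axis 2 1}"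
    by (simp add: Basis_vec_def UNIV_2 Un_commute insert_commute)
  have ne: "axis 1 1 \<noteq> (axis 2 1 :: real^2)" by (simp add: axis_eq_axis)
  have i: "x \<bullet> axis i 1 = x $ i" for x :: "real^2" and i by (simp add: cart_eq_inner_axis)
  have le: "l $ 1 \<le> u $ 1" "l $ 2 \<le> u $ 2" using lu[of "axis 1 1"] lu[of "axis 2 1"] Basis i by auto
  have "vec2 -` box l u \<inter> space (lborel \<Otimes>\<^sub>M lborel) = {l $ 1 <..< u $ 1} \<times> {l $ 2 <..< u $ 2}"
    by (auto simp: box_def Basis i space_pair_measure)
  then have "emeasure (distr (lborel \<Otimes>\<^sub>M lborel) borel vec2) (box l u)
      = emeasure (lborel \<Otimes>\<^sub>M lborel) ({l $ 1 <..< u $ 1} \<times> {l $ 2 <..< u $ 2})"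
    by (simp add: emeasure_distr)
  also have "\<dots> = ennreal (u $ 1 - l $ 1) * ennreal (u $ 2 - l $ 2)"
    using le by (subst lborel.emeasure_pair_measure_Times) auto
  also have "\<dots> = (\<Prod>b\<in>Basis. (u - l) \<bullet> b)"
    using le ne unfolding Basis by (simp add: i ennreal_mult)
  finally show "emeasure (distr (lborel \<Otimes>\<^sub>M lborel) borel vec2) (box l u) = (\<Prod>b\<in>Basis. (u - l) \<bullet> b)" .
qed simp

lemma change_of_variables_real:
  fixes w :: "real^'m::{finite,wellorder} \<Rightarrow> real" and g :: "real^'m::_ \<Rightarrow> real^'m::_"
  assumes S: "S \<in> sets lebesgue" and der: "\<And>x. x \<in> S \<Longrightarrow> (g has_derivative g' x) (at x within S)"
    and inj: "inj_on g S" and w: "w absolutely_integrable_on (g ` S)"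
  shows "(\<lambda>x. \<bar>det (matrix (g' x))\<bar> * w (g x)) absolutely_integrable_on S"
    "integral S (\<lambda>x. \<bar>det (matrix (g' x))\<bar> * w (g x)) = integral (g ` S) w"
proof -
  \<comment> \<open>The change of variables is stated for vector-valued integrands; a scalar one is
    passed through \<open>real^1\<close>.\<close>
  have "(\<lambda>x. \<bar>det (matrix (g' x))\<bar> *\<^sub>R vec (w (g x)) :: real^1) absolutely_integrable_on S \<and>
      integral S (\<lambda>x. \<bar>det (matrix (g' x))\<bar> *\<^sub>R vec (w (g x))) = (vec (integral (g ` S) w) :: real^1)
    \<longleftrightarrow> (\<lambda>x. vec (w x) :: real^1) absolutely_integrable_on (g ` S) \<and>
      integral (g ` S) (\<lambda>x. vec (w x)) = (vec (integral (g ` S) w) :: real^1)"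
    by (rule has_absolute_integral_change_of_variables[OF S der inj])
  then have "(\<lambda>x. \<bar>det (matrix (g' x))\<bar> * w (g x)) absolutely_integrable_on S \<and>
      integral S (\<lambda>x. \<bar>det (matrix (g' x))\<bar> * w (g x)) = integral (g ` S) w"
    using w by (simp add: absolutely_integrable_on_1_iff integral_on_1_eq)
  then show "(\<lambda>x. \<bar>det (matrix (g' x))\<bar> * w (g x)) absolutely_integrable_on S"
    "integral S (\<lambda>x. \<bar>det (matrix (g' x))\<bar> * w (g x)) = integral (g ` S) w" by blast+
qed

context smooth_body
begin

lemma ncv_continuous: "continuous_on S ncv"
  unfolding ncv_def[abs_def] by (intro continuous_intros)

lemma f_measurable [measurable]: "f \<in> borel_measurable borel"
  using f(4) by (rule borel_measurable_continuous_onI)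

lemma nc_dom_measurable [measurable]: "nc_dom \<in> sets borel"
proof -
  have "nc_dom = {p. 0 \<le> p $ 1} \<inter> {p. p $ 1 < 2*pi} \<inter> {p. 0 < p $ 2}" by (auto simp: nc_dom_def)
  moreover have "closed {p::real^2. 0 \<le> p $ 1}" "open {p::real^2. p $ 1 < 2*pi}" "open {p::real^2. 0 < p $ 2}"
    by (intro closed_Collect_le open_Collect_less continuous_intros)+
  ultimately show ?thesis by (metis borel_closed borel_open sets.Int)
qed

text \<open>Normal coordinates carry the region \<open>P\<close> below the height bijectively onto
  \<open>K - A\<close>. Change of variables and Fubini then leave, for each \<theta>, the integral
  along one normal ray.\<close>

lemma integral_normal_coordinates:
  fixes w :: "real^2 \<Rightarrow> real" and \<rho> :: "real \<Rightarrow> real"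
  assumes w: "w \<in> borel_measurable borel" and int: "set_integrable lborel K w"
    and K: "K \<in> sets borel" "A \<subseteq> K" and \<rho>: "\<And>\<theta> r. 0 < r \<Longrightarrow> nc \<theta> r \<in> K \<longleftrightarrow> r \<le> \<rho> \<theta>"
  defines "\<Phi> \<equiv> \<lambda>\<theta>. LINT r:{0<..\<rho> \<theta>}|lborel. w (nc \<theta> r) * (f \<theta> + r)"
  shows "integrable (lebesgue_on {0..2*pi}) \<Phi>"
    "(LINT x:K|lborel. w x) = (LINT x:A|lborel. w x) + integral\<^sup>L (lebesgue_on {0..2*pi}) \<Phi>"
proof -
  note [measurable] = w K(1)
  define P where "P = {p \<in> nc_dom. ncv p \<in> K}"
  have ncv_m [measurable]: "ncv \<in> borel_measurable borel" by (rule borel_measurable_continuous_onI[OF ncv_continuous])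
  have P [measurable]: "P \<in> sets borel"
  proof -
    have "P = nc_dom \<inter> (ncv -` K \<inter> space borel)" by (auto simp: P_def)
    moreover have "ncv -` K \<inter> space borel \<in> sets borel" by (rule measurable_sets[OF ncv_m K(1)])
    ultimately show ?thesis by simp
  qed
  have A_m [measurable]: "A \<in> sets borel" using A(1) by (simp add: borel_compact)
  have KA: "set_integrable lborel (K - A) w" "set_integrable lborel A w"
    by (rule set_integrable_subset[OF int]; use K A_m in auto)+
  have image: "ncv ` P = K - A" unfolding P_def by (rule ncv_image)
  define J where "J p = (f (p $ 1) + p $ 2) * w (ncv p)" for p
  have J_m [measurable]: "J \<in> borel_measurable borel" unfolding J_def[abs_def] by measurable
  have wabs: "w absolutely_integrable_on (K - A)"
  proof -
    have "integrable lborel (\<lambda>x. indicator (K - A) x *\<^sub>R w x)" using KA(1) by (simp add: set_integrable_def)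
    then show ?thesis unfolding set_integrable_def by (subst integrable_completion) auto
  qed
  have jac: "\<bar>det (matrix (ncv' p))\<bar> * w (ncv p) = J p" if "p \<in> P" for p
    using that by (simp add: J_def P_def nc_dom_def ncv_jacobian)
  have wabs': "w absolutely_integrable_on (ncv ` P)" using wabs image by simp
  have inj: "inj_on ncv P" by (rule inj_on_subset[OF ncv_inj]) (auto simp: P_def)
  have Pl: "P \<in> sets lebesgue" using P by simp
  note cov = change_of_variables_real[OF Pl ncv_derivative inj wabs']
  have Jabs: "J absolutely_integrable_on P"
  proof -
    have "(\<lambda>x. \<bar>det (matrix (ncv' x))\<bar> * w (ncv x)) absolutely_integrable_on P \<longleftrightarrow> J absolutely_integrable_on P"
      by (rule set_integrable_cong) (simp_all add: jac)
    then show ?thesis using cov(1) by blast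
  qed
  have Jint: "integral P J = integral (K - A) w"
    using cov(2) image jac by (metis (no_types, lifting) Henstock_Kurzweil_Integration.integral_cong)
  have 1: "(LINT x:K - A|lborel. w x) = integral (K - A) w"
  proof -
    have "(LINT x:K - A|lborel. w x) = (LINT x:K - A|lebesgue. w x)"
      unfolding set_lebesgue_integral_def by (rule integral_completion[symmetric]) measurable
    then show ?thesis using set_lebesgue_integral_eq_integral(2)[OF wabs] by simp
  qed
  have Ji: "integrable lborel (\<lambda>p. indicator P p * J p)"
    using Jabs unfolding set_integrable_def by (subst (asm) integrable_completion) auto
  have 2: "(LINT p|lborel. indicator P p * J p) = integral P J"
  proof -
    have "(LINT p|lborel. indicator P p * J p) = (LINT p:P|lebesgue. J p)"
      unfolding set_lebesgue_integral_def real_scaleR_def by (rule integral_completion[symmetric]) measurable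
    then show ?thesis using set_lebesgue_integral_eq_integral(2)[OF Jabs] by simp
  qed
  have Zi: "integrable (lborel \<Otimes>\<^sub>M lborel) (\<lambda>z. indicator P (vec2 z) * J (vec2 z))"
    using Ji by (subst (asm) lborel_vec2) (simp add: integrable_distr_eq)
  have 3: "(LINT p|lborel. indicator P p * J p) = (LINT z|(lborel \<Otimes>\<^sub>M lborel). indicator P (vec2 z) * J (vec2 z))"
    by (subst (1) lborel_vec2) (simp add: integral_distr)
  \<comment> \<open>The sections of \<open>P\<close> are intervals
    \<open>{0<..\<rho> \<theta>}\<close> over the half-open period on which the coordinates are
    injective.\<close>
  have split: "indicator P (vec2 (\<theta>, r)) * J (vec2 (\<theta>, r)) =
      indicator {0..<2*pi} \<theta> * (indicator {0<..\<rho> \<theta>} r *\<^sub>R (w (nc \<theta> r) * (f \<theta> + r)))" for \<theta> r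
    using \<rho>[of r \<theta>] by (auto simp: P_def nc_dom_def J_def ncv_def split: split_indicator)
  have inner: "(LINT r|lborel. indicator P (vec2 (\<theta>, r)) * J (vec2 (\<theta>, r))) = indicator {0..<2*pi} \<theta> * \<Phi> \<theta>" for \<theta>
    unfolding split \<Phi>_def set_lebesgue_integral_def by (rule integral_mult_right_zero)
  have fubini: "(LINT \<theta>|lborel. indicator {0..<2*pi} \<theta> * \<Phi> \<theta>) = (LINT z|(lborel \<Otimes>\<^sub>M lborel). indicator P (vec2 z) * J (vec2 z))"
    using lborel_pair.integral_fst'[OF Zi] unfolding inner .
  have \<Phi>i: "integrable lborel (\<lambda>\<theta>. indicator {0..<2*pi} \<theta> * \<Phi> \<theta>)"
    using lborel_pair.integrable_fst'[OF Zi] unfolding inner .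
  have \<Phi>il: "integrable lebesgue (\<lambda>\<theta>. indicator {0..<2*pi} \<theta> * \<Phi> \<theta>)"
    by (subst integrable_completion) (use \<Phi>i in auto)
  have ae: "AE \<theta> in lebesgue. indicator {0..<2*pi} \<theta> * \<Phi> \<theta> = indicator {0..2*pi} \<theta> *\<^sub>R \<Phi> \<theta>"
  proof -
    have "AE \<theta> in lebesgue. \<theta> \<noteq> 2*pi" by (rule AE_completion[OF AE_lborel_singleton])
    then show ?thesis by eventually_elim (auto split: split_indicator)
  qed
  \<comment> \<open>Passing to the closed interval changes the integrand only at
    \<open>2 * pi\<close>; this exhibits the change as a measurable correction.\<close>
  have m: "(\<lambda>\<theta>. indicator {0..2*pi} \<theta> *\<^sub>R \<Phi> \<theta>) \<in> borel_measurable lebesgue"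
  proof -
    have "(\<lambda>\<theta>. indicator {0..2*pi} \<theta> *\<^sub>R \<Phi> \<theta>) = (\<lambda>\<theta>. indicator {0..<2*pi} \<theta> * \<Phi> \<theta> + indicator {2*pi} \<theta> * \<Phi> (2*pi))"
      by (auto simp: fun_eq_iff split: split_indicator)
    moreover have "\<dots> \<in> borel_measurable lebesgue"
      by (intro borel_measurable_add borel_measurable_integrable[OF \<Phi>il] borel_measurable_times
          borel_measurable_indicator borel_measurable_const) auto
    ultimately show ?thesis by simp
  qed
  have I2: "integrable lebesgue (\<lambda>\<theta>. indicator {0..2*pi} \<theta> *\<^sub>R \<Phi> \<theta>)"
    using integrable_cong_AE[OF borel_measurable_integrable[OF \<Phi>il] m ae] \<Phi>il by blast
  then show "integrable (lebesgue_on {0..2*pi}) \<Phi>" by (subst integrable_restrict_space) auto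
  have 4: "integral\<^sup>L (lebesgue_on {0..2*pi}) \<Phi> = (LINT \<theta>|lborel. indicator {0..<2*pi} \<theta> * \<Phi> \<theta>)"
  proof -
    have "integral\<^sup>L (lebesgue_on {0..2*pi}) \<Phi> = (LINT \<theta>|lebesgue. indicator {0..2*pi} \<theta> *\<^sub>R \<Phi> \<theta>)"
      by (subst integral_restrict_space) auto
    also have "\<dots> = (LINT \<theta>|lebesgue. indicator {0..<2*pi} \<theta> * \<Phi> \<theta>)"
      by (rule integral_cong_AE[OF m borel_measurable_integrable[OF \<Phi>il]]) (use ae in eventually_elim, erule sym)
    also have "\<dots> = (LINT \<theta>|lborel. indicator {0..<2*pi} \<theta> * \<Phi> \<theta>)"
      by (rule integral_completion[OF borel_measurable_integrable[OF \<Phi>i]])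
    finally show ?thesis .
  qed
  have "(LINT x:K|lborel. w x) = (LINT x:A \<union> (K - A)|lborel. w x)" using K(2) by (simp add: Un_absorb1)
  also have "\<dots> = (LINT x:A|lborel. w x) + (LINT x:K - A|lborel. w x)"
    by (rule set_integral_Un) (use KA in auto)
  also have "(LINT x:K - A|lborel. w x) = integral\<^sup>L (lebesgue_on {0..2*pi}) \<Phi>"
    using 1 2 3 4 Jint fubini by simp
  finally show "(LINT x:K|lborel. w x) = (LINT x:A|lborel. w x) + integral\<^sup>L (lebesgue_on {0..2*pi}) \<Phi>" .
qed

end

section \<open>The mixed right derivative\<close>

lemma filterlim_inverse_Suc: "filterlim (\<lambda>n. inverse (real (Suc n))) (at_right 0) sequentially"
  using LIMSEQ_inverse_real_of_nat by (auto simp: filterlim_at)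

lemma dominated_convergence_at_right:
  fixes s :: "real \<Rightarrow> 'a \<Rightarrow> real"
  assumes d: "0 < d" and meas: "\<And>t. 0 < t \<Longrightarrow> t < d \<Longrightarrow> s t \<in> borel_measurable M" "f \<in> borel_measurable M"
    and lim: "AE x in M. ((\<lambda>t. s t x) \<longlongrightarrow> f x) (at_right 0)"
    and bound: "\<And>t. 0 < t \<Longrightarrow> t < d \<Longrightarrow> AE x in M. \<bar>s t x\<bar> \<le> w x" and w: "integrable M w"
  shows "integrable M f" "((\<lambda>t. integral\<^sup>L M (s t)) \<longlongrightarrow> integral\<^sup>L M f) (at_right 0)"
proof -
  have *: "integrable M f" "(\<lambda>n. integral\<^sup>L M (s (S n))) \<longlonglongrightarrow> integral\<^sup>L M f"
    if S: "\<And>n. 0 < S n" "\<And>n. S n < d" "S \<longlonglongrightarrow> 0" for S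
  proof -
    have fl: "filterlim S (at_right 0) sequentially"
      using S less_imp_neq[OF S(1)] by (auto simp: filterlim_at)
    have l: "AE x in M. (\<lambda>n. s (S n) x) \<longlonglongrightarrow> f x"
      using lim by eventually_elim (rule filterlim_compose[OF _ fl])
    show "integrable M f"
      by (rule integrable_dominated_convergence[OF meas(2) meas(1)[OF S(1,2)] w l]) (use bound S in auto)
    show "(\<lambda>n. integral\<^sup>L M (s (S n))) \<longlonglongrightarrow> integral\<^sup>L M f"
      by (rule integral_dominated_convergence[OF meas(2) meas(1)[OF S(1,2)] w l]) (use bound S in auto)
  qed
  show "((\<lambda>t. integral\<^sup>L M (s t)) \<longlongrightarrow> integral\<^sup>L M f) (at_right 0)"
    by (rule tendsto_at_right_sequentially[OF d]) (rule *(2))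
  \<comment> \<open>One sequence inside \<open>(0, d)\<close> tending to 0 suffices for the
    integrability of the limit.\<close>
  have "(\<lambda>n. d / 2 * inverse (real (Suc n))) \<longlonglongrightarrow> d / 2 * 0"
    by (intro tendsto_intros LIMSEQ_inverse_real_of_nat)
  moreover have "d / 2 * inverse (real (Suc n)) < d" for n
  proof -
    have "d / 2 * inverse (real (Suc n)) \<le> d / 2 * 1"
      using d by (intro mult_left_mono) (auto simp: inverse_le_1_iff)
    then show ?thesis using d by linarith
  qed
  ultimately show "integrable M f" using d by (intro *(1)[of "\<lambda>n. d / 2 * inverse (real (Suc n))"]) auto
qed

text \<open>The limit function may be arbitrary on the exceptional null set, as the representatives
  of the derivatives of \<open>hB\<close> and \<open>hC\<close> are. Completeness of Lebesgue
  measure makes it measurable all the same.\<close>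

lemma lebesgue_on_AE_limit_measurable:
  fixes f :: "'a::euclidean_space \<Rightarrow> real"
  assumes S: "S \<in> sets lebesgue" and u: "\<And>n. u n \<in> borel_measurable (lebesgue_on S)"
    and lim: "AE x in lebesgue_on S. (\<lambda>n. u n x) \<longlonglongrightarrow> f x"
  shows "f \<in> borel_measurable (lebesgue_on S)"
proof -
  define v where "v x = lim (\<lambda>n. u n x)" for x
  have v: "v \<in> borel_measurable (lebesgue_on S)" unfolding v_def using u by (rule borel_measurable_lim_metric)
  have ae: "AE x in lebesgue. x \<in> S \<longrightarrow> f x = v x"
    using lim S by (simp add: AE_restrict_space_iff) (auto elim!: eventually_mono simp: v_def limI)
  define E where "E = {x \<in> space lebesgue. \<not> (x \<in> S \<longrightarrow> f x = v x)}"
  have E: "E \<in> null_sets lebesgue" using completion.AE_iff_null_sets[THEN iffD1, OF ae] unfolding E_def .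
  show ?thesis
  proof (rule measurableI)
    fix T :: "real set" assume T: "T \<in> sets borel"
    have 1: "v -` T \<inter> S \<in> sets lebesgue"
      using measurable_sets[OF v T] S by (simp add: sets_restrict_space_iff space_restrict_space)
    have "f -` T \<inter> S \<inter> E \<in> null_sets lebesgue" by (rule completion.complete2[OF _ E]) auto
    then have "f -` T \<inter> S \<inter> E \<in> sets lebesgue" by blast
    moreover have "f -` T \<inter> S = (v -` T \<inter> S - E) \<union> (f -` T \<inter> S \<inter> E)" by (auto simp: E_def)
    moreover have "E \<in> sets lebesgue" using E by blast
    ultimately have "f -` T \<inter> S \<in> sets lebesgue" using 1 by (metis sets.Diff sets.Un)
    then show "f -` T \<inter> space (lebesgue_on S) \<in> sets (lebesgue_on S)"
      using S by (simp add: sets_restrict_space_iff space_restrict_space)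
  qed auto
qed

text \<open>A one-sided derivative of \<open>F\<close> suffices because \<open>g\<close> stays in
  \<open>{0..}\<close>. It is used with \<open>g\<close> a height, which starts at the endpoint 0
  when \<open>s = t = 0\<close>.\<close>

lemma DERIV_at_right_chain:
  fixes F g :: "real \<Rightarrow> real"
  assumes g: "(g has_real_derivative p) (at_right 0)" and nonneg: "\<And>t. 0 < t \<Longrightarrow> 0 \<le> g t"
    and F: "(F has_real_derivative D) (at (g 0) within {0..})"
  shows "((\<lambda>t. F (g t)) has_real_derivative D * p) (at_right 0)"
proof -
  have "(F has_real_derivative D) (at (g 0) within g ` {0<..})"
    by (rule DERIV_subset[OF F]) (use nonneg in auto)
  from DERIV_image_chain[OF this g] show ?thesis by (simp add: comp_def)
qed

section \<open>The two limits for a density with a Lipschitz bound and a one-sided derivative along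
  normals\<close>

locale mixed_density = smooth_body +
  fixes B C :: "(real^2) set" and w :: "real^2 \<Rightarrow> real" and w1 :: "real \<Rightarrow> real" and W l \<kappa> M :: real
  assumes origin: "0 \<in> interior A"
    and B: "compact B" "convex B" "B \<noteq> {}" and C: "compact C" "convex C" "C \<noteq> {}"
    and w: "w \<in> borel_measurable borel" "\<And>x. 0 \<le> w x" "\<And>x. w x \<le> 1" "continuous_on (- {0}) w"
    and w_lip: "\<And>\<theta> r. 0 \<le> r \<Longrightarrow> r \<le> 1 \<Longrightarrow> \<bar>w (nc \<theta> r) - w (nc \<theta> 0)\<bar> \<le> W * r"
    and w_der: "\<And>\<theta>. ((\<lambda>r. w (nc \<theta> r)) has_real_derivative w1 \<theta>) (at_right 0)"
    and hB: "\<And>\<theta>. 0 \<le> support_angle B \<theta>" "\<And>\<theta>. support_angle B \<theta> \<le> M"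
    and hC: "\<And>\<theta>. 0 \<le> support_angle C \<theta>" "\<And>\<theta>. support_angle C \<theta> \<le> M"
    and lip: "\<And>\<theta> \<psi>. \<bar>support_angle B \<theta> - support_angle B \<psi>\<bar> \<le> l * \<bar>\<theta> - \<psi>\<bar>"
      "\<And>\<theta> \<psi>. \<bar>support_angle C \<theta> - support_angle C \<psi>\<bar> \<le> l * \<bar>\<theta> - \<psi>\<bar>"
    and \<kappa>: "0 < \<kappa>" "\<kappa> \<le> 1" "\<And>\<theta>. \<kappa> * support_angle C \<theta> \<le> support_angle B \<theta>"
begin

abbreviation "hB \<equiv> support_angle B"
abbreviation "hC \<equiv> support_angle C"

definition \<rho> :: "real \<Rightarrow> real \<Rightarrow> real \<Rightarrow> real" where
  "\<rho> \<theta> s t = reach (gap \<theta>) (\<lambda>\<eta>. s * hB (\<theta> + \<eta>) + t * hC (\<theta> + \<eta>))"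

definition \<sigma> :: "real \<Rightarrow> real \<Rightarrow> real" where
  "\<sigma> \<theta> s = reach_pair.slope (gap \<theta>) (\<lambda>\<eta>. hB (\<theta> + \<eta>)) (\<lambda>\<eta>. hC (\<theta> + \<eta>)) s"

lemma reach_pair_at: "reach_pair (gap \<theta>) (c1 / 4) (\<lambda>\<eta>. hB (\<theta> + \<eta>)) (\<lambda>\<eta>. hC (\<theta> + \<eta>)) l \<kappa>"
proof (intro reach_pair.intro gap_reach reach_pair_axioms.intro)
  show "\<bar>hB (\<theta> + \<eta>) - hB (\<theta> + 0)\<bar> \<le> l * \<bar>\<eta>\<bar>" "\<bar>hC (\<theta> + \<eta>) - hC (\<theta> + 0)\<bar> \<le> l * \<bar>\<eta>\<bar>" for \<eta>
    using lip[of "\<theta> + \<eta>" \<theta>] by simp_all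
qed (use hB hC \<kappa> in auto)

lemma \<rho>_eq: "\<rho> \<theta> s t = reach_pair.R (gap \<theta>) (\<lambda>\<eta>. hB (\<theta> + \<eta>)) (\<lambda>\<eta>. hC (\<theta> + \<eta>)) s t"
  unfolding \<rho>_def reach_pair.R_def[OF reach_pair_at] ..

lemma \<rho>_bounds:
  assumes "0 \<le> s" "0 \<le> t"
  shows "0 \<le> \<rho> \<theta> s t" "\<rho> \<theta> s t \<le> s * hB \<theta> + t * hC \<theta>"
    "s * hB \<theta> + t * hC \<theta> - (l * (s + t))\<^sup>2 / c1 \<le> \<rho> \<theta> s t"
proof -
  have t: "- \<kappa> * s \<le> t" 
  proof -
    have "0 \<le> \<kappa> * s" using assms \<kappa>(1) by simp
    then show ?thesis using assms(2) by simp
  qed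
  show "0 \<le> \<rho> \<theta> s t" "\<rho> \<theta> s t \<le> s * hB \<theta> + t * hC \<theta>"
    "s * hB \<theta> + t * hC \<theta> - (l * (s + t))\<^sup>2 / c1 \<le> \<rho> \<theta> s t"
    using reach_pair.R_nonneg[OF reach_pair_at assms(1) t] reach_pair.R_le[OF reach_pair_at assms(1) t] reach_pair.R_ge[OF reach_pair_at assms(1) t] assms
    unfolding \<rho>_eq by simp_all
qed

lemma \<rho>_mono: "0 \<le> s \<Longrightarrow> 0 \<le> t \<Longrightarrow> t \<le> t' \<Longrightarrow> \<rho> \<theta> s t \<le> \<rho> \<theta> s t'"
  unfolding \<rho>_eq by (rule reach_pair.R_mono[OF reach_pair_at])

lemma \<rho>_0: "\<rho> \<theta> 0 0 = 0" unfolding \<rho>_eq by (rule reach_pair.R_00[OF reach_pair_at])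

lemma \<rho>_derivative: "0 \<le> s \<Longrightarrow> (\<rho> \<theta> s has_real_derivative \<sigma> \<theta> s) (at_right 0)"
  unfolding \<sigma>_def \<rho>_eq[abs_def] by (rule reach_pair.slope_derivative[OF reach_pair_at])

lemma \<rho>_slope: "0 \<le> s \<Longrightarrow> 0 < t \<Longrightarrow> (\<rho> \<theta> s t - \<rho> \<theta> s 0) / t \<le> \<sigma> \<theta> s"
  unfolding \<sigma>_def \<rho>_eq by (rule reach_pair.slope_bounds(1)[OF reach_pair_at])

text \<open>The constant of \<open>slope_upper\<close> for the gap constant \<open>c1 / 4\<close>.
  Since \<open>\<kappa> \<le> 1\<close>, it also dominates the one of
  \<open>slope_lower\<close>.\<close>

definition K\<^sub>1 :: real where "K\<^sub>1 = (2 * l)\<^sup>2 / (c1 * \<kappa>)"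

lemma K1_nonneg: "0 \<le> K\<^sub>1" unfolding K\<^sub>1_def using f(1) \<kappa>(1) by simp

lemma \<sigma>_bound: assumes "0 \<le> s" shows "\<bar>\<sigma> \<theta> s - hC \<theta>\<bar> \<le> K\<^sub>1 * s"
proof -
  have "hC \<theta> - (2 * l)\<^sup>2 / c1 * s \<le> \<sigma> \<theta> s"
    using reach_pair.slope_lower[OF reach_pair_at assms, of \<theta>] unfolding \<sigma>_def by simp
  moreover have "\<sigma> \<theta> s \<le> hC \<theta> + K\<^sub>1 * s"
    using reach_pair.slope_upper[OF reach_pair_at assms, of \<theta>] unfolding \<sigma>_def K\<^sub>1_def by simp
  moreover have "(2 * l)\<^sup>2 / c1 * s \<le> K\<^sub>1 * s"
    unfolding K\<^sub>1_def using assms f(1) \<kappa> by (intro mult_right_mono divide_left_mono) (auto simp: mult_le_cancel_left1)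
  ultimately show ?thesis by linarith
qed

lemma \<sigma>_0: "\<sigma> \<theta> 0 = hC \<theta>" using \<sigma>_bound[of 0 \<theta>] by simp

lemma \<sigma>_derivative:
  assumes "(hB has_real_derivative b) (at \<theta>)" "(hC has_real_derivative d) (at \<theta>)"
  shows "(\<sigma> \<theta> has_real_derivative - b * d / f \<theta>) (at_right 0)"
proof -
  have sh: "((\<lambda>\<eta>. g (\<theta> + \<eta>)) has_real_derivative a) (at 0)" if "(g has_real_derivative a) (at \<theta>)" for g a
  proof -
    have "(g has_real_derivative a) (at (\<theta> + 0))" using that by simp
    moreover have "((\<lambda>\<eta>. \<theta> + \<eta>) has_real_derivative 1) (at 0)" by (auto intro!: derivative_eq_intros)
    ultimately show ?thesis using DERIV_chain2[where f = g and g = "\<lambda>\<eta>. \<theta> + \<eta>"] by force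
  qed
  have "((\<lambda>s. (\<sigma> \<theta> s - hC \<theta>) / s) \<longlongrightarrow> - b * d / f \<theta>) (at_right 0)"
    using reach_pair.slope_first_order[OF reach_pair_at f_pos gap_second_order sh[OF assms(1)] sh[OF assms(2)]]
    unfolding \<sigma>_def by simp
  then show ?thesis by (simp add: has_field_derivative_iff \<sigma>_0)
qed

text \<open>The loss below \<open>s * hB \<theta>\<close> is quadratic in \<open>s\<close>, so it
  vanishes to first order at every \<theta>, whether or not \<open>hB\<close> is differentiable
  there.\<close>

lemma \<rho>_derivative_0: "((\<lambda>s. \<rho> \<theta> s 0) has_real_derivative hB \<theta>) (at_right 0)"
proof -
  have "((\<lambda>s. \<rho> \<theta> s 0 / s) \<longlongrightarrow> hB \<theta>) (at_right 0)"
  proof (rule tendsto_sandwich[where f = "\<lambda>s. hB \<theta> - l\<^sup>2 / c1 * s" and h = "\<lambda>s. hB \<theta>"])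
    show "((\<lambda>s. hB \<theta>) \<longlongrightarrow> hB \<theta>) (at_right 0)" by simp
    have "((\<lambda>s. hB \<theta> - l\<^sup>2 / c1 * s) \<longlongrightarrow> hB \<theta> - l\<^sup>2 / c1 * 0) (at_right 0)" by (intro tendsto_intros)
    then show "((\<lambda>s. hB \<theta> - l\<^sup>2 / c1 * s) \<longlongrightarrow> hB \<theta>) (at_right 0)" by simp
    have "hB \<theta> - l\<^sup>2 / c1 * s \<le> \<rho> \<theta> s 0 / s" "\<rho> \<theta> s 0 / s \<le> hB \<theta>" if s: "0 < s" for s
    proof -
      show "\<rho> \<theta> s 0 / s \<le> hB \<theta>" using \<rho>_bounds(2)[of s 0 \<theta>] s by (simp add: pos_divide_le_eq mult.commute)
      have "(s * hB \<theta> - (l * s)\<^sup>2 / c1) / s \<le> \<rho> \<theta> s 0 / s"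
        using \<rho>_bounds(3)[of s 0 \<theta>] s by (intro divide_right_mono) auto
      moreover have "(s * hB \<theta> - (l * s)\<^sup>2 / c1) / s = hB \<theta> - l\<^sup>2 / c1 * s"
        using s by (simp add: diff_divide_distrib power2_eq_square)
      ultimately show "hB \<theta> - l\<^sup>2 / c1 * s \<le> \<rho> \<theta> s 0 / s" by simp
    qed
    then show "\<forall>\<^sub>F s in at_right 0. hB \<theta> - l\<^sup>2 / c1 * s \<le> \<rho> \<theta> s 0 / s" "\<forall>\<^sub>F s in at_right 0. \<rho> \<theta> s 0 / s \<le> hB \<theta>"
      by (auto simp: eventually_at_filter)
  qed
  then show ?thesis by (simp add: has_field_derivative_iff \<rho>_0)
qed

text \<open>The density \<open>w\<close> is continuous off the origin, and this keeps the normal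
  rays away from it.\<close>

lemma nc_nonzero: assumes "0 \<le> r" shows "nc \<theta> r \<noteq> 0"
proof
  assume "nc \<theta> r = 0"
  then have "h \<theta> + r = 0" using nc_unit_vec[of \<theta> r 0] by (simp add: gap_0)
  moreover obtain m where "m > 0" "\<And>\<theta>. m \<le> h \<theta>" using support_angle_pos[OF A(1) origin] by blast
  ultimately show False using assms by (metis add_pos_nonneg less_irrefl less_le_trans)
qed

definition \<Psi> :: "real \<Rightarrow> real \<Rightarrow> real" where "\<Psi> \<theta> r = w (nc \<theta> r) * (f \<theta> + r)"

definition \<Phi> :: "real \<Rightarrow> real \<Rightarrow> real" where "\<Phi> \<theta> R = (LINT r:{0<..R}|lborel. \<Psi> \<theta> r)"

lemma \<Psi>_continuous: "continuous_on {0..} (\<Psi> \<theta>)"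
proof -
  have "continuous_on {0..} (\<lambda>r. w (nc \<theta> r))"
    by (rule continuous_on_compose2[OF w(4)]) (auto intro!: continuous_intros simp: nc_nonzero)
  then show ?thesis unfolding \<Psi>_def by (intro continuous_intros)
qed

lemma \<Psi>_bounds: assumes "0 \<le> r" shows "0 \<le> \<Psi> \<theta> r" "\<Psi> \<theta> r \<le> c2 + r"
proof -
  have fr: "0 \<le> f \<theta> + r" "f \<theta> + r \<le> c2 + r" using f_pos[of \<theta>] f(3)[of \<theta>] assms by auto
  show "0 \<le> \<Psi> \<theta> r" unfolding \<Psi>_def using w(2) fr by simp
  have "w (nc \<theta> r) * (f \<theta> + r) \<le> f \<theta> + r" using mult_right_mono[OF w(3) fr(1)] by simp
  then show "\<Psi> \<theta> r \<le> c2 + r" unfolding \<Psi>_def by (rule order_trans[OF _ fr(2)])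
qed

lemma \<Phi>_eq: assumes "0 \<le> R" shows "\<Phi> \<theta> R = integral {0..R} (\<Psi> \<theta>)"
proof -
  have c: "continuous_on {0..R} (\<Psi> \<theta>)" by (rule continuous_on_subset[OF \<Psi>_continuous]) auto
  have "set_integrable lborel {0<..R} (\<Psi> \<theta>)"
    by (rule set_integrable_subset[OF borel_integrable_atLeastAtMost'[OF c]]) auto
  then have "\<Phi> \<theta> R = integral {0<..R} (\<Psi> \<theta>)" unfolding \<Phi>_def by (rule set_borel_integral_eq_integral(2))
  also have "\<dots> = integral {0..R} (\<Psi> \<theta>)"
    by (rule integral_spike_set) (auto intro: negligible_subset[OF negligible_sing[of "0::real"]])
  finally show ?thesis .
qed

text \<open>Taken within \<open>{0..}\<close> so as to include \<open>R = 0\<close>, the height at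
  \<open>s = t = 0\<close>.\<close>

lemma \<Phi>_derivative: assumes R: "0 \<le> R" shows "(\<Phi> \<theta> has_real_derivative \<Psi> \<theta> R) (at R within {0..})"
proof -
  have "continuous_on {0..R + 1} (\<Psi> \<theta>)" by (rule continuous_on_subset[OF \<Psi>_continuous]) auto
  then have "((\<lambda>x. integral {0..x} (\<Psi> \<theta>)) has_real_derivative \<Psi> \<theta> R) (at R within {0..R + 1})"
    by (rule integral_has_real_derivative) (use R in auto)
  moreover have "at R within {0..R + 1} = at R within {0..}"
    by (rule at_within_nhd[of _ "{..<R + 1}"]) auto
  ultimately have "((\<lambda>x. integral {0..x} (\<Psi> \<theta>)) has_real_derivative \<Psi> \<theta> R) (at R within {0..})" by simp
  then show ?thesis
    by (rule has_field_derivative_transform_within[of _ _ _ _ 1]) (use R \<Phi>_eq in auto)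
qed

lemma \<Phi>_diff: assumes ab: "0 \<le> a" "a \<le> b" shows "\<bar>\<Phi> \<theta> b - \<Phi> \<theta> a\<bar> \<le> (c2 + b) * (b - a)"
proof -
  have c: "\<Psi> \<theta> integrable_on {x..b}" if "0 \<le> x" for x
    by (rule integrable_continuous_real, rule continuous_on_subset[OF \<Psi>_continuous]) (use that in auto)
  have "integral {0..a} (\<Psi> \<theta>) + integral {a..b} (\<Psi> \<theta>) = integral {0..b} (\<Psi> \<theta>)"
    by (rule Henstock_Kurzweil_Integration.integral_combine) (use ab c[of 0] in auto)
  then have eq: "\<Phi> \<theta> b - \<Phi> \<theta> a = integral {a..b} (\<Psi> \<theta>)" using ab by (simp add: \<Phi>_eq)
  have "0 \<le> integral {a..b} (\<Psi> \<theta>)"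
    by (rule Henstock_Kurzweil_Integration.integral_nonneg[OF c[OF ab(1)]]) (use ab \<Psi>_bounds in auto)
  moreover have "integral {a..b} (\<Psi> \<theta>) \<le> integral {a..b} (\<lambda>_. c2 + b)"
    by (rule integral_le[OF c[OF ab(1)]]) (use ab in \<open>auto intro: order_trans[OF \<Psi>_bounds(2)]\<close>)
  ultimately show ?thesis using ab eq by (simp add: mult.commute)
qed

definition Q :: "real \<Rightarrow> real \<Rightarrow> (real^2) set" where
  "Q s t = A + (\<lambda>x. s *\<^sub>R x) ` B + (\<lambda>x. t *\<^sub>R x) ` C"

lemma Q_body:
  assumes st: "0 \<le> s" "0 \<le> t"
  shows "compact (Q s t)" "convex (Q s t)" "Q s t \<noteq> {}" "support_angle (Q s t) \<theta> = h \<theta> + (s * hB \<theta> + t * hC \<theta>)"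
proof -
  let ?B = "(\<lambda>x. s *\<^sub>R x) ` B" and ?C = "(\<lambda>x. t *\<^sub>R x) ` C"
  have c: "compact ?B" "compact ?C" using B C by (auto intro: compact_scaling)
  have ne: "?B \<noteq> {}" "?C \<noteq> {}" "A + ?B \<noteq> {}" using A B C by (auto simp: set_plus_def)
  have cab: "compact (A + ?B)" by (rule compact_set_plus[OF A(1) c(1)])
  show "compact (Q s t)" unfolding Q_def by (rule compact_set_plus[OF cab c(2)])
  show "convex (Q s t)" unfolding Q_def by (intro convex_set_plus convex_scaling A B C)
  show "Q s t \<noteq> {}" unfolding Q_def using ne by (auto simp: set_plus_def)
  show "support_angle (Q s t) \<theta> = h \<theta> + (s * hB \<theta> + t * hC \<theta>)"
    unfolding Q_def support_angle_def
    by (simp add: support_fun_plus[OF cab ne(3) c(2) ne(2)] support_fun_plus[OF A(1,3) c(1) ne(1)]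
        support_fun_image_scaleR[OF B(1,3) st(1)] support_fun_image_scaleR[OF C(1,3) st(2)])
qed

lemma Q_ge: assumes st: "0 \<le> s" "0 \<le> t" shows "h \<theta> \<le> support_angle (Q s t) \<theta>" "A \<subseteq> Q s t"
proof -
  show *: "h \<theta> \<le> support_angle (Q s t) \<theta>" for \<theta> using Q_body(4)[OF st, of \<theta>] st hB hC by simp
  show "A \<subseteq> Q s t"
    using mem_iff_support_angle[OF A] mem_iff_support_angle[OF Q_body(1-3)[OF st]] * by (meson order_trans subsetI)
qed

definition F :: "real \<Rightarrow> real \<Rightarrow> real" where "F s t = (LINT x:Q s t|lborel. w x)"

abbreviation "N \<equiv> lebesgue_on {0..2*pi}"

lemma F_formula:
  assumes st: "0 \<le> s" "0 \<le> t"
  shows "integrable N (\<lambda>\<theta>. \<Phi> \<theta> (\<rho> \<theta> s t))"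
    "F s t = (LINT x:A|lborel. w x) + integral\<^sup>L N (\<lambda>\<theta>. \<Phi> \<theta> (\<rho> \<theta> s t))"
proof -
  have Qm: "Q s t \<in> sets borel" using Q_body(1)[OF st] by (rule borel_compact)
  have int: "set_integrable lborel (Q s t) w"
  proof -
    have "set_integrable lborel (Q s t) (\<lambda>_. 1::real)"
      unfolding set_integrable_def using Qm emeasure_compact_finite[OF Q_body(1)[OF st]] by simp
    then show ?thesis
      by (rule set_integrable_bound) (use w Qm in \<open>auto simp: set_borel_measurable_def\<close>)
  qed
  have mem: "nc \<theta> r \<in> Q s t \<longleftrightarrow> r \<le> \<rho> \<theta> s t" if "0 < r" for \<theta> r
    using mem_iff_le_reach[OF Q_body(1-3)[OF st] Q_ge(1)[OF st], of r \<theta>] that unfolding \<rho>_def Q_body(4)[OF st] by simp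
  show "integrable N (\<lambda>\<theta>. \<Phi> \<theta> (\<rho> \<theta> s t))"
    "F s t = (LINT x:A|lborel. w x) + integral\<^sup>L N (\<lambda>\<theta>. \<Phi> \<theta> (\<rho> \<theta> s t))"
    using integral_normal_coordinates[OF w(1) int Qm Q_ge(2)[OF st] mem] unfolding F_def \<Phi>_def \<Psi>_def by auto
qed

lemma const_integrable: "integrable N (\<lambda>_. c::real)"
proof -
  interpret finite_measure N by (rule finite_measure_lebesgue_on) auto
  show ?thesis by simp
qed

text \<open>The integrand of the right derivative of \<open>F s\<close> at 0, as the chain rule
  gives it for \<open>\<Phi> \<theta> (\<rho> \<theta> s t)\<close>.\<close>

definition g\<^sub>1 :: "real \<Rightarrow> real \<Rightarrow> real" where "g\<^sub>1 s \<theta> = \<Psi> \<theta> (\<rho> \<theta> s 0) * \<sigma> \<theta> s"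

lemma M_nonneg: "0 \<le> M" using hB[of 0] by linarith

definition \<Delta> :: "real \<Rightarrow> real \<Rightarrow> real \<Rightarrow> real" where
  "\<Delta> s t \<theta> = (\<Phi> \<theta> (\<rho> \<theta> s t) - \<Phi> \<theta> (\<rho> \<theta> s 0)) / t"

lemma quotient_limit:
  assumes "0 \<le> s"
  shows "((\<lambda>t. \<Delta> s t \<theta>) \<longlongrightarrow> g\<^sub>1 s \<theta>) (at_right 0)"
proof -
  have "((\<lambda>t. \<Phi> \<theta> (\<rho> \<theta> s t)) has_real_derivative \<Psi> \<theta> (\<rho> \<theta> s 0) * \<sigma> \<theta> s) (at_right 0)"
    using assms by (intro DERIV_at_right_chain \<rho>_derivative \<Phi>_derivative \<rho>_bounds(1)) auto
  then show ?thesis by (simp add: has_field_derivative_iff g\<^sub>1_def \<Delta>_def)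
qed

lemma quotient_measurable:
  assumes "0 \<le> s" "0 \<le> t"
  shows "\<Delta> s t \<in> borel_measurable N"
  unfolding \<Delta>_def[abs_def]
  using borel_measurable_integrable[OF F_formula(1)[OF assms]] borel_measurable_integrable[OF F_formula(1)[OF assms(1) order_refl]]
  by measurable

text \<open>The right derivative \<sigma> comes from a definite description; measurability is
  obtained from the difference quotients, which converge at every \<theta>.\<close>

lemma g1_measurable: assumes "0 \<le> s" shows "g\<^sub>1 s \<in> borel_measurable N"
proof (rule borel_measurable_LIMSEQ_real)
  fix n show "\<Delta> s (inverse (real (Suc n))) \<in> borel_measurable N"
    using assms by (intro quotient_measurable) auto
next
  fix \<theta>
  from filterlim_compose[OF quotient_limit[OF assms] filterlim_inverse_Suc]
  show "(\<lambda>n. \<Delta> s (inverse (real (Suc n))) \<theta>) \<longlonglongrightarrow> g\<^sub>1 s \<theta>" .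
qed

lemma \<rho>_le_const: assumes "0 \<le> s" "0 \<le> t" shows "\<rho> \<theta> s t \<le> (s + t) * M"
proof -
  have "s * hB \<theta> + t * hC \<theta> \<le> s * M + t * M" using assms hB(2) hC(2) by (intro add_mono mult_left_mono)
  then show ?thesis using \<rho>_bounds(2)[OF assms, of \<theta>] by (simp add: distrib_right)
qed

lemma F_right_derivative:
  assumes s: "0 \<le> s"
  shows "integrable N (g\<^sub>1 s)" "(F s has_real_derivative integral\<^sup>L N (g\<^sub>1 s)) (at_right 0)"
proof -
  \<comment> \<open>The Lipschitz bound for \<Phi> on heights up to \<open>(s + 1) * M\<close>,
    valid as \<open>t < 1\<close>, times the bound for the difference quotients of the
    height.\<close>
  define c where "c = (c2 + (s + 1) * M) * (M + K\<^sub>1 * s)"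
  have c2: "0 \<le> c2" using f_pos[of 0] f(3)[of 0] by linarith
  have bound: "\<bar>\<Delta> s t \<theta>\<bar> \<le> c" if t: "0 < t" "t < 1" for t \<theta>
  proof -
    have "\<bar>\<Phi> \<theta> (\<rho> \<theta> s t) - \<Phi> \<theta> (\<rho> \<theta> s 0)\<bar> \<le> (c2 + \<rho> \<theta> s t) * (\<rho> \<theta> s t - \<rho> \<theta> s 0)"
      using s t by (intro \<Phi>_diff \<rho>_bounds \<rho>_mono) auto
    then have "\<bar>\<Delta> s t \<theta>\<bar> \<le> (c2 + \<rho> \<theta> s t) * (\<rho> \<theta> s t - \<rho> \<theta> s 0) / t"
      using t by (simp add: \<Delta>_def abs_divide divide_right_mono)
    also have "\<dots> = (c2 + \<rho> \<theta> s t) * ((\<rho> \<theta> s t - \<rho> \<theta> s 0) / t)" by simp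
    also have "\<dots> \<le> c" unfolding c_def
    proof (rule mult_mono)
      have "(s + t) * M \<le> (s + 1) * M" using t M_nonneg by (intro mult_right_mono) auto
      then show "c2 + \<rho> \<theta> s t \<le> c2 + (s + 1) * M" using \<rho>_le_const[OF s, of t \<theta>] t by simp
      show "(\<rho> \<theta> s t - \<rho> \<theta> s 0) / t \<le> M + K\<^sub>1 * s"
        using \<rho>_slope[OF s t(1), of \<theta>] \<sigma>_bound[OF s, of \<theta>] hC(2)[of \<theta>] by linarith
      show "0 \<le> c2 + (s + 1) * M" using c2 s M_nonneg by simp
      show "0 \<le> (\<rho> \<theta> s t - \<rho> \<theta> s 0) / t" using \<rho>_mono[of s 0 t \<theta>] s t by simp
    qed
    finally show ?thesis .
  qed
  have meas: "\<Delta> s t \<in> borel_measurable N" if "0 < t" "t < 1" for t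
    using quotient_measurable[OF s, of t] that by simp
  have lim: "AE \<theta> in N. ((\<lambda>t. \<Delta> s t \<theta>) \<longlongrightarrow> g\<^sub>1 s \<theta>) (at_right 0)"
    using quotient_limit[OF s] by simp
  have bd: "AE \<theta> in N. \<bar>\<Delta> s t \<theta>\<bar> \<le> c" if "0 < t" "t < 1" for t
    using bound[OF that] by simp
  note dct = dominated_convergence_at_right[OF zero_less_one meas g1_measurable[OF s] lim bd const_integrable]
  show "integrable N (g\<^sub>1 s)" by (rule dct(1))
  have eq: "integral\<^sup>L N (\<Delta> s t) = (F s t - F s 0) / t" if "0 < t" for t
    unfolding \<Delta>_def
    using F_formula[OF s, of t] F_formula[OF s, of 0] that by (simp add: Bochner_Integration.integral_diff)
  have "((\<lambda>t. (F s t - F s 0) / t) \<longlongrightarrow> integral\<^sup>L N (g\<^sub>1 s)) (at_right 0)"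
    by (rule Lim_transform_eventually[OF dct(2)]) (use eq in \<open>auto simp: eventually_at_filter\<close>)
  then show "(F s has_real_derivative integral\<^sup>L N (g\<^sub>1 s)) (at_right 0)" by (simp add: has_field_derivative_iff)
qed

lemma at_0_within_atLeast: "at (0::real) within {0..} = at_right 0"
proof -
  have "{0..} - {0} = {0<..} - {0::real}" by auto
  then show ?thesis by (simp add: at_within_def)
qed

lemma \<Psi>_derivative: "(\<Psi> \<theta> has_real_derivative w1 \<theta> * f \<theta> + w (nc \<theta> 0)) (at 0 within {0..})"
proof -
  have "((\<lambda>r. w (nc \<theta> r) * (f \<theta> + r)) has_real_derivative w1 \<theta> * (f \<theta> + 0) + 1 * w (nc \<theta> 0)) (at_right 0)"
    by (rule DERIV_mult[OF w_der]) (auto intro!: derivative_eq_intros)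
  then show ?thesis unfolding \<Psi>_def[abs_def] at_0_within_atLeast by simp
qed

lemma W_nonneg: "0 \<le> W" using w_lip[of 1 0] by (smt (verit))

lemma \<Psi>_diff: assumes r: "0 \<le> r" "r \<le> 1" shows "\<bar>\<Psi> \<theta> r - \<Psi> \<theta> 0\<bar> \<le> (W * (c2 + 1) + 1) * r"
proof -
  have fr: "\<bar>f \<theta> + r\<bar> \<le> c2 + 1" using f_pos[of \<theta>] f(3)[of \<theta>] r by auto
  have "\<Psi> \<theta> r - \<Psi> \<theta> 0 = (w (nc \<theta> r) - w (nc \<theta> 0)) * (f \<theta> + r) + w (nc \<theta> 0) * r"
    by (simp add: \<Psi>_def algebra_simps)
  then have "\<bar>\<Psi> \<theta> r - \<Psi> \<theta> 0\<bar> \<le> \<bar>w (nc \<theta> r) - w (nc \<theta> 0)\<bar> * \<bar>f \<theta> + r\<bar> + \<bar>w (nc \<theta> 0)\<bar> * \<bar>r\<bar>"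
    using abs_triangle_ineq[of "(w (nc \<theta> r) - w (nc \<theta> 0)) * (f \<theta> + r)" "w (nc \<theta> 0) * r"] by (simp add: abs_mult)
  also have "\<dots> \<le> (W * r) * (c2 + 1) + 1 * r"
    using w_lip[OF r, of \<theta>] fr w(2,3)[of "nc \<theta> 0"] r W_nonneg by (intro add_mono mult_mono) auto
  finally show ?thesis by (simp add: algebra_simps)
qed

text \<open>Product rule for
  \<open>\<Psi> \<theta> (\<rho> \<theta> s 0) * \<sigma> \<theta> s\<close> at
  \<open>s = 0\<close>. The first factor contributes \<open>(w1 * f + w) * hB * hC\<close>; the
  second contributes \<open>w * f\<close> times \<open>- b * d / f\<close>.\<close>

theorem mixed_right_derivative:
  assumes dB: "AE \<theta> in N. (hB has_real_derivative b \<theta>) (at \<theta>)" and dC: "AE \<theta> in N. (hC has_real_derivative d \<theta>) (at \<theta>)"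
  defines "g \<equiv> \<lambda>\<theta>. w (nc \<theta> 0) * (hB \<theta> * hC \<theta> - b \<theta> * d \<theta>) + w1 \<theta> * f \<theta> * hB \<theta> * hC \<theta>"
  shows "integrable N g" "has_mixed_right_derivative F (integral\<^sup>L N g)"
proof -
  have lim: "AE \<theta> in N. ((\<lambda>s. (g\<^sub>1 s \<theta> - g\<^sub>1 0 \<theta>) / s) \<longlongrightarrow> g \<theta>) (at_right 0)"
    using dB dC
  proof eventually_elim
    case (elim \<theta>)
    have "(\<Psi> \<theta> has_real_derivative w1 \<theta> * f \<theta> + w (nc \<theta> 0)) (at (\<rho> \<theta> 0 0) within {0..})"
      unfolding \<rho>_0 by (rule \<Psi>_derivative)
    then have "((\<lambda>s. \<Psi> \<theta> (\<rho> \<theta> s 0)) has_real_derivative (w1 \<theta> * f \<theta> + w (nc \<theta> 0)) * hB \<theta>) (at_right 0)"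
      by (intro DERIV_at_right_chain[OF \<rho>_derivative_0]) (auto intro: \<rho>_bounds(1))
    from DERIV_mult[OF this \<sigma>_derivative[OF elim]]
    have "((\<lambda>s. g\<^sub>1 s \<theta>) has_real_derivative (w1 \<theta> * f \<theta> + w (nc \<theta> 0)) * hB \<theta> * \<sigma> \<theta> 0
        + - b \<theta> * d \<theta> / f \<theta> * \<Psi> \<theta> (\<rho> \<theta> 0 0)) (at_right 0)"
      unfolding g\<^sub>1_def .
    moreover have "(w1 \<theta> * f \<theta> + w (nc \<theta> 0)) * hB \<theta> * \<sigma> \<theta> 0 + - b \<theta> * d \<theta> / f \<theta> * \<Psi> \<theta> (\<rho> \<theta> 0 0) = g \<theta>"
      using f_pos[of \<theta>] by (simp add: \<sigma>_0 \<rho>_0 \<Psi>_def g_def algebra_simps)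
    ultimately show ?case by (simp add: has_field_derivative_iff)
  qed
  have meas: "(\<lambda>\<theta>. (g\<^sub>1 s \<theta> - g\<^sub>1 0 \<theta>) / s) \<in> borel_measurable N" if "0 \<le> s" for s
    using g1_measurable[OF that] g1_measurable[of 0] by measurable
  have gm: "g \<in> borel_measurable N"
  proof (rule lebesgue_on_AE_limit_measurable)
    show "{0..2*pi} \<in> sets lebesgue" by simp
    show "(\<lambda>\<theta>. (g\<^sub>1 (inverse (real (Suc n))) \<theta> - g\<^sub>1 0 \<theta>) / inverse (real (Suc n))) \<in> borel_measurable N" for n
      by (rule meas) simp
    show "AE \<theta> in N. (\<lambda>n. (g\<^sub>1 (inverse (real (Suc n))) \<theta> - g\<^sub>1 0 \<theta>) / inverse (real (Suc n))) \<longlonglongrightarrow> g \<theta>"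
      using lim by eventually_elim (rule filterlim_compose[OF _ filterlim_inverse_Suc])
  qed
  define W' where "W' = W * (c2 + 1) + 1"
  \<comment> \<open>The product rule in quantitative form: Lipschitz constant of \<Psi> times
    \<open>\<rho> \<le> s * M\<close> times the bound of \<sigma>, plus the bound \<open>c2\<close>
    of \<open>\<Psi> \<theta> 0\<close> times the deviation of \<sigma>.\<close>
  define c where "c = W' * M * (M + K\<^sub>1) + c2 * K\<^sub>1"
  \<comment> \<open>For \<open>s < e\<close> the height is at most 1, the range in which the
    Lipschitz bound of the density holds; adding 1 avoids division by zero.\<close>
  define e where "e = 1 / (M + 1)"
  have e: "0 < e" "e \<le> 1" using M_nonneg by (auto simp: e_def)
  have c2: "0 \<le> c2" using f_pos[of 0] f(3)[of 0] by linarith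
  have W': "0 \<le> W'" using W_nonneg c2 by (simp add: W'_def)
  have bound: "\<bar>(g\<^sub>1 s \<theta> - g\<^sub>1 0 \<theta>) / s\<bar> \<le> c" if s: "0 < s" "s < e" for s \<theta>
  proof -
    have r0: "0 \<le> \<rho> \<theta> s 0" using s by (intro \<rho>_bounds) auto
    have rM: "\<rho> \<theta> s 0 \<le> s * M" using \<rho>_le_const[of s 0 \<theta>] s by simp
    have "s * (M + 1) < 1" using s(2) M_nonneg by (simp add: e_def pos_less_divide_eq)
    then have "s * M \<le> 1" using s by (simp add: algebra_simps)
    then have r1: "\<rho> \<theta> s 0 \<le> 1" using rM by linarith
    have "\<bar>\<Psi> \<theta> (\<rho> \<theta> s 0) - \<Psi> \<theta> 0\<bar> \<le> W' * \<rho> \<theta> s 0" unfolding W'_def by (rule \<Psi>_diff[OF r0 r1])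
    also have "\<dots> \<le> W' * (s * M)" using rM W' by (rule mult_left_mono)
    finally have P: "\<bar>\<Psi> \<theta> (\<rho> \<theta> s 0) - \<Psi> \<theta> 0\<bar> \<le> W' * (s * M)" .
    have sd: "\<bar>\<sigma> \<theta> s - hC \<theta>\<bar> \<le> K\<^sub>1 * s" using \<sigma>_bound[of s \<theta>] s by simp
    have "K\<^sub>1 * s \<le> K\<^sub>1 * 1" using s e K1_nonneg by (intro mult_left_mono) auto
    then have S: "\<bar>\<sigma> \<theta> s\<bar> \<le> M + K\<^sub>1" using sd hC(1,2)[of \<theta>] by linarith
    have P0: "\<bar>\<Psi> \<theta> 0\<bar> \<le> c2" using \<Psi>_bounds[of 0 \<theta>] by simp
    have "g\<^sub>1 s \<theta> - g\<^sub>1 0 \<theta> = (\<Psi> \<theta> (\<rho> \<theta> s 0) - \<Psi> \<theta> 0) * \<sigma> \<theta> s + \<Psi> \<theta> 0 * (\<sigma> \<theta> s - hC \<theta>)"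
      by (simp add: g\<^sub>1_def \<rho>_0 \<sigma>_0 algebra_simps)
    then have "\<bar>g\<^sub>1 s \<theta> - g\<^sub>1 0 \<theta>\<bar> \<le> \<bar>\<Psi> \<theta> (\<rho> \<theta> s 0) - \<Psi> \<theta> 0\<bar> * \<bar>\<sigma> \<theta> s\<bar> + \<bar>\<Psi> \<theta> 0\<bar> * \<bar>\<sigma> \<theta> s - hC \<theta>\<bar>"
      using abs_triangle_ineq[of "(\<Psi> \<theta> (\<rho> \<theta> s 0) - \<Psi> \<theta> 0) * \<sigma> \<theta> s" "\<Psi> \<theta> 0 * (\<sigma> \<theta> s - hC \<theta>)"] by (simp add: abs_mult)
    also have "\<dots> \<le> (W' * (s * M)) * (M + K\<^sub>1) + c2 * (K\<^sub>1 * s)"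
      using P S P0 sd W' s M_nonneg c2 by (intro add_mono mult_mono) auto
    also have "\<dots> = c * s" by (simp add: c_def algebra_simps)
    finally show ?thesis using s by (simp add: abs_divide pos_divide_le_eq)
  qed
  have bd: "AE \<theta> in N. \<bar>(g\<^sub>1 s \<theta> - g\<^sub>1 0 \<theta>) / s\<bar> \<le> c" if "0 < s" "s < e" for s
    using bound[OF that] by simp
  have meas': "(\<lambda>\<theta>. (g\<^sub>1 s \<theta> - g\<^sub>1 0 \<theta>) / s) \<in> borel_measurable N" if "0 < s" "s < e" for s
    using meas[of s] that by simp
  note dct = dominated_convergence_at_right[OF e(1) meas' gm lim bd const_integrable]
  show "integrable N g" by (rule dct(1))
  have eq: "integral\<^sup>L N (\<lambda>\<theta>. (g\<^sub>1 s \<theta> - g\<^sub>1 0 \<theta>) / s) = (integral\<^sup>L N (g\<^sub>1 s) - integral\<^sup>L N (g\<^sub>1 0)) / s" if "0 < s" for s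
    using F_right_derivative(1)[of s] F_right_derivative(1)[of 0] that by (simp add: Bochner_Integration.integral_diff)
  have "((\<lambda>s. (integral\<^sup>L N (g\<^sub>1 s) - integral\<^sup>L N (g\<^sub>1 0)) / s) \<longlongrightarrow> integral\<^sup>L N g) (at_right 0)"
    by (rule Lim_transform_eventually[OF dct(2)]) (use eq in \<open>auto simp: eventually_at_filter\<close>)
  then have "((\<lambda>s. integral\<^sup>L N (g\<^sub>1 s)) has_real_derivative integral\<^sup>L N g) (at_right 0)"
    by (simp add: has_field_derivative_iff)
  then show "has_mixed_right_derivative F (integral\<^sup>L N g)"
    unfolding has_mixed_right_derivative_def using F_right_derivative(2)
    by (intro exI[of _ 1] conjI exI[of _ "\<lambda>s. integral\<^sup>L N (g\<^sub>1 s)"]) auto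
qed

end

section \<open>Densities given by a gauge\<close>

lemma measure_density_compact:
  fixes w :: "'a::euclidean_space \<Rightarrow> real"
  assumes w: "w \<in> borel_measurable borel" "\<And>x. 0 \<le> w x" and K: "compact K"
  shows "measure (density lborel (\<lambda>x. ennreal (w x))) K = (LINT x:K|lborel. w x)"
proof -
  have K': "K \<in> sets borel" using K by (rule borel_compact)
  have "measure (density lborel (\<lambda>x. ennreal (w x))) K = (LINT x|density lborel (\<lambda>x. ennreal (w x)). indicator K x)"
    by simp
  also have "\<dots> = (LINT x|lborel. w x *\<^sub>R indicator K x)"
    by (rule integral_density) (use w K' in auto)
  finally show ?thesis by (simp add: set_lebesgue_integral_def mult.commute)
qed

section \<open>Regularity of the density built from a gauge\<close>

locale gauge_density =
  fixes L :: "(real^2) set" and \<phi> :: "real \<Rightarrow> real"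
  assumes L: "compact L" "convex L" "0 \<in> interior L" and L_smooth: "C2_plus L"
    and phi_nonneg: "\<And>r. r \<ge> 0 \<Longrightarrow> \<phi> r \<ge> 0"
    and phi_mono: "mono_on {0..} \<phi>"
    and phi_C2: "C2_on {0<..} \<phi>"
begin

definition w :: "real^2 \<Rightarrow> real" where "w x = exp (- \<phi> (body_gauge L x))"

lemma gauge_eq: "body_gauge L = support_fun (polar_set L)"
  using body_gauge_eq_support_fun[OF L] by blast

lemma gauge_pos: "x \<noteq> 0 \<Longrightarrow> 0 < body_gauge L x"
  using gauge_frontier_decomposition[OF L] by blast

lemma gauge_nonneg: "0 \<le> body_gauge L x"
proof -
  have "0 \<in> polar_set L" by (simp add: polar_set_def)
  from support_fun_ge[OF compact_polar_set[OF L(3)] this, of x] show ?thesis by (simp add: gauge_eq)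
qed

lemma gauge_continuous: "continuous_on S (body_gauge L)"
  unfolding gauge_eq by (rule support_fun_continuous[OF compact_polar_set[OF L(3)] polar_set_nonempty])

lemma gauge_lipschitz:
  obtains G where "0 < G" "\<And>x y. \<bar>body_gauge L x - body_gauge L y\<bar> \<le> G * norm (x - y)"
proof -
  obtain G where G: "G > 0" "\<And>y. y \<in> polar_set L \<Longrightarrow> norm y \<le> G"
    using compact_imp_bounded[OF compact_polar_set[OF L(3)]] by (meson bounded_pos)
  show thesis
    using that[OF G(1)] support_fun_lipschitz[OF compact_polar_set[OF L(3)] polar_set_nonempty G(2)]
    unfolding gauge_eq by blast
qed

lemma gauge_lower:
  obtains m where "0 < m" "\<And>x. m * norm x \<le> body_gauge L x"
proof -
  obtain M where M: "M > 0" "\<And>y. y \<in> L \<Longrightarrow> norm y \<le> M"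
    using compact_imp_bounded[OF L(1)] by (meson bounded_pos)
  have "1 / M * norm x \<le> body_gauge L x" for x
  proof (cases "x = 0")
    case False
    obtain y where y: "y \<in> L" "x = body_gauge L x *\<^sub>R y"
      using gauge_frontier_decomposition[OF L False] by blast
    have "norm x = body_gauge L x * norm y" by (subst y(2)) (simp add: gauge_nonneg)
    also have "\<dots> \<le> body_gauge L x * M" using M(2)[OF y(1)] gauge_nonneg by (rule mult_left_mono)
    finally show ?thesis using M(1) by (simp add: pos_divide_le_eq)
  qed (simp add: gauge_nonneg)
  then show thesis using that[of "1 / M"] M(1) by simp
qed

lemma phi_derivative: "0 < r \<Longrightarrow> (\<phi> has_real_derivative deriv \<phi> r) (at r)"
  using phi_C2 unfolding C2_on_def by (simp add: DERIV_deriv_iff_real_differentiable)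

lemma phi_continuous: "continuous_on {0<..} \<phi>"
  using phi_derivative by (auto intro!: continuous_at_imp_continuous_on DERIV_isCont)

lemma deriv_phi_continuous: "continuous_on {0<..} (deriv \<phi>)"
  using phi_C2 unfolding C2_on_def
  by (auto intro!: continuous_at_imp_continuous_on differentiable_imp_continuous_within)

lemma w_measurable: "w \<in> borel_measurable borel"
proof -
  \<comment> \<open>\<phi> is monotone only on \<open>{0..}\<close>; truncating the argument makes a
    monotone function on the whole line that agrees with it at all gauge values.\<close>
  have "mono (\<lambda>r. \<phi> (max 0 r))"
    using phi_mono by (auto simp: mono_def mono_on_def)
  then have "(\<lambda>r. \<phi> (max 0 r)) \<in> borel_measurable borel" by (rule borel_measurable_mono)
  moreover have "body_gauge L \<in> borel_measurable borel"
    by (rule borel_measurable_continuous_onI[OF gauge_continuous])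
  ultimately have "(\<lambda>x. exp (- \<phi> (max 0 (body_gauge L x)))) \<in> borel_measurable borel" by measurable
  then show ?thesis unfolding w_def[abs_def] using gauge_nonneg by (simp add: max_absorb2)
qed

lemma w_bounds: "0 \<le> w x" "w x \<le> 1"
  using phi_nonneg[OF gauge_nonneg] by (simp_all add: w_def)

lemma w_continuous: "continuous_on (- {0}) w"
  unfolding w_def
  by (intro continuous_intros continuous_on_compose2[OF phi_continuous gauge_continuous]) (use gauge_pos in auto)

text \<open>On the annulus the gauge takes values in a compact interval of positive numbers, where
  \<open>deriv \<phi>\<close> is bounded. The mean value bound is applied to \<phi> on that
  interval, so the annulus itself need not be convex; the gauge is Lipschitz on the whole
  plane.\<close>

lemma w_lipschitz:
  assumes "0 < a"
  obtains W where "\<And>x y. a \<le> norm x \<Longrightarrow> norm x \<le> b \<Longrightarrow> a \<le> norm y \<Longrightarrow> norm y \<le> b \<Longrightarrow> \<bar>w x - w y\<bar> \<le> W * norm (x - y)"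
proof -
  obtain G where G: "0 < G" "\<And>x y. \<bar>body_gauge L x - body_gauge L y\<bar> \<le> G * norm (x - y)"
    using gauge_lipschitz by blast
  obtain m where m: "0 < m" "\<And>x. m * norm x \<le> body_gauge L x" using gauge_lower by blast
  define I where "I = {m * a..G * b}"
  have I_pos: "I \<subseteq> {0<..}" using m(1) assms by (auto simp: I_def intro: less_le_trans[of 0 "m * a"])
  have gI: "body_gauge L x \<in> I" if "a \<le> norm x" "norm x \<le> b" for x
  proof -
    have "m * a \<le> m * norm x" "G * norm x \<le> G * b" using that m(1) G(1) by (auto intro: mult_left_mono)
    moreover have "body_gauge L 0 = 0"
      using support_fun_scaleR[OF compact_polar_set[OF L(3)] polar_set_nonempty, of 0 0] by (simp add: gauge_eq)
    ultimately show ?thesis using m(2)[of x] G(2)[of x 0] by (auto simp: I_def)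
  qed
  have "bounded (deriv \<phi> ` I)"
    by (intro compact_imp_bounded compact_continuous_image continuous_on_subset[OF deriv_phi_continuous I_pos])
       (simp add: I_def)
  then obtain D where D: "D > 0" "\<And>r. r \<in> I \<Longrightarrow> norm (deriv \<phi> r) \<le> D" by (auto simp: bounded_pos)
  have phi_lip: "norm (\<phi> r - \<phi> s) \<le> D * norm (r - s)" if "r \<in> I" "s \<in> I" for r s
  proof (rule field_differentiable_bound[where S = I and f' = "deriv \<phi>"])
    fix z assume "z \<in> I"
    then show "(\<phi> has_real_derivative deriv \<phi> z) (at z within I)"
      using I_pos by (intro has_field_derivative_at_within[OF phi_derivative]) auto
  qed (use D(2) that in \<open>auto simp: I_def\<close>)
  have exp_lip: "norm (exp (- r) - exp (- s)) \<le> 1 * norm (r - s)" if "0 \<le> r" "0 \<le> s" for r s :: real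
    by (rule field_differentiable_bound[where S = "{0..}" and f' = "\<lambda>r. - exp (- r)"])
      (use that in \<open>auto intro!: derivative_eq_intros\<close>)
  show thesis
  proof (rule that[of "D * G"])
    fix x y :: "real^2" assume xy: "a \<le> norm x" "norm x \<le> b" "a \<le> norm y" "norm y \<le> b"
    have "\<bar>w x - w y\<bar> \<le> \<bar>\<phi> (body_gauge L x) - \<phi> (body_gauge L y)\<bar>"
      using exp_lip[of "\<phi> (body_gauge L x)" "\<phi> (body_gauge L y)"] phi_nonneg gauge_nonneg by (simp add: w_def)
    also have "\<dots> \<le> D * \<bar>body_gauge L x - body_gauge L y\<bar>" using phi_lip gI xy by simp
    also have "\<dots> \<le> D * (G * norm (x - y))" using G(2) D(1) by (intro mult_left_mono) auto
    finally show "\<bar>w x - w y\<bar> \<le> D * G * norm (x - y)" by simp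
  qed
qed

lemma w_directional_derivative:
  assumes x: "x \<noteq> 0"
  shows "((\<lambda>r. w (x + r *\<^sub>R u)) has_real_derivative
    - deriv \<phi> (body_gauge L x) * (grad (body_gauge L) x \<bullet> u) * w x) (at 0 within S)"
proof -
  obtain \<gamma> \<gamma>' \<gamma>'' where "C2_curve L \<gamma> \<gamma>' \<gamma>''" using C2_plus_curve[OF L_smooth] .
  \<comment> \<open>Smoothness of \<open>L\<close> makes the gradient exist, so that the definite
    description \<open>grad\<close> denotes it.\<close>
  then obtain d where d: "GDERIV (body_gauge L) x :> d" using C2_curve.gauge_gderiv[OF _ L(3) x] by blast
  have line: "((\<lambda>r. x + r *\<^sub>R u) has_derivative (\<lambda>r. r *\<^sub>R u)) (at 0)"
    by (auto intro!: derivative_eq_intros)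
  have "(body_gauge L has_derivative (\<lambda>z. z \<bullet> d)) (at (x + 0 *\<^sub>R u))" using d by (simp add: gderiv_def)
  from has_derivative_compose[OF line this]
  have "((\<lambda>r. body_gauge L (x + r *\<^sub>R u)) has_derivative (\<lambda>r. (r *\<^sub>R u) \<bullet> d)) (at 0)" .
  then have "((\<lambda>r. body_gauge L (x + r *\<^sub>R u)) has_real_derivative grad (body_gauge L) x \<bullet> u) (at 0)"
    by (simp add: grad_eq[OF d] has_field_derivative_def inner_commute mult.commute[of _ "d \<bullet> u"] mult_commute_abs)
  moreover have "(\<phi> has_real_derivative deriv \<phi> (body_gauge L x)) (at (body_gauge L (x + 0 *\<^sub>R u)))"
    using phi_derivative[OF gauge_pos[OF x]] by simp
  ultimately have "((\<lambda>r. \<phi> (body_gauge L (x + r *\<^sub>R u))) has_real_derivative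
      deriv \<phi> (body_gauge L x) * (grad (body_gauge L) x \<bullet> u)) (at 0)"
    by (rule DERIV_chain2[rotated])
  then have "((\<lambda>r. w (x + r *\<^sub>R u)) has_real_derivative
    - deriv \<phi> (body_gauge L x) * (grad (body_gauge L) x \<bullet> u) * w x) (at 0)"
    unfolding w_def by (auto intro!: derivative_eq_intros)
  then show ?thesis by (rule has_field_derivative_at_within)
qed

end

section \<open>The formula for the gauge measure\<close>

theorem theorem5p2:
  fixes A B C L :: "(real^2) set" and \<phi> :: "real \<Rightarrow> real"
  defines "\<mu> \<equiv> gauge_measure \<phi> L"
  assumes bodies: "convex_body A" "convex_body B" "convex_body C" "convex_body L"
    and origin: "0 \<in> interior A" "0 \<in> interior B" "0 \<in> interior C" "0 \<in> interior L"
    and smooth: "C2_plus A" "C2_plus L"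
    and phi_nonneg: "\<And>r. r \<ge> 0 \<Longrightarrow> \<phi> r \<ge> 0"
    and phi_mono: "mono_on {0..} \<phi>"
    and phi_convex: "convex_on {0..} \<phi>"
    and phi_C2: "C2_on {0<..} \<phi>"
    and prob: "prob_space \<mu>"
  shows "(AE \<theta>\<in>{0..2*pi} in lebesgue. support_angle B differentiable (at \<theta>)) \<and>
    (AE \<theta>\<in>{0..2*pi} in lebesgue. support_angle C differentiable (at \<theta>)) \<and>
    (\<forall>hB' hC' :: real \<Rightarrow> real.
      (AE \<theta>\<in>{0..2*pi} in lebesgue. (support_angle B has_real_derivative hB' \<theta>) (at \<theta>)) \<longrightarrow>
      (AE \<theta>\<in>{0..2*pi} in lebesgue. (support_angle C has_real_derivative hC' \<theta>) (at \<theta>)) \<longrightarrow>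
      (let g = (\<lambda>\<theta>. exp (- \<phi> (body_gauge L (normal_point A \<theta>))) *
             (support_angle B \<theta> * support_angle C \<theta>
              - support_angle B \<theta> * support_angle C \<theta>
                * deriv \<phi> (body_gauge L (normal_point A \<theta>)) * curv_fun A \<theta>
                * (grad (body_gauge L) (normal_point A \<theta>) \<bullet> unit_vec \<theta>)
              - hB' \<theta> * hC' \<theta>))
       in set_integrable lebesgue {0..2*pi} g \<and>
          has_mixed_measure \<mu> A B C (LINT \<theta>:{0..2*pi}|lebesgue. g \<theta>)))"
proof -
  have A: "compact A" "convex A" "A \<noteq> {}" and B: "compact B" "convex B" "B \<noteq> {}"
    and C: "compact C" "convex C" "C \<noteq> {}" and L: "compact L" "convex L"
    using bodies by (auto simp: convex_body_def)
  have ae_diff: "AE \<theta>\<in>{0..2*pi} in lebesgue. support_angle K differentiable (at \<theta>)"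
    if "compact K" "K \<noteq> {}" for K
    using countable_imp_AE_lebesgue[OF support_angle_countable_nondifferentiable[OF that]]
    by eventually_elim simp
  interpret gauge_density L \<phi>
    by unfold_locales (use L origin smooth phi_nonneg phi_mono phi_C2 in auto)
  obtain \<gamma> \<gamma>' \<gamma>'' where "C2_curve A \<gamma> \<gamma>' \<gamma>''" using C2_plus_curve[OF smooth(1)] .
  then obtain h' f c1 c2 where hf: "c1 > 0" "\<And>\<theta>. c1 \<le> f \<theta>" "\<And>\<theta>. f \<theta> \<le> c2" "continuous_on UNIV f"
    "\<And>\<theta>. (support_angle A has_real_derivative h' \<theta>) (at \<theta>)"
    "\<And>\<theta>. (h' has_real_derivative f \<theta> - support_angle A \<theta>) (at \<theta>)"
    using C2_curve.support_angle_C2 by metis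
  interpret smooth_body A h' f c1 c2
    by unfold_locales (use A hf in auto)
  \<comment> \<open>With \<open>a\<close> from the support function and \<open>b\<close> bounding
    the norms on \<open>A\<close>, all points \<open>nc \<theta> r\<close> with
    \<open>0 \<le> r \<le> 1\<close> lie in the annulus of radii \<open>a\<close> and
    \<open>b + 1\<close>.\<close>
  obtain a where a: "a > 0" "\<And>\<theta>. a \<le> support_angle A \<theta>" using support_angle_pos[OF A(1) origin(1)] by blast
  obtain b where b: "b > 0" "\<And>x. x \<in> A \<Longrightarrow> norm x \<le> b" using compact_imp_bounded[OF A(1)] by (meson bounded_pos)
  obtain W where W: "\<And>x y. a \<le> norm x \<Longrightarrow> norm x \<le> b + 1 \<Longrightarrow> a \<le> norm y \<Longrightarrow> norm y \<le> b + 1 \<Longrightarrow> \<bar>w x - w y\<bar> \<le> W * norm (x - y)"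
    using w_lipschitz[OF a(1)] by blast
  have nc_norm: "a \<le> norm (nc \<theta> r)" "norm (nc \<theta> r) \<le> b + 1" if "0 \<le> r" "r \<le> 1" for \<theta> r
  proof -
    have "a \<le> nc \<theta> r \<bullet> unit_vec \<theta>" using nc_unit_vec[of \<theta> r 0] a(2)[of \<theta>] that gap_0(1)[of \<theta>] by simp
    also have "\<dots> \<le> norm (nc \<theta> r) * norm (unit_vec \<theta>)" by (rule norm_cauchy_schwarz)
    finally show "a \<le> norm (nc \<theta> r)" by simp
    have "norm (nc \<theta> r) \<le> norm (bpoint \<theta>) + norm (r *\<^sub>R unit_vec \<theta>)" unfolding nc_def by (rule norm_triangle_ineq)
    then show "norm (nc \<theta> r) \<le> b + 1" using b(2)[OF bpoint_in[of \<theta>]] that by simp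
  qed
  have nc0: "nc \<theta> 0 = normal_point A \<theta>" for \<theta> by (simp add: nc_def normal_point_eq)
  define w1 where "w1 \<theta> = - deriv \<phi> (body_gauge L (normal_point A \<theta>))
      * (grad (body_gauge L) (normal_point A \<theta>) \<bullet> unit_vec \<theta>) * w (normal_point A \<theta>)" for \<theta>
  obtain m where m: "m > 0" "\<And>\<theta>. m \<le> support_angle B \<theta>" using support_angle_pos[OF B(1) origin(2)] by blast
  obtain m' where m': "m' > 0" "\<And>\<theta>. m' \<le> support_angle C \<theta>" using support_angle_pos[OF C(1) origin(3)] by blast
  obtain M1 where M1: "M1 > 0" "\<And>\<theta>. \<bar>support_angle B \<theta>\<bar> \<le> M1"
    "\<And>\<theta> \<psi>. \<bar>support_angle B \<theta> - support_angle B \<psi>\<bar> \<le> M1 * \<bar>\<theta> - \<psi>\<bar>"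
    using support_angle_lipschitz[OF B(1,3)] by blast
  obtain M2 where M2: "M2 > 0" "\<And>\<theta>. \<bar>support_angle C \<theta>\<bar> \<le> M2"
    "\<And>\<theta> \<psi>. \<bar>support_angle C \<theta> - support_angle C \<psi>\<bar> \<le> M2 * \<bar>\<theta> - \<psi>\<bar>"
    using support_angle_lipschitz[OF C(1,3)] by blast
  define M where "M = max M1 M2"
  \<comment> \<open>\<open>m\<close> bounds \<open>hB\<close> from below and \<open>M2\<close>
    bounds \<open>hC\<close> from above, so \<open>\<kappa> * hC \<le> m \<le> hB\<close>.\<close>
  define \<kappa> where "\<kappa> = min 1 (m / M2)"
  interpret mixed_density A h' f c1 c2 B C w w1 W M \<kappa> M
  proof unfold_locales
    fix \<theta> \<psi> :: real
    show "\<bar>support_angle B \<theta> - support_angle B \<psi>\<bar> \<le> M * \<bar>\<theta> - \<psi>\<bar>"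
      by (rule order_trans[OF M1(3)]) (auto simp: M_def intro: mult_right_mono)
    show "\<bar>support_angle C \<theta> - support_angle C \<psi>\<bar> \<le> M * \<bar>\<theta> - \<psi>\<bar>"
      by (rule order_trans[OF M2(3)]) (auto simp: M_def intro: mult_right_mono)
    show "0 \<le> support_angle B \<theta>" "0 \<le> support_angle C \<theta>" using m m' less_imp_le order_trans by blast+
    show "support_angle B \<theta> \<le> M" "support_angle C \<theta> \<le> M"
      using M1(2)[of \<theta>] M2(2)[of \<theta>] by (auto simp: M_def)
    show "0 < \<kappa>" "\<kappa> \<le> 1" using m M2 by (auto simp: \<kappa>_def)
    have "\<kappa> * support_angle C \<theta> \<le> m / M2 * M2"
      using m(1) M2(1) M2(2)[of \<theta>] by (intro mult_mono) (auto simp: \<kappa>_def abs_le_iff intro: order_trans[OF less_imp_le[OF m'(1)] m'(2)])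
    also have "\<dots> \<le> support_angle B \<theta>" using m(2) M2(1) by simp
    finally show "\<kappa> * support_angle C \<theta> \<le> support_angle B \<theta>" .
    show "((\<lambda>r. w (nc \<theta> r)) has_real_derivative w1 \<theta>) (at_right 0)"
    proof -
      have "normal_point A \<theta> \<noteq> 0" using nc_norm(1)[of 0 \<theta>] a(1) by (auto simp: nc0)
      from w_directional_derivative[OF this, of "unit_vec \<theta>"] show ?thesis
        by (simp add: nc_def normal_point_eq w1_def)
    qed
    fix r :: real assume r: "0 \<le> r" "r \<le> 1"
    have "norm (nc \<theta> r - nc \<theta> 0) = r" using r by (simp add: nc_def)
    then show "\<bar>w (nc \<theta> r) - w (nc \<theta> 0)\<bar> \<le> W * r"
      using W[OF nc_norm[OF r] nc_norm[OF order_refl zero_le_one], of \<theta> \<theta>] by simp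
  qed (use B C origin w_measurable w_bounds w_continuous in auto)
  \<comment> \<open>Stated for all real \<open>s\<close> and \<open>t\<close>, so that the measure
    can be rewritten as \<open>F\<close> as a function of both variables.\<close>
  have Q_compact: "compact (Q s t)" for s t
    unfolding Q_def by (intro compact_set_plus compact_scaling A B C)
  have \<mu>F: "measure \<mu> (A + (\<lambda>x. s *\<^sub>R x) ` B + (\<lambda>x. t *\<^sub>R x) ` C) = F s t" for s t
    unfolding \<mu>_def gauge_measure_def F_def Q_def[symmetric] w_def[symmetric]
    by (rule measure_density_compact[OF w_measurable w_bounds(1) Q_compact])
  have main: "set_integrable lebesgue {0..2*pi} g \<and> has_mixed_measure \<mu> A B C (LINT \<theta>:{0..2*pi}|lebesgue. g \<theta>)"
    if dB: "AE \<theta>\<in>{0..2*pi} in lebesgue. (support_angle B has_real_derivative hB' \<theta>) (at \<theta>)"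
      and dC: "AE \<theta>\<in>{0..2*pi} in lebesgue. (support_angle C has_real_derivative hC' \<theta>) (at \<theta>)"
      and g: "g = (\<lambda>\<theta>. exp (- \<phi> (body_gauge L (normal_point A \<theta>))) *
             (support_angle B \<theta> * support_angle C \<theta>
              - support_angle B \<theta> * support_angle C \<theta>
                * deriv \<phi> (body_gauge L (normal_point A \<theta>)) * curv_fun A \<theta>
                * (grad (body_gauge L) (normal_point A \<theta>) \<bullet> unit_vec \<theta>)
              - hB' \<theta> * hC' \<theta>))" for hB' hC' g
  proof -
    have g': "g = (\<lambda>\<theta>. w (nc \<theta> 0) * (hB \<theta> * hC \<theta> - hB' \<theta> * hC' \<theta>) + w1 \<theta> * f \<theta> * hB \<theta> * hC \<theta>)"
      unfolding g by (rule ext) (simp add: nc0 w_def w1_def curv_fun_eq algebra_simps)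
    have 1: "AE \<theta> in N. (hB has_real_derivative hB' \<theta>) (at \<theta>)" "AE \<theta> in N. (hC has_real_derivative hC' \<theta>) (at \<theta>)"
      using dB dC by (simp_all add: AE_restrict_space_iff)
    note res = mixed_right_derivative[OF 1, folded g']
    have "set_integrable lebesgue {0..2*pi} g"
      using res(1) unfolding set_integrable_def by (subst (asm) integrable_restrict_space) auto
    moreover have "integral\<^sup>L N g = (LINT \<theta>:{0..2*pi}|lebesgue. g \<theta>)"
      unfolding set_lebesgue_integral_def by (rule integral_restrict_space) simp
    ultimately show ?thesis using res(2) unfolding has_mixed_measure_def \<mu>F by simp
  qed
  show ?thesis
    unfolding Let_def using ae_diff[OF B(1,3)] ae_diff[OF C(1,3)] main[OF _ _ refl] by blast
qed

end
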